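(* If $\mu\in N(\mathscr X)$ then $\{8\mu,9\mu\}\subseteq N(\mathscr X)$.
   Context: A Latin square of order $n$ is an $n\times n$ matrix with row indices, column indices and symbols in $[n]=\{1,\dots,n\}$, each symbol occurring once in each row and column; arithmetic on elements of $[n]$ is modulo $n$ (with representatives in $[n]$). A subsquare of order $k$ of a matrix is a $k\times k$ submatrix (on any $k$ rows and $k$ columns) that is a Latin square; an intercalate is a subsquare of order $2$; a Latin square of order $n$ is $N_\infty$ if it has no subsquare of order in $\{2,\dots,n-1\}$. For a matrix $L$, a cell $(i,j)$ and a symbol $\sigma\ne L[i,j]$, $\sigma\hookrightarrow L[i,j]$ denotes the matrix obtained from $L$ by replacing the symbol in cell $(i,j)$ by $\sigma$. For distinct rows $i,j$ of a Latin square $L$, the row permutation $\tau_{i,j}$ is the permutation of symbols with $\tau_{i,j}(L[i,k])=L[j,k]$ for all columns $k$; if $C$ is the set of columns in which the symbols of a cycle of $\tau_{i,j}$ occur in row $i$, the entries of $L$ in cells $\{i,j\}\times C$ form a row cycle of length $|C|$, involving rows $i,j$, the columns in $C$ and the symbols of that cycle. For a Latin square $L$ of order $\mu$ and $s\in[\mu-1]$, and a positive integer $\alpha$, say $s$ is a strong allowable shift for order $\alpha$ if for every cell $(i,j)$, $i,j\in[\mu]$, the matrix $(L[i,j]+s)\hookrightarrow L[i,j]$ contains no subsquare of order $\alpha$. Let $\mathscr X$ be the set of pairs $(L,s)$ where $L$ is an $N_\infty$ Latin square of order $\mu\ge 10$ (rows, columns, symbols $[\mu]$) and $s\in[\mu-1]$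 such that: (i) $s$ is a strong allowable shift for order $8$ and for order $9$; (ii) $L$ contains a row cycle of length $3$ involving rows $x_1,x_2$, columns $y_1,y_2,y_3$ and symbols $z_1,z_2,z_3$, with $1\notin\{x_1,x_2,y_1,y_2,y_3\}$ and $L[1,1]+s\notin\{z_1,z_2,z_3\}$, and the matrix $L[x_2,y_3]\hookrightarrow L[x_1,y_3]$ contains no intercalate; (iii) there exist rows $r_1,r_2$, columns $c_1,c_2,c_3$ and a symbol $\sigma$ with $1\notin\{r_1,r_2,c_1,c_2,c_3\}$ such that, writing $\tau=\tau_{r_1,r_2}$, $L$ contains the entries $(r_1,c_1,\sigma),(r_2,c_1,\tau(\sigma)),(r_1,c_2,\tau(\sigma)),(r_2,c_2,\tau^2(\sigma)),(r_1,c_3,\tau^2(\sigma)),(r_2,c_3,\sigma+s)$; moreover the matrix $L[r_2,c_3]\hookrightarrow L[r_1,c_3]$ contains no intercalate, and neither $L[1,1]$ nor $L[1,1]+s$ lies in $\{\sigma,\tau(\sigma),\tau^2(\sigma),\sigma+s\}$. Define $N(\mathscr X)=\{\mu\in\mathbb Z:$ there is $(L,s)\in\mathscr X$ with $L$ of order $\mu\}$. *)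

theory Defs
  imports "HOL-Combinatorics.Orbits"
begin

text \<open>A square matrix of order \<open>n\<close> is a function of which only the values on
  \<open>{1..n} \<times> {1..n}\<close> are relevant; the order is always passed separately.\<close>

type_synonym matrix = "nat \<Rightarrow> nat \<Rightarrow> nat"

definition latin_on :: "nat set \<Rightarrow> nat set \<Rightarrow> nat set \<Rightarrow> matrix \<Rightarrow> bool" where
  "latin_on R C S M \<longleftrightarrow>
     finite R \<and> finite C \<and> finite S \<and> card R = card C \<and> card S = card C \<and>
     (\<forall>r\<in>R. \<forall>c\<in>C. M r c \<in> S) \<and>
     (\<forall>r\<in>R. \<forall>z\<in>S. \<exists>!c. c \<in> C \<and> M r c = z) \<and>
     (\<forall>c\<in>C. \<forall>z\<in>S. \<exists>!r. r \<in> R \<and> M r c = z)"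

definition latin_square :: "nat \<Rightarrow> matrix \<Rightarrow> bool" where
  "latin_square n L \<longleftrightarrow> latin_on {1..n} {1..n} {1..n} L"

definition has_subsquare :: "nat \<Rightarrow> matrix \<Rightarrow> nat \<Rightarrow> bool" where
  "has_subsquare n M k \<longleftrightarrow>
     (\<exists>R C S. R \<subseteq> {1..n} \<and> C \<subseteq> {1..n} \<and> card R = k \<and> card C = k \<and> latin_on R C S M)"

abbreviation has_intercalate :: "nat \<Rightarrow> matrix \<Rightarrow> bool" where
  "has_intercalate n M \<equiv> has_subsquare n M 2"

definition N_infinity :: "nat \<Rightarrow> matrix \<Rightarrow> bool" where
  "N_infinity n L \<longleftrightarrow> latin_square n L \<and> (\<forall>k\<in>{2..n-1}. \<not> has_subsquare n L k)"

text \<open>Addition modulo \<open>n\<close> with representatives in \<open>{1..n}\<close>; the arguments are positive,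
  so the subtraction does not truncate.\<close>

definition add_mod :: "nat \<Rightarrow> nat \<Rightarrow> nat \<Rightarrow> nat" where
  "add_mod n a b = (a + b - 1) mod n + 1"

definition replace :: "nat \<Rightarrow> matrix \<Rightarrow> nat \<Rightarrow> nat \<Rightarrow> matrix" where
  "replace z L i j = L(i := (L i)(j := z))"

definition row_perm :: "nat \<Rightarrow> matrix \<Rightarrow> nat \<Rightarrow> nat \<Rightarrow> nat \<Rightarrow> nat" where
  "row_perm n L i j z =
     (if z \<in> {1..n} then L j (THE k. k \<in> {1..n} \<and> L i k = z) else z)"

text \<open>\<open>C\<close> and \<open>Z\<close> are the columns and symbols of a row cycle in rows \<open>i\<close> and \<open>j\<close>;
  its length is \<open>card C\<close>.\<close>

definition row_cycle ::
    "nat \<Rightarrow> matrix \<Rightarrow> nat \<Rightarrow> nat \<Rightarrow> nat set \<Rightarrow> nat set \<Rightarrow> bool" where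
  "row_cycle n L i j C Z \<longleftrightarrow>
     i \<in> {1..n} \<and> j \<in> {1..n} \<and> i \<noteq> j \<and>
     Z \<subseteq> {1..n} \<and> cyclic_on (row_perm n L i j) Z \<and>
     C = {k \<in> {1..n}. L i k \<in> Z}"

definition strong_allowable_shift :: "nat \<Rightarrow> matrix \<Rightarrow> nat \<Rightarrow> nat \<Rightarrow> bool" where
  "strong_allowable_shift n L s \<alpha> \<longleftrightarrow>
     s \<in> {1..n-1} \<and>
     (\<forall>i\<in>{1..n}. \<forall>j\<in>{1..n}. \<not> has_subsquare n (replace (add_mod n (L i j) s) L i j) \<alpha>)"

definition cond_ii :: "nat \<Rightarrow> matrix \<Rightarrow> nat \<Rightarrow> bool" where
  "cond_ii n L s \<longleftrightarrow>
     (\<exists>x1 x2 y1 y2 y3 z1 z2 z3.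
        row_cycle n L x1 x2 {y1, y2, y3} {z1, z2, z3} \<and> card {y1, y2, y3} = 3 \<and>
        1 \<notin> {x1, x2, y1, y2, y3} \<and>
        add_mod n (L 1 1) s \<notin> {z1, z2, z3} \<and>
        \<not> has_intercalate n (replace (L x2 y3) L x1 y3))"

definition cond_iii :: "nat \<Rightarrow> matrix \<Rightarrow> nat \<Rightarrow> bool" where
  "cond_iii n L s \<longleftrightarrow>
     (\<exists>r1 r2 c1 c2 c3 \<sigma>.
        {r1, r2, c1, c2, c3, \<sigma>} \<subseteq> {1..n} \<and> r1 \<noteq> r2 \<and>
        1 \<notin> {r1, r2, c1, c2, c3} \<and>
        (let \<tau> = row_perm n L r1 r2 in
           L r1 c1 = \<sigma> \<and> L r2 c1 = \<tau> \<sigma> \<and>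
           L r1 c2 = \<tau> \<sigma> \<and> L r2 c2 = \<tau> (\<tau> \<sigma>) \<and>
           L r1 c3 = \<tau> (\<tau> \<sigma>) \<and> L r2 c3 = add_mod n \<sigma> s \<and>
           \<not> has_intercalate n (replace (L r2 c3) L r1 c3) \<and>
           L 1 1 \<notin> {\<sigma>, \<tau> \<sigma>, \<tau> (\<tau> \<sigma>), add_mod n \<sigma> s} \<and>
           add_mod n (L 1 1) s \<notin> {\<sigma>, \<tau> \<sigma>, \<tau> (\<tau> \<sigma>), add_mod n \<sigma> s}))"

text \<open>The pairs \<open>(L, s)\<close> of the family with \<open>L\<close> of order \<open>\<mu>\<close>.\<close>

definition X_family :: "nat \<Rightarrow> (matrix \<times> nat) set" where
  "X_family \<mu> = {(L, s).
     \<mu> \<ge> 10 \<and> N_infinity \<mu> L \<and> s \<in> {1..\<mu>-1} \<and>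
     strong_allowable_shift \<mu> L s 8 \<and> strong_allowable_shift \<mu> L s 9 \<and>
     cond_ii \<mu> L s \<and> cond_iii \<mu> L s}"

definition N_X :: "int set" where
  "N_X = {m. \<exists>\<mu> L s. m = int \<mu> \<and> (L, s) \<in> X_family \<mu>}"

end

theory Submission
  imports Defs
begin

text \<open>Let \<open>\<alpha> \<in> {8, 9}\<close> and let \<open>(L, s)\<close> be a member of the family of order \<open>\<mu>\<close>. On pairs of indices form
  the direct product of a fixed Latin square \<open>A\<close> of order \<open>\<alpha>\<close> with \<open>L\<close>, and corrupt it twice: the
  subsquare over the cell \<open>(1, 1)\<close> of \<open>L\<close> is refilled with a second square \<open>B\<close>, and the copy of \<open>L\<close> over
  the cell \<open>(0, 0)\<close> of \<open>A\<close> has its symbols shifted by \<open>s\<close>. The corrupted product \<open>P\<close> contains a row cycle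
  of length 3 that combines the broken cycle of condition (iii) for \<open>L\<close> with the 3-cycle between rows 0 and
  1 of \<open>A\<close>; switching it gives \<open>Q\<close>.

  Project a proper subsquare of \<open>Q\<close> to \<open>A\<close>. At most a few of its rows meet a cell in which the first
  coordinates do not multiply as in \<open>A\<close>. If three other rows lie over distinct rows of \<open>A\<close>, connectivity of
  the row permutations of \<open>A\<close> makes all fibres of the projection equally large, and the subsquare then is
  either everything, or yields a subsquare of \<open>L\<close>, or is a subsquare of order \<open>\<alpha>\<close> of \<open>L\<close> with one entry
  shifted by \<open>s\<close>, against the strong allowable shift. If they lie over at most two rows of \<open>A\<close>, the
  subsquare is so small, or its rows so special, that it would force a local configuration in \<open>A\<close> and \<open>B\<close>
  which the chosen tables avoid. The new shift \<open>3 * \<mu>\<close> changes only the first coordinate of a symbol, so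
  a replaced cell is one more exceptional cell in the same analysis, and the row cycle of condition (ii)
  for \<open>L\<close>, lifted along cells of \<open>A\<close>, gives conditions (ii) and (iii) for \<open>Q\<close>.\<close>

section \<open>Latin arrays\<close>

text \<open>In the plain product each cell of \<open>L\<close> carries a copy of \<open>A\<close>
  and each cell of \<open>A\<close> a copy of \<open>L\<close>. The shift over (0, 0) breaks every
  copy of \<open>A\<close> in one entry, and strong allowability of \<open>s\<close> prevents a new
  subsquare built from varying cells of \<open>L\<close>. Refilling with \<open>B\<close> breaks
  every copy of \<open>L\<close> but the one over (0, 0): there \<open>B 0 0 = 0 = A 0 0\<close> is
  forced, since the shift must keep the set of symbols with first coordinate 0 in each row. So the
  shifted copy of \<open>L\<close> survives as a subsquare of order \<mu>, and the switch is made to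
  break it: one of the two switched rows lies in this copy and the other does not. Each corruption
  makes a few cells exceptional; the conditions on the tables exclude small squares through such
  cells. The recursion closes because condition (iii) is used up by the switch, while the closed
  cycle of condition (ii) is the source of both (ii) and (iii) at the next order: for (iii) it is
  combined with a path in \<open>A\<close> that fails to close by 3, the leading digit of the new
  shift. Condition (i) at both orders leaves \<alpha> free in every step.\<close>

definition latin_array :: "'r set \<Rightarrow> 'c set \<Rightarrow> 's set \<Rightarrow> ('r \<Rightarrow> 'c \<Rightarrow> 's) \<Rightarrow> bool" where
  "latin_array R C S M \<longleftrightarrow> finite R \<and> finite C \<and>
     (\<forall>r\<in>R. bij_betw (M r) C S) \<and> (\<forall>c\<in>C. bij_betw (\<lambda>r. M r c) R S)"

lemma latin_array_transpose:
  "latin_array R C S M \<Longrightarrow> latin_array C R S (\<lambda>c r. M r c)"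
  by (auto simp: latin_array_def)

lemma latin_array_row: "latin_array R C S M \<Longrightarrow> r \<in> R \<Longrightarrow> bij_betw (M r) C S"
  and latin_array_col: "latin_array R C S M \<Longrightarrow> c \<in> C \<Longrightarrow> bij_betw (\<lambda>r. M r c) R S"
  and latin_array_finite: "latin_array R C S M \<Longrightarrow> finite R" "latin_array R C S M \<Longrightarrow> finite C"
  by (auto simp: latin_array_def)

lemma latin_array_mem: "latin_array R C S M \<Longrightarrow> r \<in> R \<Longrightarrow> c \<in> C \<Longrightarrow> M r c \<in> S"
  by (meson latin_array_row bij_betwE)

lemma latin_array_row_inj:
  "latin_array R C S M \<Longrightarrow> r \<in> R \<Longrightarrow> c \<in> C \<Longrightarrow> c' \<in> C \<Longrightarrow> M r c = M r c' \<Longrightarrow> c = c'"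
  by (meson latin_array_row bij_betw_imp_inj_on inj_onD)

lemma latin_array_col_inj:
  "latin_array R C S M \<Longrightarrow> r \<in> R \<Longrightarrow> r' \<in> R \<Longrightarrow> c \<in> C \<Longrightarrow> M r c = M r' c \<Longrightarrow> r = r'"
  by (rule latin_array_row_inj[OF latin_array_transpose])

lemma latin_array_row_surj:
  "latin_array R C S M \<Longrightarrow> r \<in> R \<Longrightarrow> z \<in> S \<Longrightarrow> \<exists>c\<in>C. M r c = z"
  by (metis latin_array_row bij_betw_imp_surj_on imageE)

lemma latin_array_col_surj:
  "latin_array R C S M \<Longrightarrow> c \<in> C \<Longrightarrow> z \<in> S \<Longrightarrow> \<exists>r\<in>R. M r c = z"
  by (rule latin_array_row_surj[OF latin_array_transpose])

lemma latin_array_card: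
  assumes "latin_array R C S M" "card R = k" "k > 0" "C \<noteq> {}"
  shows "card C = k" "card S = k" "finite S"
proof -
  obtain r where "r \<in> R" using assms(2,3) by fastforce
  then have r: "bij_betw (M r) C S" by (rule latin_array_row[OF assms(1)])
  obtain c where "c \<in> C" using assms(4) by blast
  then have c: "bij_betw (\<lambda>r. M r c) R S" by (rule latin_array_col[OF assms(1)])
  show "card S = k" using bij_betw_same_card[OF c] assms(2) by simp
  then show "card C = k" using bij_betw_same_card[OF r] by simp
  show "finite S" using bij_betw_finite[OF r] latin_array_finite(2)[OF assms(1)] by simp
qed

lemma latin_array_cong:
  assumes "latin_array R C S M" "\<And>r c. r \<in> R \<Longrightarrow> c \<in> C \<Longrightarrow> M r c = M' r c"
  shows "latin_array R C S M'"
proof -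
  have "bij_betw (M' r) C S" if "r \<in> R" for r
    using latin_array_row[OF assms(1) that] bij_betw_cong[of C "M r" "M' r" S] assms(2)[OF that]
    by blast
  moreover have "bij_betw (\<lambda>r. M' r c) R S" if "c \<in> C" for c
    using latin_array_col[OF assms(1) that] bij_betw_cong[of R "\<lambda>r. M r c" "\<lambda>r. M' r c" S]
      assms(2)[OF _ that] by blast
  ultimately show ?thesis using assms(1) unfolding latin_array_def by blast
qed

lemma latin_arrayI:
  assumes "finite R" "finite C" "card R = card S" "card C = card S" "finite S"
    and "\<And>r c. r \<in> R \<Longrightarrow> c \<in> C \<Longrightarrow> M r c \<in> S"
    and "\<And>r c c'. r \<in> R \<Longrightarrow> c \<in> C \<Longrightarrow> c' \<in> C \<Longrightarrow> M r c = M r c' \<Longrightarrow> c = c'"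
    and "\<And>r r' c. r \<in> R \<Longrightarrow> r' \<in> R \<Longrightarrow> c \<in> C \<Longrightarrow> M r c = M r' c \<Longrightarrow> r = r'"
  shows "latin_array R C S M"
proof -
  have "bij_betw (M r) C S" if "r \<in> R" for r
  proof -
    have i: "inj_on (M r) C" using assms(7) that by (meson inj_onI)
    moreover have "M r ` C \<subseteq> S" using assms(6) that by blast
    ultimately have "M r ` C = S" using assms(4,5) by (metis card_image card_subset_eq)
    with i show ?thesis by (simp add: bij_betw_def)
  qed
  moreover have "bij_betw (\<lambda>r. M r c) R S" if "c \<in> C" for c
  proof -
    have i: "inj_on (\<lambda>r. M r c) R" using assms(8) that by (meson inj_onI)
    moreover have "(\<lambda>r. M r c) ` R \<subseteq> S" using assms(6) that by blast
    ultimately have "(\<lambda>r. M r c) ` R = S" using assms(3,5) by (metis card_image card_subset_eq)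
    with i show ?thesis by (simp add: bij_betw_def)
  qed
  ultimately show ?thesis using assms(1,2) by (simp add: latin_array_def)
qed

text \<open>The subsquares studied below are indexed by pairs, while \<open>latin_on\<close> speaks
  of numbers. \<open>latin_array\<close> is free of index types and replaces unique existence by
  bijections, the form in which rows and fibres are compared.\<close>

lemma latin_on_imp_array:
  assumes "latin_on R C S M"
  shows "latin_array R C S M"
proof (rule latin_arrayI)
  show "finite R" "finite C" "card R = card S" "card C = card S" "finite S"
    using assms unfolding latin_on_def by auto
  have m: "\<forall>r\<in>R. \<forall>c\<in>C. M r c \<in> S" using assms unfolding latin_on_def by blast
  then show "\<And>r c. r \<in> R \<Longrightarrow> c \<in> C \<Longrightarrow> M r c \<in> S" by blast
  have "\<forall>r\<in>R. \<forall>z\<in>S. \<exists>!c. c \<in> C \<and> M r c = z" using assms unfolding latin_on_def by blast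
  then show "\<And>r c c'. r \<in> R \<Longrightarrow> c \<in> C \<Longrightarrow> c' \<in> C \<Longrightarrow> M r c = M r c' \<Longrightarrow> c = c'"
    using m by metis
  have "\<forall>c\<in>C. \<forall>z\<in>S. \<exists>!r. r \<in> R \<and> M r c = z" using assms unfolding latin_on_def by blast
  then show "\<And>r r' c. r \<in> R \<Longrightarrow> r' \<in> R \<Longrightarrow> c \<in> C \<Longrightarrow> M r c = M r' c \<Longrightarrow> r = r'"
    using m by metis
qed

lemma array_imp_latin_on:
  assumes "latin_array R C S M" "R \<noteq> {}" "C \<noteq> {}"
  shows "latin_on R C S M"
proof -
  have "card R > 0" using assms latin_array_finite by (metis card_gt_0_iff)
  note c = latin_array_card[OF assms(1) refl this assms(3)]
  have "\<exists>!c. c \<in> C \<and> M r c = z" if "r \<in> R" "z \<in> S" for r z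
    using latin_array_row_surj[OF assms(1) that] latin_array_row_inj[OF assms(1) that(1)] by metis
  moreover have "\<exists>!r. r \<in> R \<and> M r c = z" if "c \<in> C" "z \<in> S" for c z
    using latin_array_col_surj[OF assms(1) that] latin_array_col_inj[OF assms(1) _ _ that(1)] by metis
  ultimately show ?thesis unfolding latin_on_def
    using c latin_array_finite[OF assms(1)] latin_array_mem[OF assms(1)] by simp
qed

lemma has_subsquareI:
  assumes "latin_array R C S M" "R \<subseteq> {1..n}" "C \<subseteq> {1..n}" "card R = k" "k > 0" "C \<noteq> {}"
  shows "has_subsquare n M k"
  unfolding has_subsquare_def
  using array_imp_latin_on[OF assms(1)] latin_array_card(1)[OF assms(1,4,5,6)] assms by force

lemma has_subsquareE:
  assumes "has_subsquare n M k"
  obtains R C S where "latin_array R C S M" "R \<subseteq> {1..n}" "C \<subseteq> {1..n}" "card R = k" "card C = k"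
  using assms latin_on_imp_array unfolding has_subsquare_def by blast

text \<open>With two columns, the symbol of the cell (r, c) must recur in row r', and not in column
  c.\<close>

lemma latin_array_square:
  assumes "latin_array R C S M" "r \<in> R" "r' \<in> R" "r \<noteq> r'" "C = {c, c'}" "c \<noteq> c'"
  shows "M r c = M r' c'"
proof -
  obtain x where x: "x \<in> C" "M r' x = M r c"
    using latin_array_row_surj[OF assms(1,3)] latin_array_mem[OF assms(1,2)] assms(5) by blast
  then show ?thesis using assms latin_array_col_inj[OF assms(1), of r' r c] by auto
qed

text \<open>Row r is a bijection from C to S; where it lies over an injection \<open>a\<close>, it
  restricts to a bijection between the fibres over j and over \<open>a j\<close>. With first
  coordinates for \<open>f\<close> and \<open>h\<close> and a row of \<open>A\<close> for
  \<open>a\<close>, every row that multiplies as in \<open>A\<close> yields equations between fibre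
  sizes.\<close>

lemma latin_array_fibre:
  assumes "latin_array R C S M" "r \<in> R" "inj_on a Z" "j \<in> Z"
    and "\<And>c. c \<in> C \<Longrightarrow> f c \<in> Z \<and> h (M r c) = a (f c)"
  shows "card {z \<in> S. h z = a j} = card {c \<in> C. f c = j}"
proof -
  have b: "bij_betw (M r) C S" by (rule latin_array_row[OF assms(1,2)])
  have img: "M r ` {c \<in> C. f c = j} = {z \<in> S. h z = a j}"
  proof (intro set_eqI iffI)
    fix z assume "z \<in> M r ` {c \<in> C. f c = j}"
    then show "z \<in> {z \<in> S. h z = a j}" using assms latin_array_mem[OF assms(1,2)] by auto
  next
    fix z assume z: "z \<in> {z \<in> S. h z = a j}"
    then obtain c where c: "c \<in> C" "M r c = z" using latin_array_row_surj[OF assms(1,2)] by auto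
    then have "a (f c) = a j" using assms(5) z by force
    then have "f c = j" using assms(3,4,5) c by (meson inj_onD)
    then show "z \<in> M r ` {c \<in> C. f c = j}" using c by blast
  qed
  have "inj_on (M r) {c \<in> C. f c = j}"
    by (rule inj_on_subset[OF bij_betw_imp_inj_on[OF b]]) auto
  from card_image[OF this] show ?thesis unfolding img .
qed

text \<open>The last value of a bijection is forced. Hence an exceptional cell cannot be alone in
  its row or column once all fibres of the projection are singletons.\<close>

lemma bij_betw_agree_but_one:
  assumes "bij_betw f C Z" "bij_betw g C Z" "c \<in> C" "\<And>x. x \<in> C \<Longrightarrow> x \<noteq> c \<Longrightarrow> f x = g x"
  shows "f c = g c"
proof -
  have "f c \<in> g ` C" using assms(1,2,3) by (metis bij_betw_imp_surj_on image_eqI)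
  then obtain x where x: "x \<in> C" "f c = g x" by blast
  show ?thesis
  proof (cases "x = c")
    case False
    then have "f x = f c" using assms(4) x by simp
    then have "x = c" using assms(1,3) x by (meson bij_betw_imp_inj_on inj_onD)
    then show ?thesis using False by simp
  qed (use x in simp)
qed

lemma sum_card_fibres:
  fixes f :: "'a \<Rightarrow> nat"
  assumes "finite C" "\<And>c. c \<in> C \<Longrightarrow> f c < n"
  shows "card C = (\<Sum>j<n. card {c \<in> C. f c = j})"
proof -
  have "(\<Sum>j<n. card {c \<in> C. f c = j}) = (\<Sum>j<n. \<Sum>c | c \<in> C \<and> f c = j. 1)" by simp
  also have "\<dots> = (\<Sum>c\<in>C. 1)"
    using assms by (intro sum.group) auto
  finally show ?thesis by simp
qed

section \<open>The corrupted product\<close>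

text \<open>\<open>hole2\<close> and \<open>hole3\<close> say that writing \<open>v\<close> into cell \<open>(i\<^sub>0, j\<^sub>0)\<close> of \<open>A\<close> creates a subsquare of
  order 2 or 3 through that cell.\<close>

definition hole2 :: "(nat \<Rightarrow> nat \<Rightarrow> nat) \<Rightarrow> nat \<Rightarrow> nat \<Rightarrow> nat \<Rightarrow> nat \<Rightarrow> bool" where
  "hole2 A n i\<^sub>0 j\<^sub>0 v \<longleftrightarrow> (\<exists>i<n. \<exists>j<n. j \<noteq> j\<^sub>0 \<and> A i j\<^sub>0 = A i\<^sub>0 j \<and> A i j = v)"

definition hole3 :: "(nat \<Rightarrow> nat \<Rightarrow> nat) \<Rightarrow> nat \<Rightarrow> nat \<Rightarrow> nat \<Rightarrow> nat \<Rightarrow> bool" where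
  "hole3 A n i\<^sub>0 j\<^sub>0 v \<longleftrightarrow> (\<exists>i<n. \<exists>i'<n. \<exists>j<n. \<exists>j'<n. j \<noteq> j\<^sub>0 \<and> j' \<noteq> j\<^sub>0 \<and>
     A i j\<^sub>0 = A i\<^sub>0 j \<and> A i j = A i\<^sub>0 j' \<and> A i j' = v \<and>
     A i' j\<^sub>0 = A i\<^sub>0 j' \<and> A i' j = v \<and> A i' j' = A i\<^sub>0 j)"

text \<open>\<open>A_no2\<close> and \<open>A_conn\<close> control fibres: row permutations of
  \<open>A\<close> have no short cycles, and any two of them with a common source row generate a
  transitive group. The remaining conditions treat small squares through an exceptional cell.
  \<open>B_hole2a\<close> to \<open>B_hole2c\<close> concern order 2 with one further cell at the
  shifted position (0, 0), where the second coordinates give no information. The names with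
  \<open>sw\<close> concern the block of rows 0, 1 and columns 0, 1, 2 of \<open>A\<close> met by
  the switch; \<open>sw_hole33\<close> has two switched cells, \<open>sw_B\<close> a switched cell
  and a cell of \<open>B\<close>. \<open>sw_hole2\<close> spares the cell (0, 2) because the table
  of order 8 has a hole there, with rows 0, 6 and columns 2, 4; that cell is left to
  \<open>no_intercalate\<close>, a property of \<open>L\<close>.\<close>

locale corrupting_pair =
  fixes \<alpha> :: nat and A B :: "nat \<Rightarrow> nat \<Rightarrow> nat"
  assumes alpha: "\<alpha> = 8 \<or> \<alpha> = 9"
    and A_row: "i < \<alpha> \<Longrightarrow> bij_betw (A i) {..<\<alpha>} {..<\<alpha>}"
    and A_col: "j < \<alpha> \<Longrightarrow> bij_betw (\<lambda>i. A i j) {..<\<alpha>} {..<\<alpha>}"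
    and B_row: "i < \<alpha> \<Longrightarrow> bij_betw (B i) {..<\<alpha>} {..<\<alpha>}"
    and B_col: "j < \<alpha> \<Longrightarrow> bij_betw (\<lambda>i. B i j) {..<\<alpha>} {..<\<alpha>}"
    and B00: "B 0 0 = 0"
    and A0: "d < 3 \<Longrightarrow> A 0 d = d"
    and A1: "d < 3 \<Longrightarrow> A 1 d = (d + 1) mod 3"
    and AB: "i < \<alpha> \<Longrightarrow> j < \<alpha> \<Longrightarrow> (i, j) \<noteq> (0, 0) \<Longrightarrow> A i j \<noteq> B i j"
    and AB3: "i < \<alpha> \<Longrightarrow> j < \<alpha> \<Longrightarrow> A i j \<noteq> (B i j + 3) mod \<alpha>"
    and A_no2: "i < \<alpha> \<Longrightarrow> i' < \<alpha> \<Longrightarrow> i \<noteq> i' \<Longrightarrow> j < \<alpha> \<Longrightarrow> j' < \<alpha> \<Longrightarrow>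
        A i j' = A i' j \<Longrightarrow> A i' j' \<noteq> A i j"
    and B_no2: "i < \<alpha> \<Longrightarrow> i' < \<alpha> \<Longrightarrow> i \<noteq> i' \<Longrightarrow> j < \<alpha> \<Longrightarrow> j' < \<alpha> \<Longrightarrow>
        B i j' = B i' j \<Longrightarrow> B i' j' \<noteq> B i j"
    and A_conn: "i < \<alpha> \<Longrightarrow> i' < \<alpha> \<Longrightarrow> i'' < \<alpha> \<Longrightarrow> i \<noteq> i' \<Longrightarrow> i \<noteq> i'' \<Longrightarrow> i' \<noteq> i'' \<Longrightarrow>
        (\<And>j. j < \<alpha> \<Longrightarrow> (\<chi> :: nat \<Rightarrow> nat) (A i' j) = \<chi> (A i j)) \<Longrightarrow>
        (\<And>j. j < \<alpha> \<Longrightarrow> \<chi> (A i'' j) = \<chi> (A i j)) \<Longrightarrow> z < \<alpha> \<Longrightarrow> \<chi> z = \<chi> 0"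
    and B_conn: "i < \<alpha> \<Longrightarrow> i' < \<alpha> \<Longrightarrow> i'' < \<alpha> \<Longrightarrow> i \<noteq> i' \<Longrightarrow> i \<noteq> i'' \<Longrightarrow> i' \<noteq> i'' \<Longrightarrow>
        (\<And>j. j < \<alpha> \<Longrightarrow> (\<chi> :: nat \<Rightarrow> nat) (B i' j) = \<chi> (B i j)) \<Longrightarrow>
        (\<And>j. j < \<alpha> \<Longrightarrow> \<chi> (B i'' j) = \<chi> (B i j)) \<Longrightarrow> z < \<alpha> \<Longrightarrow> \<chi> z = \<chi> 0"
    and A_no4: "i < \<alpha> \<Longrightarrow> i' < \<alpha> \<Longrightarrow> l < \<alpha> \<Longrightarrow> i \<noteq> i' \<Longrightarrow> l \<noteq> i \<Longrightarrow> l \<noteq> i' \<Longrightarrow>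
        j\<^sub>0 < \<alpha> \<Longrightarrow> j\<^sub>1 < \<alpha> \<Longrightarrow> j\<^sub>2 < \<alpha> \<Longrightarrow> j\<^sub>3 < \<alpha> \<Longrightarrow>
        A i' j\<^sub>0 = A i j\<^sub>1 \<Longrightarrow> A i' j\<^sub>1 = A i j\<^sub>2 \<Longrightarrow> A i' j\<^sub>2 = A i j\<^sub>3 \<Longrightarrow> A i' j\<^sub>3 = A i j\<^sub>0 \<Longrightarrow>
        \<not> {A l j\<^sub>0, A l j\<^sub>1, A l j\<^sub>2} \<subseteq> {A i j\<^sub>0, A i j\<^sub>1, A i j\<^sub>2, A i j\<^sub>3}"
    and B_hole2a: "0 < i \<Longrightarrow> i < \<alpha> \<Longrightarrow> 0 < j \<Longrightarrow> j < \<alpha> \<Longrightarrow> A i j = 0 \<Longrightarrow> B 0 j \<noteq> A i 0"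
    and B_hole2b: "0 < i \<Longrightarrow> i < \<alpha> \<Longrightarrow> 0 < j \<Longrightarrow> j < \<alpha> \<Longrightarrow> A i j = 0 \<Longrightarrow> B i 0 \<noteq> A 0 j"
    and B_hole2c: "0 < i \<Longrightarrow> i < \<alpha> \<Longrightarrow> 0 < j \<Longrightarrow> j < \<alpha> \<Longrightarrow> A i 0 = A 0 j \<Longrightarrow> B i j \<noteq> 0"
    and B_hole3: "i < \<alpha> \<Longrightarrow> j < \<alpha> \<Longrightarrow> (i, j) \<noteq> (0, 0) \<Longrightarrow> \<not> hole3 A \<alpha> i j (B i j)"
    and sw_hole2: "b < 2 \<Longrightarrow> d < 3 \<Longrightarrow> (b, d) \<noteq> (0, 2) \<Longrightarrow> \<not> hole2 A \<alpha> b d (A (1 - b) d)"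
    and sw_hole2': "i < \<alpha> \<Longrightarrow> A i 2 = 0 \<Longrightarrow> A i 0 \<noteq> 0"
    and sw_hole3: "b < 2 \<Longrightarrow> d < 3 \<Longrightarrow> \<not> hole3 A \<alpha> b d (A (1 - b) d)"
    and sw_hole33: "b < 2 \<Longrightarrow> d < 3 \<Longrightarrow> d' < 3 \<Longrightarrow> d \<noteq> d' \<Longrightarrow> i < \<alpha> \<Longrightarrow> j < \<alpha> \<Longrightarrow>
        A i d = A (1 - b) d' \<Longrightarrow> A i d' = A b j \<Longrightarrow> A i j = A (1 - b) d \<Longrightarrow> i' < \<alpha> \<Longrightarrow>
        A i' d = A b j \<Longrightarrow> A i' d' = A (1 - b) d \<Longrightarrow> A i' j \<noteq> A (1 - b) d'"
    and sw_B: "b < 2 \<Longrightarrow> d < 3 \<Longrightarrow> l < \<alpha> \<Longrightarrow> j < \<alpha> \<Longrightarrow> i < \<alpha> \<Longrightarrow> (l, j) \<noteq> (0, 0) \<Longrightarrow>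
        A b j = A l d \<Longrightarrow> A (1 - b) d = A i j \<Longrightarrow> B l j \<noteq> A i d"
begin

lemma alpha_ge: "8 \<le> \<alpha>" "\<alpha> \<le> 9" "0 < \<alpha>" using alpha by auto

lemma A_less: "i < \<alpha> \<Longrightarrow> j < \<alpha> \<Longrightarrow> A i j < \<alpha>" using bij_betwE[OF A_row] by blast
lemma B_less: "i < \<alpha> \<Longrightarrow> j < \<alpha> \<Longrightarrow> B i j < \<alpha>" using bij_betwE[OF B_row] by blast
lemma A_row_inj: "i < \<alpha> \<Longrightarrow> j < \<alpha> \<Longrightarrow> j' < \<alpha> \<Longrightarrow> A i j = A i j' \<longleftrightarrow> j = j'"
  using bij_betw_imp_inj_on[OF A_row] by (auto dest: inj_onD)
lemma A_col_inj: "i < \<alpha> \<Longrightarrow> i' < \<alpha> \<Longrightarrow> j < \<alpha> \<Longrightarrow> A i j = A i' j \<longleftrightarrow> i = i'"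
  using bij_betw_imp_inj_on[OF A_col] by (auto dest: inj_onD)
lemma B_row_inj: "i < \<alpha> \<Longrightarrow> j < \<alpha> \<Longrightarrow> j' < \<alpha> \<Longrightarrow> B i j = B i j' \<longleftrightarrow> j = j'"
  using bij_betw_imp_inj_on[OF B_row] by (auto dest: inj_onD)
lemma B_col_inj: "i < \<alpha> \<Longrightarrow> i' < \<alpha> \<Longrightarrow> j < \<alpha> \<Longrightarrow> B i j = B i' j \<longleftrightarrow> i = i'"
  using bij_betw_imp_inj_on[OF B_col] by (auto dest: inj_onD)
lemma A_row_surj: "i < \<alpha> \<Longrightarrow> z < \<alpha> \<Longrightarrow> \<exists>j<\<alpha>. A i j = z"
  using bij_betw_imp_surj_on[OF A_row, of i] by (metis imageE lessThan_iff)
lemma A_col_surj: "j < \<alpha> \<Longrightarrow> z < \<alpha> \<Longrightarrow> \<exists>i<\<alpha>. A i j = z"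
  using bij_betw_imp_surj_on[OF A_col, of j] by (metis (no_types, lifting) imageE lessThan_iff)
lemma A00: "A 0 0 = 0" using A0[of 0] by simp

text \<open>The permutation of symbols from row i to row i' has no fixed point and, as
  \<open>A\<close> has no intercalate, no 2-cycle. So a nonempty closed set contains a cycle of
  length at least 3.\<close>

lemma closed_card_ge_3:
  assumes "i < \<alpha>" "i' < \<alpha>" "i \<noteq> i'" "Z \<subseteq> {..<\<alpha>}" "Z \<noteq> {}"
    and cl: "\<And>j. j < \<alpha> \<Longrightarrow> A i j \<in> Z \<Longrightarrow> A i' j \<in> Z"
  shows "3 \<le> card Z"
proof -
  obtain z where z: "z \<in> Z" using assms by blast
  obtain j where j: "j < \<alpha>" "A i j = z" using A_row_surj assms z by blast
  have 1: "A i' j \<in> Z" using cl j z by blast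
  then obtain j' where j': "j' < \<alpha>" "A i j' = A i' j" using A_row_surj[of i "A i' j"] assms by blast
  have 2: "A i' j' \<in> Z" using cl j' 1 by simp
  have "j \<noteq> j'" using j' j A_col_inj assms by auto
  then have "A i' j' \<noteq> A i' j" "A i' j' \<noteq> z" "A i' j \<noteq> z"
    using A_row_inj A_col_inj A_no2[of i i' j j'] assms j j' by auto
  then have "card {z, A i' j, A i' j'} = 3" by simp
  moreover have "{z, A i' j, A i' j'} \<subseteq> Z" using z 1 2 by blast
  moreover have "finite Z" using assms(4) finite_subset by blast
  ultimately show ?thesis by (metis card_mono)
qed

text \<open>Transitivity, obtained from \<open>A_conn\<close> for the indicator function of
  Z.\<close>

lemma closed3_full:
  assumes "i < \<alpha>" "i' < \<alpha>" "i'' < \<alpha>" "i \<noteq> i'" "i \<noteq> i''" "i' \<noteq> i''" "Z \<subseteq> {..<\<alpha>}" "Z \<noteq> {}"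
    and "\<And>j. j < \<alpha> \<Longrightarrow> A i' j \<in> Z \<longleftrightarrow> A i j \<in> Z"
    and "\<And>j. j < \<alpha> \<Longrightarrow> A i'' j \<in> Z \<longleftrightarrow> A i j \<in> Z"
  shows "Z = {..<\<alpha>}"
proof -
  have "(if z \<in> Z then 1 else 0) = (if 0 \<in> Z then 1 else 0 :: nat)" if "z < \<alpha>" for z
    using A_conn[OF assms(1-6), of "\<lambda>z. if z \<in> Z then 1 else 0" z] assms(9,10) that by auto
  then have "z \<in> Z \<longleftrightarrow> 0 \<in> Z" if "z < \<alpha>" for z using that by (metis one_neq_zero)
  then show ?thesis using assms(7,8) by blast
qed

lemma closed3_full_B:
  assumes "i < \<alpha>" "i' < \<alpha>" "i'' < \<alpha>" "i \<noteq> i'" "i \<noteq> i''" "i' \<noteq> i''" "Z \<subseteq> {..<\<alpha>}" "Z \<noteq> {}"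
    and "\<And>j. j < \<alpha> \<Longrightarrow> B i' j \<in> Z \<longleftrightarrow> B i j \<in> Z"
    and "\<And>j. j < \<alpha> \<Longrightarrow> B i'' j \<in> Z \<longleftrightarrow> B i j \<in> Z"
  shows "Z = {..<\<alpha>}"
proof -
  have "(if z \<in> Z then 1 else 0) = (if 0 \<in> Z then 1 else 0 :: nat)" if "z < \<alpha>" for z
    using B_conn[OF assms(1-6), of "\<lambda>z. if z \<in> Z then 1 else 0" z] assms(9,10) that by auto
  then have "z \<in> Z \<longleftrightarrow> 0 \<in> Z" if "z < \<alpha>" for z using that by (metis one_neq_zero)
  then show ?thesis using assms(7,8) by blast
qed

end

text \<open>\<open>c d\<close> and \<open>w d\<close> are the columns and symbols of the broken row cycle of condition (iii),
  with the final symbol \<open>\<sigma> + s\<close> placed first.\<close>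

locale corrupted_product = corrupting_pair +
  fixes \<mu> :: nat and L :: matrix and s r\<^sub>0 r\<^sub>1 \<sigma> :: nat and c w :: "nat \<Rightarrow> nat"
  assumes mu: "10 \<le> \<mu>"
    and Ninf: "N_infinity \<mu> L"
    and s: "s \<in> {1..\<mu> - 1}"
    and shift: "strong_allowable_shift \<mu> L s \<alpha>"
    and r01: "r\<^sub>0 \<in> {2..\<mu>}" "r\<^sub>1 \<in> {2..\<mu>}" "r\<^sub>0 \<noteq> r\<^sub>1"
    and c: "d < 3 \<Longrightarrow> c d \<in> {2..\<mu>}"
    and L00: "L r\<^sub>0 (c 0) = \<sigma>" "w 0 = add_mod \<mu> \<sigma> s"
    and L0: "0 < d \<Longrightarrow> d < 3 \<Longrightarrow> L r\<^sub>0 (c d) = w d"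
    and L1: "d < 3 \<Longrightarrow> L r\<^sub>1 (c d) = w ((d + 1) mod 3)"
    and w11: "d < 3 \<Longrightarrow> w d \<noteq> L 1 1"
    and no_intercalate: "\<not> has_intercalate \<mu> (replace (L r\<^sub>1 (c 2)) L r\<^sub>0 (c 2))"
begin

section \<open>The square \<open>L\<close>, its shift, and maps from \<open>A\<close> to
  \<open>L\<close>\<close>

definition sh :: "nat \<Rightarrow> nat" where "sh v = add_mod \<mu> v s"

lemma L_latin: "latin_array {1..\<mu>} {1..\<mu>} {1..\<mu>} L"
  using Ninf latin_on_imp_array unfolding N_infinity_def latin_square_def by blast

lemma L_mem: "x \<in> {1..\<mu>} \<Longrightarrow> y \<in> {1..\<mu>} \<Longrightarrow> L x y \<in> {1..\<mu>}"
  by (rule latin_array_mem[OF L_latin])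

lemma L_row_inj: "x \<in> {1..\<mu>} \<Longrightarrow> y \<in> {1..\<mu>} \<Longrightarrow> y' \<in> {1..\<mu>} \<Longrightarrow> L x y = L x y' \<longleftrightarrow> y = y'"
  using latin_array_row_inj[OF L_latin] by blast

lemma L_col_inj: "x \<in> {1..\<mu>} \<Longrightarrow> x' \<in> {1..\<mu>} \<Longrightarrow> y \<in> {1..\<mu>} \<Longrightarrow> L x y = L x' y \<longleftrightarrow> x = x'"
  using latin_array_col_inj[OF L_latin] by blast

lemma L_subsquare:
  assumes "latin_array X Y V L" "X \<subseteq> {1..\<mu>}" "Y \<subseteq> {1..\<mu>}" "Y \<noteq> {}" "X \<noteq> {}"
  shows "card X = 1 \<or> card X = \<mu>"
proof (rule ccontr)
  assume a: "\<not> ?thesis"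
  have "finite X" using assms(2) finite_subset by blast
  then have "card X > 0" using assms(5) by (simp add: card_gt_0_iff)
  moreover have "card X \<le> \<mu>" using card_mono[OF _ assms(2)] by simp
  ultimately have "card X \<in> {2..\<mu> - 1}" using a by auto
  then show False
    using has_subsquareI[OF assms(1,2,3) refl \<open>card X > 0\<close> assms(4)] Ninf
    unfolding N_infinity_def by blast
qed

lemma L_no_intercalate:
  assumes "x \<in> {1..\<mu>}" "x' \<in> {1..\<mu>}" "x \<noteq> x'" "y \<in> {1..\<mu>}" "y' \<in> {1..\<mu>}"
    "L x y' = L x' y"
  shows "L x' y' \<noteq> L x y"
proof
  assume e: "L x' y' = L x y"
  have "y \<noteq> y'" using assms L_col_inj by auto
  have "latin_array {x, x'} {y, y'} {L x y, L x y'} L"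
    by (rule latin_arrayI)
      (use assms e \<open>y \<noteq> y'\<close> L_row_inj L_col_inj in \<open>auto simp: card_insert_if\<close>)
  then have "card {x, x'} = 1 \<or> card {x, x'} = \<mu>"
    by (rule L_subsquare) (use assms in auto)
  then show False using assms(3) mu by simp
qed

lemma sh_mem: "v \<in> {1..\<mu>} \<Longrightarrow> sh v \<in> {1..\<mu>}"
  using mu by (auto simp: sh_def add_mod_def Suc_le_eq)

lemma sh_inj: assumes "v \<in> {1..\<mu>}" "v' \<in> {1..\<mu>}" "sh v = sh v'" shows "v = v'"
proof -
  have "a = b" if "a < \<mu>" "b < \<mu>" "a \<le> b" "(a + s) mod \<mu> = (b + s) mod \<mu>" for a b
  proof -
    have "\<mu> dvd (b + s) - (a + s)" using mod_eq_dvd_iff_nat[of "a + s" "b + s" \<mu>] that by auto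
    then have "\<mu> dvd b - a" by simp
    then show ?thesis using that nat_dvd_not_less[of "b - a" \<mu>] by fastforce
  qed
  note * = this
  have "((v - 1) + s) mod \<mu> = ((v' - 1) + s) mod \<mu>" using assms by (simp add: sh_def add_mod_def)
  moreover have "v - 1 < \<mu>" "v' - 1 < \<mu>" using assms by auto
  ultimately have "v - 1 = v' - 1"
    using *[of "v - 1" "v' - 1"] *[of "v' - 1" "v - 1"] by (metis nat_le_linear)
  then show ?thesis using assms(1,2) by auto
qed

lemma sh_neq: assumes "v \<in> {1..\<mu>}" shows "sh v \<noteq> v"
proof
  assume "sh v = v"
  then have "((v - 1) + s) mod \<mu> = v - 1" using assms by (simp add: sh_def add_mod_def)
  then show False using assms s mu by (cases "v - 1 + s < \<mu>") (auto simp: mod_if split: if_splits)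
qed

text \<open>This is the form a subarray takes when all fibres of its projection to \<open>A\<close>
  are singletons. If \<open>v\<close> is injective, the images of \<open>x\<close> and
  \<open>y\<close> form a subsquare of order \<alpha> of \<open>L\<close> with one entry shifted. If
  not, the level sets of \<open>x\<close>, \<open>y\<close> and \<open>v\<close> form blocks in
  \<open>A\<close>, which the connectivity of three rows makes trivial; but a constant map would
  have to send 0 both to a symbol and to its shift.\<close>

lemma no_homotopy:
  assumes x: "\<And>i. i < \<alpha> \<Longrightarrow> x i \<in> {1..\<mu>}" and y: "\<And>j. j < \<alpha> \<Longrightarrow> y j \<in> {1..\<mu>}"
    and h: "\<And>i j. i < \<alpha> \<Longrightarrow> j < \<alpha> \<Longrightarrow> (i, j) \<noteq> (0, 0) \<Longrightarrow> L (x i) (y j) = v (A i j)"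
    and h0: "sh (L (x 0) (y 0)) = v 0"
  shows False
proof (cases "inj_on v {..<\<alpha>}")
  case True
  note a = alpha_ge
  have vi: "v z = v z' \<longleftrightarrow> z = z'" if "z < \<alpha>" "z' < \<alpha>" for z z'
    using True that by (auto dest: inj_onD)
  have xi: "i = i'" if "i < \<alpha>" "i' < \<alpha>" "x i = x i'" for i i'
    using h[of i 1] h[of i' 1] that vi A_less A_col_inj a by auto
  have yi: "j = j'" if "j < \<alpha>" "j' < \<alpha>" "y j = y j'" for j j'
    using h[of 1 j] h[of 1 j'] that vi A_less A_row_inj a by auto
  define M where "M = replace (add_mod \<mu> (L (x 0) (y 0)) s) L (x 0) (y 0)"
  have M: "M (x i) (y j) = v (A i j)" if "i < \<alpha>" "j < \<alpha>" for i j
  proof (cases "i = 0 \<and> j = 0")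
    case True then show ?thesis using h0 A00 by (simp add: M_def replace_def sh_def)
  next
    case False
    then have "\<not> (x i = x 0 \<and> y j = y 0)" using xi yi that a by blast
    then have "M (x i) (y j) = L (x i) (y j)" by (auto simp: M_def replace_def)
    then show ?thesis using h that False by simp
  qed
  have cx: "card (x ` {..<\<alpha>}) = \<alpha>" "card (y ` {..<\<alpha>}) = \<alpha>" "card (v ` {..<\<alpha>}) = \<alpha>"
    using xi yi True by (auto simp: card_image inj_on_def)
  have "latin_array (x ` {..<\<alpha>}) (y ` {..<\<alpha>}) (v ` {..<\<alpha>}) M"
  proof (rule latin_arrayI)
    show "M r c \<in> v ` {..<\<alpha>}" if "r \<in> x ` {..<\<alpha>}" "c \<in> y ` {..<\<alpha>}" for r c
      using that M A_less by auto
    show "c = c'" if "r \<in> x ` {..<\<alpha>}" "c \<in> y ` {..<\<alpha>}" "c' \<in> y ` {..<\<alpha>}" "M r c = M r c'" for r c c'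
      using that M A_less vi A_row_inj by auto
    show "r = r'" if "r \<in> x ` {..<\<alpha>}" "r' \<in> x ` {..<\<alpha>}" "c \<in> y ` {..<\<alpha>}" "M r c = M r' c" for r r' c
      using that M A_less vi A_col_inj by auto
  qed (use cx in simp_all)
  then have "has_subsquare \<mu> M \<alpha>"
    by (rule has_subsquareI) (use x y cx a in auto)
  then show False using shift x[of 0] y[of 0] a
    unfolding strong_allowable_shift_def M_def by blast
next
  case False
  note a = alpha_ge
  obtain z z' where z: "z < \<alpha>" "z' < \<alpha>" "z \<noteq> z'" "v z = v z'" using False by (auto simp: inj_on_def)
  define Z where "Z = {u. u < \<alpha> \<and> v u = v z}"
  \<comment> \<open>The class \<open>G\<close> of i avoids row 0, so its rows have no shifted cell
    and all send \<open>H\<close> onto \<open>Z\<close>; also \<open>G\<close>, \<open>H\<close> and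
    \<open>Z\<close> have the same size. Two rows of \<open>G\<close> give \<open>Z\<close> three
    elements, hence \<open>G\<close> a third row; three rows make \<open>Z\<close> everything, and
    then \<open>G\<close> contains 0 after all.\<close>
  have xc: "x i = x 0" if i: "i < \<alpha>" for i
  proof (rule ccontr)
    assume ne: "x i \<noteq> x 0"
    then have i0: "i \<noteq> 0" by (cases "i = 0") simp_all
    define G where "G = {i'. i' < \<alpha> \<and> x i' = x i}"
    have G0: "i' \<noteq> 0 \<and> i' < \<alpha>" if "i' \<in> G" for i'
      using that ne by (cases "i' = 0") (simp_all add: G_def)
    obtain j where j: "j < \<alpha>" "A i j = z" using A_row_surj i z by blast
    define H where "H = {j'. j' < \<alpha> \<and> y j' = y j}"
    have row: "A i' j' \<in> Z \<longleftrightarrow> j' \<in> H" if "i' \<in> G" "j' < \<alpha>" for i' j'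
    proof -
      have "v (A i' j') = L (x i) (y j')" using h[of i' j'] G0[OF that(1)] that by (auto simp: G_def)
      moreover have "v z = L (x i) (y j)" using h[of i j] j i i0 by auto
      ultimately show ?thesis using that G0[OF that(1)] j i x y A_less L_row_inj
        by (auto simp: Z_def H_def)
    qed
    have "i \<in> G" using i by (simp add: G_def)
    have HZ: "card H = card Z"
    proof -
      have "A i ` H = Z"
      proof (intro set_eqI iffI)
        fix u assume "u \<in> A i ` H"
        then show "u \<in> Z" using row[OF \<open>i \<in> G\<close>] by (auto simp: H_def)
      next
        fix u assume u: "u \<in> Z"
        then obtain j' where "j' < \<alpha>" "A i j' = u" using A_row_surj[OF i] by (auto simp: Z_def)
        then show "u \<in> A i ` H" using row[OF \<open>i \<in> G\<close>] u by blast
      qed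
      moreover have "inj_on (A i) H" using A_row_inj i by (auto simp: inj_on_def H_def)
      ultimately show ?thesis by (metis card_image)
    qed
    have "{z, z'} \<subseteq> Z" "finite Z" using z by (auto simp: Z_def)
    then have Z2: "2 \<le> card Z" using z(3) card_mono[of Z "{z, z'}"] by simp
    have "\<not> H \<subseteq> {0}" using HZ Z2 card_mono[of "{0::nat}" H] by auto
    then obtain j' where j': "j' \<in> H" "j' \<noteq> 0" by auto
    have col: "A i' j' \<in> Z \<longleftrightarrow> i' \<in> G" if "i' < \<alpha>" for i'
    proof -
      have "v (A i' j') = L (x i') (y j)" using h[of i' j'] that j' by (auto simp: H_def)
      moreover have "v z = L (x i) (y j)" using h[of i j] j i i0 by auto
      ultimately show ?thesis using that j i x y A_less[of i' j'] j' L_col_inj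
        by (auto simp: Z_def H_def G_def)
    qed
    have "(\<lambda>i. A i j') ` G = Z"
    proof (intro set_eqI iffI)
      fix u assume "u \<in> (\<lambda>i. A i j') ` G"
      then show "u \<in> Z" using col G0 by blast
    next
      fix u assume u: "u \<in> Z"
      then obtain i' where "i' < \<alpha>" "A i' j' = u" using A_col_surj[of j' u] j' by (auto simp: Z_def H_def)
      then show "u \<in> (\<lambda>i. A i j') ` G" using col u by blast
    qed
    moreover have "inj_on (\<lambda>i. A i j') G" using A_col_inj j' by (auto simp: inj_on_def H_def G_def)
    ultimately have GZ: "card G = card Z" by (metis card_image)
    have "finite G" by (simp add: G_def)
    have Zs: "Z \<subseteq> {..<\<alpha>}" "Z \<noteq> {}" using z by (auto simp: Z_def)
    obtain i' where i': "i' \<in> G" "i' \<noteq> i"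
    proof -
      have "\<not> G \<subseteq> {i}" using GZ Z2 card_mono[of "{i}" G] by auto
      then show ?thesis using that by blast
    qed
    have "3 \<le> card Z"
      by (rule closed_card_ge_3[of i i']) (use i i' G0 row \<open>i \<in> G\<close> Zs in auto)
    then have "\<not> G \<subseteq> {i, i'}" using GZ card_mono[of "{i, i'}" G] i' by auto
    then obtain i'' where i'': "i'' \<in> G" "i'' \<noteq> i" "i'' \<noteq> i'" by blast
    have "Z = {..<\<alpha>}"
      by (rule closed3_full[of i i' i'']) (use i i' i'' G0 row \<open>i \<in> G\<close> Zs in auto)
    then have "card G = \<alpha>" using GZ by simp
    then have "G = {..<\<alpha>}" using card_subset_eq[of "{..<\<alpha>}" G] by (auto simp: G_def)
    then show False using G0 a by blast
  qed
  have vc: "v u = L (x 0) (y 1)" if "u < \<alpha>" for u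
  proof -
    \<comment> \<open>Column 1 contains every symbol and misses the shifted cell, which lies in
      column 0.\<close>
    have a1: "1 < \<alpha>" using a by linarith
    obtain i where i: "i < \<alpha>" "A i 1 = u" using A_col_surj[OF a1 \<open>u < \<alpha>\<close>] by blast
    then show ?thesis using h[OF i(1) a1] xc[OF i(1)] by simp
  qed
  have "L (x 0) (y 0) = v (A 1 0)" using h[of 1 0] xc[of 1] a by simp
  also have "\<dots> = v 0" using vc A_less[of 1 0] a by simp
  finally show False using h0 sh_neq[OF L_mem[OF x[of 0] y[of 0]]] a by simp
qed

section \<open>The product, its 3-cycle and the cycle switch\<close>

definition U :: "(nat \<times> nat) set" where "U = {..<\<alpha>} \<times> {1..\<mu>}"

definition P :: "nat \<times> nat \<Rightarrow> nat \<times> nat \<Rightarrow> nat \<times> nat" where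
  "P r x = ((if snd r = 1 \<and> snd x = 1 then B else A) (fst r) (fst x),
            (if fst r = 0 \<and> fst x = 0 then sh else id) (L (snd r) (snd x)))"

definition \<rho> :: "nat \<Rightarrow> nat \<times> nat" where "\<rho> b = (b, if b = 0 then r\<^sub>0 else r\<^sub>1)"
definition \<kappa> :: "nat \<Rightarrow> nat \<times> nat" where "\<kappa> d = (d, c d)"
definition \<epsilon> :: "nat \<Rightarrow> nat \<times> nat" where "\<epsilon> d = (d, w d)"

definition Q :: "nat \<times> nat \<Rightarrow> nat \<times> nat \<Rightarrow> nat \<times> nat" where
  "Q r x = P (if x \<in> \<kappa> ` {..<3} then if r = \<rho> 0 then \<rho> 1 else if r = \<rho> 1 then \<rho> 0 else r else r) x"

lemma U_iff: "r \<in> U \<longleftrightarrow> fst r < \<alpha> \<and> snd r \<in> {1..\<mu>}" by (cases r) (auto simp: U_def)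

lemma \<rho>_U: "b < 2 \<Longrightarrow> \<rho> b \<in> U" using r01 alpha_ge by (auto simp: U_iff \<rho>_def)
lemma \<kappa>_U: "d < 3 \<Longrightarrow> \<kappa> d \<in> U" using c[of d] alpha_ge by (auto simp: U_iff \<kappa>_def)
lemma snd_\<rho>: "snd (\<rho> b) \<noteq> 1" using r01 by (auto simp: \<rho>_def)
lemma snd_\<kappa>: "d < 3 \<Longrightarrow> snd (\<kappa> d) \<noteq> 1" using c[of d] by (auto simp: \<kappa>_def)
lemma \<kappa>_inj: "\<kappa> d = \<kappa> d' \<longleftrightarrow> d = d'" by (auto simp: \<kappa>_def)
lemma \<epsilon>_inj: "\<epsilon> d = \<epsilon> d' \<longleftrightarrow> d = d'" by (auto simp: \<epsilon>_def)
lemma \<rho>_01: "\<rho> 0 \<noteq> \<rho> 1" "\<rho> 1 \<noteq> \<rho> 0" by (auto simp: \<rho>_def)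

lemma P_mem: "r \<in> U \<Longrightarrow> x \<in> U \<Longrightarrow> P r x \<in> U"
  using A_less B_less L_mem sh_mem by (auto simp: U_iff P_def)

text \<open>A symbol over 0 in row 0 of \<open>A\<close> comes from column 0 of \<open>A\<close>, in
  the block of \<open>B\<close> as well, because \<open>A 0 0 = B 0 0 = 0\<close>. So the symbol
  tells whether it was shifted, and the shift can be undone in the two injectivity proofs
  below.\<close>

lemma P_0_iff:
  assumes "r \<in> U" "x \<in> U" "fst (P r x) = 0"
  shows "fst r = 0 \<longleftrightarrow> fst x = 0"
  using assms A00 B00 A_row_inj[of 0 _ 0] B_row_inj[of 0 _ 0] A_col_inj[of 0 _ 0] B_col_inj[of 0 _ 0]
    alpha_ge A_col_inj[of _ 0 0] B_col_inj[of _ 0 0]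
  by (auto simp: U_iff P_def split: if_splits)

lemma P_row_inj:
  assumes "r \<in> U" "x \<in> U" "x' \<in> U" "P r x = P r x'" shows "x = x'"
proof -
  have "fst x = 0 \<longleftrightarrow> fst x' = 0" if "fst r = 0"
  proof -
    have "fst (P r x) = 0 \<longleftrightarrow> fst x = 0" if "x \<in> U" for x
      using P_0_iff[OF assms(1) that] \<open>fst r = 0\<close> A00 B00 by (auto simp: P_def)
    then show ?thesis using assms by metis
  qed
  then have "L (snd r) (snd x) = L (snd r) (snd x')"
    using assms sh_inj[of "L (snd r) (snd x)" "L (snd r) (snd x')"] L_mem
    by (auto simp: P_def U_iff split: if_splits)
  then have y: "snd x = snd x'" using assms L_row_inj by (simp add: U_iff)
  then have "fst x = fst x'" using assms A_row_inj B_row_inj by (auto simp: P_def U_iff split: if_splits)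
  with y show ?thesis by (simp add: prod_eq_iff)
qed

lemma P_col_inj:
  assumes "x \<in> U" "r \<in> U" "r' \<in> U" "P r x = P r' x" shows "r = r'"
proof -
  have "fst r = 0 \<longleftrightarrow> fst r' = 0" if "fst x = 0"
  proof -
    have "fst (P r x) = 0 \<longleftrightarrow> fst r = 0" if "r \<in> U" for r
      using P_0_iff[OF that assms(1)] \<open>fst x = 0\<close> A00 B00 by (auto simp: P_def)
    then show ?thesis using assms by metis
  qed
  then have "L (snd r) (snd x) = L (snd r') (snd x)"
    using assms sh_inj[of "L (snd r) (snd x)" "L (snd r') (snd x)"] L_mem
    by (auto simp: P_def U_iff split: if_splits)
  then have y: "snd r = snd r'" using assms L_col_inj by (simp add: U_iff)
  then have "fst r = fst r'" using assms A_col_inj B_col_inj by (auto simp: P_def U_iff split: if_splits)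
  with y show ?thesis by (simp add: prod_eq_iff)
qed

text \<open>For d = 0 the cell lies over (0, 0), and the shift turns \<sigma> into
  \<open>w 0\<close>. This closes the cycle that is broken in \<open>L\<close>: rows 0 and 1 of
  \<open>A\<close> supply the matching 3-cycle of first coordinates.\<close>

lemma P_\<rho>0: "d < 3 \<Longrightarrow> P (\<rho> 0) (\<kappa> d) = \<epsilon> d"
  using L00 L0[of d] A0[of d] r01 by (auto simp: P_def \<rho>_def \<kappa>_def \<epsilon>_def sh_def)

lemma P_\<rho>1: "d < 3 \<Longrightarrow> P (\<rho> 1) (\<kappa> d) = \<epsilon> ((d + 1) mod 3)"
  using L1[of d] A1[of d] r01 by (auto simp: P_def \<rho>_def \<kappa>_def \<epsilon>_def)

lemma Q_\<rho>0: "d < 3 \<Longrightarrow> Q (\<rho> 0) (\<kappa> d) = \<epsilon> ((d + 1) mod 3)"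
  using P_\<rho>1 by (auto simp: Q_def)

lemma Q_\<rho>1: "d < 3 \<Longrightarrow> Q (\<rho> 1) (\<kappa> d) = \<epsilon> d"
  using P_\<rho>0 \<rho>_01 by (auto simp: Q_def)

lemma Q_eq_P: "x \<notin> \<kappa> ` {..<3} \<or> r \<noteq> \<rho> 0 \<and> r \<noteq> \<rho> 1 \<Longrightarrow> Q r x = P r x"
  by (auto simp: Q_def)

lemma Q_mem: "r \<in> U \<Longrightarrow> x \<in> U \<Longrightarrow> Q r x \<in> U"
  using P_mem \<rho>_U[of 0] \<rho>_U[of 1] by (auto simp: Q_def)

lemma Q_col_inj:
  assumes "x \<in> U" "r \<in> U" "r' \<in> U" "Q r x = Q r' x" shows "r = r'"
proof -
  define g where "g r = (if x \<in> \<kappa> ` {..<3} then if r = \<rho> 0 then \<rho> 1 else if r = \<rho> 1 then \<rho> 0 else r else r)" for r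
  have "g r = g r'"
  proof (rule P_col_inj[OF assms(1)])
    show "g r \<in> U" "g r' \<in> U" using assms \<rho>_U[of 0] \<rho>_U[of 1] by (auto simp: g_def)
    show "P (g r) x = P (g r') x" using assms(4) by (simp add: Q_def g_def)
  qed
  then show ?thesis using \<rho>_01 by (auto simp: g_def split: if_splits)
qed

text \<open>On the three columns of the cycle, the two switched rows have the same set of symbols in
  \<open>P\<close>. So every entry of \<open>Q\<close> there is an entry of \<open>P\<close> in the
  same row and another of these columns, and no symbol repeats.\<close>

lemma Q_row_inj:
  assumes "r \<in> U" "x \<in> U" "x' \<in> U" "Q r x = Q r x'" shows "x = x'"
proof -
  have one: "\<exists>x2\<in>\<kappa> ` {..<3}. Q r x = P r x2" if "x \<in> \<kappa> ` {..<3}" for x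
  proof -
    obtain d where d: "d < 3" "x = \<kappa> d" using \<open>x \<in> _\<close> by auto
    show ?thesis
    proof (cases "r = \<rho> 0")
      case True
      then have "Q r x = P r (\<kappa> ((d + 1) mod 3))" using Q_\<rho>0 P_\<rho>0 d by simp
      then show ?thesis by (metis imageI lessThan_iff mod_less_divisor zero_less_numeral)
    next
      case False
      show ?thesis
      proof (cases "r = \<rho> 1")
        case True
        have "((d + 2) mod 3 + 1) mod 3 = d" using d(1) by presburger
        then have "Q r x = P r (\<kappa> ((d + 2) mod 3))" using True Q_\<rho>1 P_\<rho>1[of "(d + 2) mod 3"] d by simp
        then show ?thesis by (metis imageI lessThan_iff mod_less_divisor zero_less_numeral)
      next
        case False
        then show ?thesis using \<open>r \<noteq> \<rho> 0\<close> \<open>x \<in> _\<close> d Q_eq_P by metis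
      qed
    qed
  qed
  have mix: False if "x \<in> \<kappa> ` {..<3}" "x' \<notin> \<kappa> ` {..<3}" "x' \<in> U" "Q r x = Q r x'" for x x'
  proof -
    obtain x2 where "x2 \<in> \<kappa> ` {..<3}" "Q r x = P r x2" using one[OF \<open>x \<in> _\<close>] by blast
    moreover have "Q r x' = P r x'" using that Q_eq_P by blast
    ultimately have "x2 = x'" using P_row_inj[OF assms(1), of x2 x'] that \<kappa>_U by auto
    then show False using \<open>x2 \<in> _\<close> that by simp
  qed
  show ?thesis
  proof (cases "x \<in> \<kappa> ` {..<3} \<or> x' \<in> \<kappa> ` {..<3}")
    case False
    then show ?thesis using P_row_inj[OF assms(1-3)] assms(4) Q_eq_P by simp
  next
    case True
    then have b: "x \<in> \<kappa> ` {..<3}" "x' \<in> \<kappa> ` {..<3}" using mix[OF _ _ assms(3,4)] mix[OF _ _ assms(2) assms(4)[symmetric]] by blast+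
    then obtain d d' where d: "d < 3" "x = \<kappa> d" "d' < 3" "x' = \<kappa> d'" by auto
    consider "r = \<rho> 0" | "r = \<rho> 1" | "r \<noteq> \<rho> 0" "r \<noteq> \<rho> 1" by blast
    then show ?thesis
    proof cases
      case 1
      then have "(d + 1) mod 3 = (d' + 1) mod 3" using Q_\<rho>0[of d] Q_\<rho>0[of d'] d assms(4) by (simp add: \<epsilon>_inj)
      then have "d = d'" using d by (auto simp: mod_Suc split: if_splits)
      then show ?thesis using d by simp
    next
      case 2
      then show ?thesis using Q_\<rho>1[of d] Q_\<rho>1[of d'] d assms(4) by (simp add: \<epsilon>_inj)
    next
      case 3
      then show ?thesis using P_row_inj[OF assms(1-3)] assms(4) Q_eq_P by simp
    qed
  qed
qed

end

section \<open>Subsquares of the corrupted product\<close>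

text \<open>A Latin subarray of the product after the cycle switch (the switch being recorded only through
  the symbols that can occur in the affected cells), possibly with one cell of \<open>St\<close> changed in its
  first coordinate.\<close>

locale product_subarray = corrupted_product +
  fixes R C S :: "(nat \<times> nat) set" and M :: "nat \<times> nat \<Rightarrow> nat \<times> nat \<Rightarrow> nat \<times> nat"
    and St :: "((nat \<times> nat) \<times> nat \<times> nat) set"
  assumes lat: "latin_array R C S M"
    and RU: "R \<subseteq> U" and CU: "C \<subseteq> U"
    and two: "2 \<le> card R" and Cne: "C \<noteq> {}"
    and St1: "p \<in> St \<Longrightarrow> q \<in> St \<Longrightarrow> p = q"
    and M_snd: "r \<in> R \<Longrightarrow> x \<in> C \<Longrightarrow> \<not> (r \<in> \<rho> ` {..<2} \<and> x \<in> \<kappa> ` {..<3}) \<Longrightarrow> snd (M r x) = snd (P r x)"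
    and M_sw: "r \<in> R \<Longrightarrow> x \<in> C \<Longrightarrow> r \<in> \<rho> ` {..<2} \<Longrightarrow> x \<in> \<kappa> ` {..<3} \<Longrightarrow> snd (M r x) \<in> w ` {..<3}"
    and M_fst: "r \<in> R \<Longrightarrow> x \<in> C \<Longrightarrow> (r, x) \<notin> St \<Longrightarrow> \<not> (r \<in> \<rho> ` {..<2} \<and> x \<in> \<kappa> ` {..<3}) \<Longrightarrow>
        fst (M r x) = fst (P r x)"
    and M_less: "r \<in> R \<Longrightarrow> x \<in> C \<Longrightarrow> fst (M r x) < \<alpha>"
begin

text \<open>Serves both as a row and as a column: the cell \<open>(\<omega>, \<omega>)\<close> is
  where the block of \<open>B\<close> meets the shifted copy of \<open>L\<close>. Its first
  coordinate obeys both \<open>A\<close> and \<open>B\<close>, but its symbol does not lie over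
  \<open>L 1 1\<close>.\<close>

definition \<omega> :: "nat \<times> nat" where "\<omega> = (0, 1)"

lemma fst_\<omega>: "fst \<omega> = 0" and snd_\<omega>: "snd \<omega> = 1" by (auto simp: \<omega>_def)
lemma eq_\<omega>: "r = \<omega> \<longleftrightarrow> fst r = 0 \<and> snd r = 1" by (auto simp: \<omega>_def prod_eq_iff)

definition k :: nat where "k = card R"

lemma cards: "card R = k" "card C = k" "card S = k" "finite R" "finite C" "finite S" "2 \<le> k"
  using latin_array_card[OF lat k_def[symmetric] _ Cne] latin_array_finite[OF lat] two
  by (auto simp: k_def)

lemma Rne: "R \<noteq> {}" using two by auto

lemma S_less: "z \<in> S \<Longrightarrow> fst z < \<alpha>"
  using latin_array_row_surj[OF lat] Rne M_less by blast
lemma R_less: "r \<in> R \<Longrightarrow> fst r < \<alpha> \<and> snd r \<in> {1..\<mu>}" using RU U_iff by blast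
lemma C_less: "x \<in> C \<Longrightarrow> fst x < \<alpha> \<and> snd x \<in> {1..\<mu>}" using CU U_iff by blast

section \<open>The part of a subarray in the block over the cell (1, 1) of \<open>L\<close>\<close>

definition R1 where "R1 = {r \<in> R. snd r = 1}"
definition C1 where "C1 = {x \<in> C. snd x = 1}"
definition S1 where "S1 = {z \<in> S. snd z = L 1 1}"

lemma R1_iff: "r \<in> R1 \<longleftrightarrow> r \<in> R \<and> snd r = 1" and C1_iff: "x \<in> C1 \<longleftrightarrow> x \<in> C \<and> snd x = 1"
  and S1_iff: "z \<in> S1 \<longleftrightarrow> z \<in> S \<and> snd z = L 1 1"
  by (auto simp: R1_def C1_def S1_def)

lemma fin1: "finite R1" "finite C1" "finite S1"
  using cards by (auto simp: R1_def C1_def S1_def)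

lemma one_mem: "1 \<in> {1..\<mu>}" using mu by simp

lemma not_sw: "snd r = 1 \<or> snd x = 1 \<Longrightarrow> \<not> (r \<in> \<rho> ` {..<2} \<and> x \<in> \<kappa> ` {..<3})"
  using snd_\<rho> snd_\<kappa> by auto

lemma corner_snd: "r \<in> R1 \<Longrightarrow> x \<in> C1 \<Longrightarrow> (r, x) \<noteq> (\<omega>,\<omega>) \<Longrightarrow> snd (M r x) = L 1 1"
  using M_snd[of r x] not_sw[of r x] by (auto simp: R1_iff C1_iff P_def eq_\<omega>)

lemma omega_snd: "\<omega> \<in> R \<Longrightarrow> \<omega> \<in> C \<Longrightarrow> snd (M \<omega> \<omega>) \<noteq> L 1 1"
  using M_snd[of "\<omega>" "\<omega>"] not_sw[of "\<omega>" "\<omega>"] sh_neq[OF L_mem[OF one_mem one_mem]]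
  by (auto simp: P_def fst_\<omega> snd_\<omega>)

text \<open>In row 1 of \<open>L\<close> the symbol \<open>L 1 1\<close> occurs only in column 1, so
  a further occurrence must be the work of the shift.\<close>

lemma row_L11:
  assumes "r \<in> R1" "x \<in> C" "snd (M r x) = L 1 1" "x \<notin> C1"
  shows "fst r = 0 \<and> fst x = 0"
proof (rule ccontr)
  assume "\<not> ?thesis"
  then have "L 1 (snd x) = L 1 1"
    using assms M_snd[of r x] not_sw[of r x] by (auto simp: R1_iff P_def split: if_splits)
  then have "snd x = 1" using L_row_inj[OF one_mem _ one_mem] C_less[OF assms(2)] by blast
  then show False using assms by (simp add: C1_iff)
qed

lemma col_L11:
  assumes "x \<in> C1" "r \<in> R" "snd (M r x) = L 1 1" "r \<notin> R1"
  shows "fst r = 0 \<and> fst x = 0"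
proof (rule ccontr)
  assume "\<not> ?thesis"
  then have "L (snd r) 1 = L 1 1"
    using assms M_snd[of r x] not_sw[of r x] by (auto simp: C1_iff P_def split: if_splits)
  then have "snd r = 1" using L_col_inj[OF _ one_mem one_mem] R_less[OF assms(2)] by blast
  then show False using assms by (simp add: R1_iff)
qed

text \<open>A row of the block other than \<omega> has nonzero first coordinate, hence no shifted
  cell; all its symbols over \<open>L 1 1\<close> are then inside the block.\<close>

lemma row_bij1:
  assumes "r \<in> R1" "r \<noteq> \<omega>" shows "bij_betw (M r) C1 S1"
proof -
  have r: "r \<in> R" "fst r \<noteq> 0" using assms by (auto simp: R1_iff eq_\<omega>)
  have "M r ` C1 = S1"
  proof (intro set_eqI iffI)
    fix z assume "z \<in> M r ` C1"
    then show "z \<in> S1" using corner_snd[OF assms(1)] assms latin_array_mem[OF lat r(1)]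
      by (auto simp: S1_iff C1_iff)
  next
    fix z assume z: "z \<in> S1"
    then obtain x where "x \<in> C" "M r x = z" using latin_array_row_surj[OF lat r(1)] S1_iff by blast
    then show "z \<in> M r ` C1" using row_L11[OF assms(1), of x] r z S1_iff by auto
  qed
  moreover have "inj_on (M r) C1"
    using latin_array_row_inj[OF lat r(1)] by (auto simp: inj_on_def C1_iff)
  ultimately show ?thesis by (simp add: bij_betw_def)
qed

lemma col_bij1:
  assumes "x \<in> C1" "x \<noteq> \<omega>" shows "bij_betw (\<lambda>r. M r x) R1 S1"
proof -
  have x: "x \<in> C" "fst x \<noteq> 0" using assms by (auto simp: C1_iff eq_\<omega>)
  have "(\<lambda>r. M r x) ` R1 = S1"
  proof (intro set_eqI iffI)
    fix z assume "z \<in> (\<lambda>r. M r x) ` R1"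
    then show "z \<in> S1" using corner_snd[OF _ assms(1)] assms latin_array_mem[OF lat _ x(1)]
      by (auto simp: S1_iff R1_iff)
  next
    fix z assume z: "z \<in> S1"
    then obtain r where "r \<in> R" "M r x = z" using latin_array_col_surj[OF lat x(1)] S1_iff by blast
    then show "z \<in> (\<lambda>r. M r x) ` R1" using col_L11[OF assms(1), of r] x z S1_iff by auto
  qed
  moreover have "inj_on (\<lambda>r. M r x) R1"
    using latin_array_col_inj[OF lat _ _ x(1)] by (auto simp: inj_on_def R1_iff)
  ultimately show ?thesis by (simp add: bij_betw_def)
qed

lemma fst_inj1: "inj_on fst R1" "inj_on fst C1" "inj_on fst S1"
  by (auto simp: inj_on_def R1_iff C1_iff S1_iff prod_eq_iff)

text \<open>In row \<omega> the corner misses \<open>S1\<close>, so the columns of \<open>C1\<close>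
  supply at most \<open>card S1 - 1\<close> of its symbols. The missing one occurs outside the
  block, by \<open>row_L11\<close> in the shifted copy, where first coordinates are 0. Thus the
  corner behaves as if it held the entry 0 of \<open>B\<close>.\<close>

lemma zero_S1_row:
  assumes "\<omega> \<in> R" "\<omega> \<in> C" "card C1 = card S1" "\<And>x. x \<in> C \<Longrightarrow> x \<notin> C1 \<Longrightarrow> (\<omega>, x) \<notin> St"
  shows "0 \<in> fst ` S1"
proof -
  have o: "\<omega> \<in> R1" "\<omega> \<in> C1" using assms(1,2) by (auto simp: R1_iff C1_iff snd_\<omega>)
  let ?I = "M \<omega> ` (C1 - {\<omega>})"
  have "card ?I \<le> card (C1 - {\<omega>})" by (rule card_image_le) (use fin1 in simp)
  also have "\<dots> < card S1" using card_Diff1_less[OF fin1(2) o(2)] assms(3) by simp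
  finally have "\<not> S1 \<subseteq> ?I" using card_mono[of ?I S1] fin1 by auto
  then obtain z where z: "z \<in> S1" "z \<notin> ?I" by blast
  then obtain x where x: "x \<in> C" "M \<omega> x = z"
    using latin_array_row_surj[OF lat assms(1)] S1_iff by blast
  have "x \<noteq> \<omega>" using omega_snd[OF assms(1,2)] z x by (auto simp: S1_iff)
  then have "x \<notin> C1" using z x by auto
  then have "fst x = 0" using row_L11[OF o(1) x(1)] z x by (auto simp: S1_iff)
  then have "fst z = 0"
    using M_fst[OF assms(1) x(1)] assms(4)[OF x(1) \<open>x \<notin> C1\<close>] not_sw[of "\<omega>" x] x A00 B00
    by (auto simp: P_def fst_\<omega> snd_\<omega>)
  then show ?thesis using z by force
qed

text \<open>The same along the column \<omega>. The single cell of \<open>St\<close> can spoil at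
  most one of the two arguments.\<close>

lemma zero_S1_col:
  assumes "\<omega> \<in> R" "\<omega> \<in> C" "card R1 = card S1" "\<And>r. r \<in> R \<Longrightarrow> r \<notin> R1 \<Longrightarrow> (r, \<omega>) \<notin> St"
  shows "0 \<in> fst ` S1"
proof -
  have o: "\<omega> \<in> R1" "\<omega> \<in> C1" using assms(1,2) by (auto simp: R1_iff C1_iff snd_\<omega>)
  let ?I = "(\<lambda>r. M r \<omega>) ` (R1 - {\<omega>})"
  have "card ?I \<le> card (R1 - {\<omega>})" by (rule card_image_le) (use fin1 in simp)
  also have "\<dots> < card S1" using card_Diff1_less[OF fin1(1) o(1)] assms(3) by simp
  finally have "\<not> S1 \<subseteq> ?I" using card_mono[of ?I S1] fin1 by auto
  then obtain z where z: "z \<in> S1" "z \<notin> ?I" by blast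
  then obtain r where r: "r \<in> R" "M r \<omega> = z"
    using latin_array_col_surj[OF lat assms(2)] S1_iff by blast
  have "r \<noteq> \<omega>" using omega_snd[OF assms(1,2)] z r by (auto simp: S1_iff)
  then have "r \<notin> R1" using z r by auto
  then have "fst r = 0" using col_L11[OF o(2) r(1)] z r by (auto simp: S1_iff)
  then have "fst z = 0"
    using M_fst[OF r(1) assms(2)] assms(4)[OF r(1) \<open>r \<notin> R1\<close>] not_sw[of r "\<omega>"] r A00 B00
    by (auto simp: P_def fst_\<omega> snd_\<omega>)
  then show ?thesis using z by force
qed

lemma corner_fst:
  assumes "r \<in> R1" "x \<in> C1" "(r, x) \<notin> St" shows "fst (M r x) = B (fst r) (fst x)"
  using assms M_fst[of r x] not_sw[of r x] by (auto simp: R1_iff C1_iff P_def)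

text \<open>The first coordinates of the block form a subarray of \<open>B\<close>; at the corner
  the value \<open>B 0 0 = 0\<close> is available by the two preceding lemmas. As \<open>B\<close>
  has no intercalate and three of its rows are connected, such a subarray has at most one cell
  besides the corner or is the full block. A changed cell of \<open>St\<close> spoils one row, and
  this adds the orders 2 and 3.\<close>

lemma corner_cases:
  "(\<exists>p. \<forall>r\<in>R1. \<forall>x\<in>C1. (r, x) = (\<omega>,\<omega>) \<or> (r, x) = p) \<or>
   (card R1 = \<alpha> \<and> card C1 = \<alpha> \<and> card S1 = \<alpha>) \<or>
   (card R1 \<in> {2, 3} \<and> card C1 = card R1 \<and> card S1 = card R1 \<and>
     (\<exists>p\<in>St. fst p \<in> R1 \<and> snd p \<in> C1 \<and> p \<noteq> (\<omega>,\<omega>)) \<and> (\<forall>r\<in>R1. \<forall>x\<in>C1. fst (M r x) \<in> fst ` S1))"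
proof (cases "\<exists>p. \<forall>r\<in>R1. \<forall>x\<in>C1. (r, x) = (\<omega>,\<omega>) \<or> (r, x) = p")
  case False
  have F: "\<exists>r x. r \<in> R1 \<and> x \<in> C1 \<and> (r, x) \<noteq> (\<omega>,\<omega>) \<and> (r, x) \<noteq> p" for p
  proof (rule ccontr)
    assume "\<not> ?thesis"
    then have "\<forall>r\<in>R1. \<forall>x\<in>C1. (r, x) = (\<omega>,\<omega>) \<or> (r, x) = p" by blast
    then show False using False by (rule notE[OF _ exI, rotated])
  qed
  obtain r0 x0 where p0: "r0 \<in> R1" "x0 \<in> C1" "(r0, x0) \<noteq> (\<omega>,\<omega>)"
    using F[of "(\<omega>,\<omega>)"] by (elim exE conjE)
  obtain r1 x1 where
    p1: "r1 \<in> R1" "x1 \<in> C1" "(r1, x1) \<noteq> (\<omega>,\<omega>)" "(r1, x1) \<noteq> (r0, x0)"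
    using F[of "(r0, x0)"] by (elim exE conjE)
  have exr: "\<exists>r\<in>R1. r \<noteq> \<omega>"
  proof (rule ccontr)
    assume "\<not> ?thesis"
    then have "R1 \<subseteq> {\<omega>}" by blast
    then have "R1 = {\<omega>}" using p0(1) by (metis empty_iff subset_singletonD)
    then have r01: "r0 = \<omega>" "r1 = \<omega>" using p0(1) p1(1) by simp_all
    have r: "r0 = \<omega>" "r1 = \<omega>" "x0 \<noteq> \<omega>" "x1 \<noteq> x0" using r01 p0(3) p1(4) by simp_all
    have "card S1 = 1" using bij_betw_same_card[OF col_bij1[OF p0(2) r(3)]] \<open>R1 = _\<close> by simp
    moreover have "M r0 x0 \<in> S1" "M r0 x1 \<in> S1"
      using corner_snd[OF p0] corner_snd[OF p1(1-3)] p0(1,2) p1(1,2) r(1,2) latin_array_mem[OF lat]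
      by (simp_all add: S1_iff R1_iff C1_iff)
    ultimately have "M r0 x0 = M r0 x1" by (metis card_1_singletonE singletonD)
    then show False
      using r(4) latin_array_row_inj[OF lat, of r0 x0 x1] p0(1,2) p1(2) by (simp add: R1_iff C1_iff)
  qed
  have exc: "\<exists>x\<in>C1. x \<noteq> \<omega>"
  proof (rule ccontr)
    assume "\<not> ?thesis"
    then have "C1 \<subseteq> {\<omega>}" by blast
    then have "C1 = {\<omega>}" using p0(2) by (metis empty_iff subset_singletonD)
    then have x01: "x0 = \<omega>" "x1 = \<omega>" using p0(2) p1(2) by simp_all
    have r: "x0 = \<omega>" "x1 = \<omega>" "r0 \<noteq> \<omega>" "r1 \<noteq> r0" using x01 p0(3) p1(4) by simp_all
    have "card S1 = 1" using bij_betw_same_card[OF row_bij1[OF p0(1) r(3)]] \<open>C1 = _\<close> by simp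
    moreover have "M r0 x0 \<in> S1" "M r1 x0 \<in> S1"
      using corner_snd[OF p0] corner_snd[OF p1(1-3)] p0(1,2) p1(1,2) r(1,2) latin_array_mem[OF lat]
      by (simp_all add: S1_iff R1_iff C1_iff)
    ultimately have "M r0 x0 = M r1 x0" by (metis card_1_singletonE singletonD)
    then show False
      using r(4) latin_array_col_inj[OF lat, of r0 r1 x0] p0(1,2) p1(1) by (simp add: R1_iff C1_iff)
  qed
  define n where "n = card R1"
  have cS: "card S1 = n" using exc col_bij1 bij_betw_same_card n_def by metis
  have cC: "card C1 = n" using exr row_bij1 bij_betw_same_card cS by metis
  have n2: "2 \<le> n"
  proof (rule ccontr)
    assume "\<not> ?thesis"
    moreover have "n > 0" using p0(1) fin1(1) card_gt_0_iff n_def by blast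
    ultimately have "card R1 = 1" "card C1 = 1" using n_def cC by auto
    then have "r0 = r1" "x0 = x1" using p0(1,2) p1(1,2) by (metis card_1_singletonE singletonD)+
    then show False using p1(4) by simp
  qed
  define I J K where "I = fst ` R1" and "J = fst ` C1" and "K = fst ` S1"
  have cI: "card I = n" "card J = n" "card K = n"
    using fst_inj1 cS cC n_def by (auto simp: I_def J_def K_def card_image)
  have IJ: "I \<subseteq> {..<\<alpha>}" "J \<subseteq> {..<\<alpha>}" "K \<subseteq> {..<\<alpha>}"
    using R_less C_less S_less by (auto simp: I_def J_def K_def R1_iff C1_iff S1_iff)
  have fJ: "finite J" "finite K" "finite I" "K \<noteq> {}"
    using fin1 cI(3) n2 by (auto simp: I_def J_def K_def)
  have mK: "fst (M r x) \<in> K" if "r \<in> R1" "x \<in> C1" "(r, x) \<noteq> (\<omega>,\<omega>)" for r x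
    using corner_snd[OF that] latin_array_mem[OF lat, of r x] that
    by (force simp: K_def S1_iff R1_iff C1_iff)
  have clJ: "B i j \<in> K \<longleftrightarrow> j \<in> J" if "i < \<alpha>" "j < \<alpha>" "\<And>j. j \<in> J \<Longrightarrow> B i j \<in> K" for i j
  proof -
    have "inj_on (B i) J" using B_row_inj that IJ by (auto simp: inj_on_def subset_iff)
    then have "card (B i ` J) = n" using cI by (simp add: card_image)
    then have "B i ` J = K" using that(3) card_subset_eq[OF fJ(2), of "B i ` J"] cI by auto
    note BJ = this
    show ?thesis
    proof
      assume "B i j \<in> K"
      then obtain j' where j': "j' \<in> J" "B i j = B i j'" using BJ by blast
      then have "j' < \<alpha>" using IJ(2) by auto
      then show "j \<in> J" using B_row_inj[OF \<open>i < \<alpha>\<close> \<open>j < \<alpha>\<close>] j' by blast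
    qed (use that(3) in blast)
  qed
  \<comment> \<open>Three rows free of the changed cell make K invariant under two row permutations
    of \<open>B\<close>, so K is everything.\<close>
  have three: "n = \<alpha>" if "i \<in> I" "i' \<in> I" "i'' \<in> I" "i \<noteq> i'" "i \<noteq> i''" "i' \<noteq> i''"
    "\<And>l j. l \<in> {i, i', i''} \<Longrightarrow> j \<in> J \<Longrightarrow> B l j \<in> K" for i i' i''
  proof -
    have "K = {..<\<alpha>}"
      by (rule closed3_full_B[of i i' i'']) (use that IJ fJ clJ in \<open>auto simp: subset_iff\<close>)
    then show ?thesis using cI by simp
  qed
  have zero: "0 \<in> K" if "\<omega> \<in> R1" "\<omega> \<in> C1"
  proof (cases "\<exists>x. x \<in> C \<and> x \<notin> C1 \<and> (\<omega>, x) \<in> St")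
    case True
    then obtain x where "(\<omega>, x) \<in> St" by blast
    then have "(r, \<omega>) \<notin> St" if "r \<notin> R1" for r
      using St1[of "(\<omega>, x)" "(r, \<omega>)"] that \<open>\<omega> \<in> R1\<close> by auto
    note * = this
    have m: "\<omega> \<in> R" "\<omega> \<in> C" using that by (simp_all add: R1_iff C1_iff)
    show ?thesis unfolding K_def
      by (rule zero_S1_col[OF m]) (simp add: cS n_def[symmetric], erule *)
  next
    case False
    have m: "\<omega> \<in> R" "\<omega> \<in> C" using that by (simp_all add: R1_iff C1_iff)
    show ?thesis unfolding K_def
      by (rule zero_S1_row[OF m]) (simp add: cS cC, use False in blast)
  qed
  have BK: "B (fst r) (fst x) \<in> K" if "r \<in> R1" "x \<in> C1" "(r, x) \<notin> St \<or> (r, x) = (\<omega>,\<omega>)" for r x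
  proof (cases "(r, x) = (\<omega>,\<omega>)")
    case True then show ?thesis using zero that(1,2) B00 by (simp add: fst_\<omega>)
  next
    case False then show ?thesis using mK[of r x] corner_fst[of r x] that by auto
  qed
  show ?thesis
  proof (cases "\<exists>p\<in>St. fst p \<in> R1 \<and> snd p \<in> C1 \<and> p \<noteq> (\<omega>,\<omega>)")
    case nst: False
    have BK': "B i j \<in> K" if "i \<in> I" "j \<in> J" for i j
      using that BK nst unfolding I_def J_def by fastforce
    have "n = \<alpha>"
    proof (cases "n = 2")
      case True
      then obtain i i' j j' where e: "I = {i, i'}" "i \<noteq> i'" "J = {j, j'}" "j \<noteq> j'"
        using cI by (metis card_2_iff)
      have lt: "i < \<alpha>" "i' < \<alpha>" "j < \<alpha>" "j' < \<alpha>" using e IJ by auto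
      have m: "B i j \<in> K" "B i j' \<in> K" "B i' j \<in> K" "B i' j' \<in> K" using BK' e by auto
      have d: "B i j \<noteq> B i j'" "B i' j \<noteq> B i' j'" "B i j \<noteq> B i' j" "B i j' \<noteq> B i' j'"
        using lt e B_row_inj B_col_inj by auto
      have "card {B i j, B i j'} = 2" using d by simp
      then have "K = {B i j, B i j'}" using m card_subset_eq[of K "{B i j, B i j'}"] fJ cI True by auto
      then have "B i j' = B i' j" "B i' j' = B i j" using m d by auto
      then show ?thesis using B_no2[of i i' j j'] lt e by auto
    next
      case False
      then have "3 \<le> card I" using n2 cI by simp
      then obtain T where "T \<subseteq> I" "card T = 3" by (meson obtain_subset_with_card_n)
      then obtain i i' i'' where "{i, i', i''} \<subseteq> I" "i \<noteq> i'" "i \<noteq> i''" "i' \<noteq> i''"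
        by (auto simp: card_3_iff)
      then show ?thesis using three[of i i' i''] BK' by blast
    qed
    then show ?thesis using n_def cS cC by simp
  next
    case True
    then obtain p where "p \<in> St" "fst p \<in> R1" "snd p \<in> C1" "p \<noteq> (\<omega>,\<omega>)" by blast
    then obtain rs xs where st: "(rs, xs) \<in> St" "rs \<in> R1" "xs \<in> C1" "(rs, xs) \<noteq> (\<omega>,\<omega>)"
      by (cases p) simp
    have BK': "B i j \<in> K" if t: "i \<in> I" "i \<noteq> fst rs" "j \<in> J" for i j
    proof -
      obtain r x where r: "r \<in> R1" "x \<in> C1" "i = fst r" "j = fst x" using t I_def J_def by auto
      then have "(r, x) \<notin> St" using St1[OF st(1), of "(r, x)"] that by auto
      then show ?thesis using BK r by blast
    qed
    have zK: "fst (M r x) \<in> K" if "r \<in> R1" "x \<in> C1" for r x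
    proof (cases "(r, x) = (\<omega>,\<omega>)")
      case True
      then have "(r, x) \<notin> St" using St1[OF st(1), of "(r, x)"] st by auto
      then show ?thesis using corner_fst[OF that] BK[OF that] by simp
    qed (use mK that in blast)
    \<comment> \<open>Only the row of the changed cell is unreliable; with four rows, three good
      ones are left.\<close>
    have "n = \<alpha> \<or> n \<le> 3"
    proof (rule disjCI)
      assume "\<not> n \<le> 3"
      then have "3 \<le> card (I - {fst rs})" using cI fJ st by (simp add: I_def card_Diff_singleton)
      then obtain T where "T \<subseteq> I - {fst rs}" "card T = 3" by (meson obtain_subset_with_card_n)
      then obtain i i' i'' where "{i, i', i''} \<subseteq> I - {fst rs}" "i \<noteq> i'" "i \<noteq> i''" "i' \<noteq> i''"
        by (auto simp: card_3_iff)
      then show "n = \<alpha>" using three[of i i' i''] BK' by blast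
    qed
    then show ?thesis using n2 n_def cS cC True zK unfolding K_def by auto
  qed
qed blast

end

lemma fibre_one_bij:
  fixes f :: "'a \<Rightarrow> nat"
  assumes "\<And>j. j < n \<Longrightarrow> card {x \<in> C. f x = j} = 1" "\<And>x. x \<in> C \<Longrightarrow> f x < n"
  shows "bij_betw f C {..<n}"
proof (rule bij_betw_imageI)
  show "inj_on f C"
  proof (rule inj_onI)
    fix x y assume a: "x \<in> C" "y \<in> C" "f x = f y"
    have "card {u \<in> C. f u = f x} = 1" using assms a by blast
    then obtain v where "{u \<in> C. f u = f x} = {v}" by (rule card_1_singletonE)
    then show "x = y" using a by (metis (mono_tags, lifting) mem_Collect_eq singletonD)
  qed
  show "f ` C = {..<n}"
  proof (intro set_eqI iffI)
    fix j assume "j \<in> {..<n}"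
    then have "card {u \<in> C. f u = j} = 1" using assms by simp
    then have "{u \<in> C. f u = j} \<noteq> {}" by (metis card.empty zero_neq_one)
    then show "j \<in> f ` C" by blast
  qed (use assms in auto)
qed

text \<open>A Latin square of order 3 is cyclic: the other two rows are the two cyclic shifts of row
  e, in an unknown order. In the applications e is the exceptional row.\<close>

lemma latin_array_cube:
  assumes "latin_array R C S M" "R = {e, r, r'}" "e \<noteq> r" "e \<noteq> r'" "r \<noteq> r'"
    "C = {x0, x1, x2}" "x0 \<noteq> x1" "x0 \<noteq> x2" "x1 \<noteq> x2"
  shows "\<exists>a c. a \<in> {r, r'} \<and> c \<in> {r, r'} \<and> a \<noteq> c \<and>
    M a x0 = M e x1 \<and> M a x1 = M e x2 \<and> M a x2 = M e x0 \<and>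
    M c x0 = M e x2 \<and> M c x1 = M e x0 \<and> M c x2 = M e x1"
proof -
  note lat = assms(1)
  have m: "e \<in> R" "r \<in> R" "r' \<in> R" "x0 \<in> C" "x1 \<in> C" "x2 \<in> C" using assms by auto
  have row: "M u x1 \<noteq> M u x0" "M u x2 \<noteq> M u x0" "M u x2 \<noteq> M u x1" if "u \<in> R" for u
    using latin_array_row_inj[OF lat that] m assms(7-9) by metis+
  have col: "M u x \<noteq> M v x" if "u \<in> R" "v \<in> R" "u \<noteq> v" "x \<in> C" for u v x
    using latin_array_col_inj[OF lat that(1,2,4)] that(3) by blast
  have img: "M e ` C = S" using latin_array_row[OF lat m(1)] by (simp add: bij_betw_def)
  have val: "M u x = M e x0 \<or> M u x = M e x1 \<or> M u x = M e x2" if "u \<in> R" "x \<in> C" for u x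
    using latin_array_mem[OF lat that] img assms(6) by auto
  have one: "M u x1 = M e x2 \<and> M u x2 = M e x0" if "u \<in> {r, r'}" "M u x0 = M e x1" for u
  proof -
    have u: "u \<in> R" "u \<noteq> e" using that(1) m assms(3,4) by auto
    have "M u x2 \<noteq> M e x2" "M u x1 \<noteq> M e x1" using col[OF u(1) m(1) u(2)] m by auto
    then show ?thesis using val[OF u(1) m(5)] val[OF u(1) m(6)] row[OF u(1)] that(2) by metis
  qed
  have two: "M u x1 = M e x0 \<and> M u x2 = M e x1" if "u \<in> {r, r'}" "M u x0 = M e x2" for u
  proof -
    have u: "u \<in> R" "u \<noteq> e" using that(1) m assms(3,4) by auto
    have "M u x2 \<noteq> M e x2" "M u x1 \<noteq> M e x1" using col[OF u(1) m(1) u(2)] m by auto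
    then show ?thesis using val[OF u(1) m(5)] val[OF u(1) m(6)] row[OF u(1)] that(2) by metis
  qed
  have x0: "M r x0 = M e x1 \<or> M r x0 = M e x2" "M r' x0 = M e x1 \<or> M r' x0 = M e x2" "M r x0 \<noteq> M r' x0"
    using val m col assms(3-5) by metis+
  show ?thesis
  proof (cases "M r x0 = M e x1")
    case True
    then have "M r' x0 = M e x2" using x0 by metis
    then show ?thesis using one[of r] two[of r'] True assms(5) by blast
  next
    case False
    then have "M r x0 = M e x2" "M r' x0 = M e x1" using x0 by metis+
    then show ?thesis using one[of r'] two[of r] assms(5) by blast
  qed
qed

text \<open>A row (i, x) meets all columns (j, 1), hence S contains all symbols over
  \<open>G x\<close>. Each of them must occur in the column (1, 1), and only rows over x can provide
  it; so the whole fibre over x consists of rows. The column (1, 1) is used because its first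
  coordinate 1 keeps it away from the shift.\<close>

lemma fill_fibre:
  fixes R C S :: "(nat \<times> nat) set"
  assumes lat: "latin_array R C S M" and n: "3 \<le> n" and R: "\<And>r. r \<in> R \<Longrightarrow> fst r < n \<and> snd r \<in> X"
    and C: "\<And>j. j < n \<Longrightarrow> (j, 1) \<in> C"
    and M: "\<And>i x j. (i, x) \<in> R \<Longrightarrow> x \<noteq> 1 \<Longrightarrow> j < n \<Longrightarrow> i \<noteq> 0 \<or> j \<noteq> 0 \<Longrightarrow> M (i, x) (j, 1) = (F i j, G x)"
    and M1: "\<And>i. (i, 1) \<in> R \<Longrightarrow> snd (M (i, 1) (1, 1)) = v"
    and G: "inj_on G X" "\<And>x. x \<in> X \<Longrightarrow> x \<noteq> 1 \<Longrightarrow> G x \<noteq> v"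
    and F: "\<And>i. i < n \<Longrightarrow> bij_betw (F i) {..<n} {..<n}" "bij_betw (\<lambda>i. F i 1) {..<n} {..<n}"
    and r: "(i, x) \<in> R" "x \<noteq> 1" "i' < n"
  shows "(i', x) \<in> R"
proof -
  have x: "x \<in> X" "i < n" using R r by fastforce+
  have find: "\<exists>i2. (i2, x) \<in> R \<and> F i2 1 = z" if z: "(z, G x) \<in> S" for z
  proof -
    have "(1, 1) \<in> C" using C[of 1] n by simp
    then obtain r' where r': "r' \<in> R" "M r' (1, 1) = (z, G x)"
      using latin_array_col_surj[OF lat _ z] by blast
    obtain i2 x2 where e: "r' = (i2, x2)" by (cases r')
    have "x2 \<noteq> 1" using M1[of i2] r' e G(2)[OF x(1) r(2)] by auto
    then have "F i2 1 = z" "G x2 = G x" using M[of i2 x2 1] r' e n by auto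
    then have "x2 = x" using G(1) R[OF r'(1)] x e by (metis inj_onD snd_conv)
    then show ?thesis using r' e \<open>F i2 1 = z\<close> by blast
  qed
  have pos: "(i', x) \<in> R" if "(l, x) \<in> R" "l \<noteq> 0" for l
  proof -
    have l: "l < n" using R[OF that(1)] by simp
    have "F i' 1 < n" using F(2) r(3) n by (auto simp: bij_betw_def)
    then obtain j where j: "j < n" "F l j = F i' 1" using F(1)[OF l] by (metis bij_betw_imp_surj_on imageE lessThan_iff)
    then have "(F i' 1, G x) \<in> S"
      using latin_array_mem[OF lat that(1) C[OF j(1)]] M[OF that(1) r(2) j(1)] that(2) by simp
    from find[OF this] obtain i2 where i2: "(i2, x) \<in> R" "F i2 1 = F i' 1" by blast
    then have "i2 = i'" using F(2) r(3) R[OF i2(1)] by (auto simp: bij_betw_def dest: inj_onD)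
    then show ?thesis using i2 by simp
  qed
  show ?thesis
  proof (cases "i = 0")
    case True
    \<comment> \<open>Row 0 is unreliable in column 0, so it does not show all symbols. One symbol
      different from \<open>F 0 1\<close> is enough to produce a row over x with nonzero first
      coordinate.\<close>
    have "(F 0 2, G x) \<in> S"
      using latin_array_mem[OF lat r(1) C[of 2]] M[OF r(1,2), of 2] n True by simp
    from find[OF this] obtain i2 where i2: "(i2, x) \<in> R" "F i2 1 = F 0 2" by blast
    have "F 0 2 \<noteq> F 0 1" using F(1)[of 0] n by (auto simp: bij_betw_def dest!: inj_onD[of "F 0" "{..<n}" 2 1])
    then have "i2 \<noteq> 0" using i2 by metis
    then show ?thesis using pos i2 by blast
  qed (use pos r in blast)
qed

section \<open>Fibres of the projection to \<open>A\<close>\<close>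

context product_subarray begin

definition \<phi> where "\<phi> i = card {r \<in> R. fst r = i}"
definition \<gamma> where "\<gamma> j = card {x \<in> C. fst x = j}"
definition \<chi> where "\<chi> z = card {u \<in> S. fst u = z}"

lemma row_fibre:
  assumes "r \<in> R" "\<And>x. x \<in> C \<Longrightarrow> fst (M r x) = A (fst r) (fst x)" "j < \<alpha>"
  shows "\<chi> (A (fst r) j) = \<gamma> j"
  unfolding \<chi>_def \<gamma>_def
  by (rule latin_array_fibre[OF lat assms(1), of _ "{..<\<alpha>}"])
    (use assms R_less C_less bij_betw_imp_inj_on[OF A_row] in auto)

lemma col_fibre:
  assumes "x \<in> C" "\<And>r. r \<in> R \<Longrightarrow> fst (M r x) = A (fst r) (fst x)" "i < \<alpha>"
  shows "\<chi> (A i (fst x)) = \<phi> i"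
  unfolding \<chi>_def \<phi>_def
  by (rule latin_array_fibre[OF latin_array_transpose[OF lat] assms(1), of "\<lambda>i. A i (fst x)" "{..<\<alpha>}"])
    (use assms R_less C_less bij_betw_imp_inj_on[OF A_col] in auto)

lemma sums: "k = (\<Sum>j<\<alpha>. \<gamma> j)" "k = (\<Sum>j<\<alpha>. \<chi> j)" "k = (\<Sum>j<\<alpha>. \<phi> j)"
  using sum_card_fibres[of C fst \<alpha>] sum_card_fibres[of S fst \<alpha>] sum_card_fibres[of R fst \<alpha>]
    cards R_less C_less S_less by (simp_all add: \<gamma>_def \<chi>_def \<phi>_def)

lemma col_count:
  assumes "x \<in> C" "T \<subseteq> R" "\<And>r. r \<in> T \<Longrightarrow> fst (M r x) = z"
  shows "card T \<le> \<chi> z"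
  unfolding \<chi>_def
proof (rule card_inj_on_le[of "\<lambda>r. M r x"])
  show "inj_on (\<lambda>r. M r x) T"
    using bij_betw_imp_inj_on[OF latin_array_col[OF lat assms(1)]] assms(2) inj_on_subset by blast
  show "(\<lambda>r. M r x) ` T \<subseteq> {u \<in> S. fst u = z}"
    using assms(2,3) latin_array_mem[OF lat _ assms(1)] by blast
  show "finite {u \<in> S. fst u = z}" using cards by simp
qed

lemma \<gamma>_pos: "0 < \<gamma> j \<longleftrightarrow> j \<in> fst ` C" using cards by (force simp: \<gamma>_def card_gt_0_iff)
lemma \<chi>_pos: "0 < \<chi> j \<longleftrightarrow> j \<in> fst ` S" using cards by (force simp: \<chi>_def card_gt_0_iff)

definition clean where "clean r \<longleftrightarrow> r \<in> R \<and> (\<forall>x\<in>C. fst (M r x) = A (fst r) (fst x))"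

lemma clean_fibre: "clean r \<Longrightarrow> j < \<alpha> \<Longrightarrow> \<chi> (A (fst r) j) = \<gamma> j"
  using row_fibre by (auto simp: clean_def)

text \<open>\<open>clean_fibre\<close> for three rows makes \<open>\<chi>\<close> invariant under
  two row permutations of \<open>A\<close>, hence constant; each clean row then carries the constant
  over to \<open>\<gamma>\<close>.\<close>

lemma clean3:
  assumes "clean r" "clean r'" "clean r''" "fst r \<noteq> fst r'" "fst r \<noteq> fst r''" "fst r' \<noteq> fst r''"
  shows "\<exists>q. (\<forall>z<\<alpha>. \<chi> z = q) \<and> (\<forall>j<\<alpha>. \<gamma> j = q) \<and> k = \<alpha> * q \<and> 0 < q"
proof -
  have l: "fst r < \<alpha>" "fst r' < \<alpha>" "fst r'' < \<alpha>" using assms R_less by (auto simp: clean_def)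
  have c: "\<chi> z = \<chi> 0" if "z < \<alpha>" for z
    by (rule A_conn[OF l assms(4-6)]) (use assms clean_fibre that in simp_all)
  have g: "\<gamma> j = \<chi> 0" if "j < \<alpha>" for j
    using clean_fibre[OF assms(1) that] c[OF A_less[OF l(1) that]] by simp
  have k: "k = \<alpha> * \<chi> 0" using sums(1) g by simp
  moreover have "0 < \<chi> 0" using k cards(7) by (cases "\<chi> 0 = 0") auto
  ultimately show ?thesis using c g by blast
qed

end

text \<open>The two ways in which a subarray can look after the switch: like \<open>P\<close>, or
  like \<open>P\<close> with the row \<open>\<rho> b\<close> overwritten from the other row of the
  cycle, which is then absent. The shifted copy of \<open>L\<close> is a subsquare of
  \<open>P\<close>, so without a visible switch it has to be excluded by
  \<open>not_copy\<close>.\<close>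

locale switched_subarray = product_subarray where St = "{}" +
  fixes b :: nat and sw :: bool
  assumes b: "b < 2"
    and M_eq: "r \<in> R \<Longrightarrow> x \<in> C \<Longrightarrow>
        M r x = (if sw \<and> r = \<rho> b \<and> x \<in> \<kappa> ` {..<3} then P (\<rho> (1 - b)) x else P r x)"
    and sw_mem: "sw \<Longrightarrow> \<rho> b \<in> R" "sw \<Longrightarrow> \<exists>d<3. \<kappa> d \<in> C"
    and not_copy: "sw \<or> R \<noteq> {0} \<times> {1..\<mu>} \<or> C \<noteq> {0} \<times> {1..\<mu>}"
    and proper: "card R \<noteq> \<alpha> * \<mu>"
begin

lemma b1: "1 - b < 2" "1 - b \<noteq> b" "b < \<alpha>" "1 - b < \<alpha>" using b alpha_ge by (auto simp: less_2_cases_iff)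

lemma fst_ge2: "2 \<le> fst r \<Longrightarrow> r \<noteq> \<rho> b" using b by (auto simp: \<rho>_def)

lemma not_\<kappa>: "snd x = 1 \<Longrightarrow> x \<notin> \<kappa> ` {..<3}" using snd_\<kappa> by auto
lemma not_\<rho>: "snd r = 1 \<Longrightarrow> r \<noteq> \<rho> b" using snd_\<rho> by auto

text \<open>By \<open>fill_fibre\<close> a full block spreads: R and C consist of whole fibres over
  sets X and Y, on which \<open>L\<close> is Latin. As \<open>L\<close> is
  \<open>N_infinity\<close>, X has one element or \<mu>. One element would put the corner symbol
  over \<open>L 1 1\<close>; \<mu> elements give the whole product.\<close>

lemma full_corner_False:
  assumes "card R1 = \<alpha>" "card C1 = \<alpha>" "card S1 = \<alpha>" shows False
proof -
  note a = alpha_ge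
  have full: "T = {..<\<alpha>}" if "T \<subseteq> {..<\<alpha>}" "card T = \<alpha>" for T
    using card_subset_eq[of "{..<\<alpha>}" T] that by simp
  have "fst ` R1 = {..<\<alpha>}"
    by (rule full) (use R_less R1_iff in auto, simp add: card_image fst_inj1 assms)
  moreover have "fst ` C1 = {..<\<alpha>}"
    by (rule full) (use C_less C1_iff in auto, simp add: card_image fst_inj1 assms)
  ultimately have R1': "(i, 1) \<in> R" and C1': "(i, 1) \<in> C" if "i < \<alpha>" for i
    using that by (force simp: R1_iff C1_iff)+
  have G: "inj_on (\<lambda>x. L x 1) {1..\<mu>}" "inj_on (\<lambda>x. L 1 x) {1..\<mu>}"
    using L_row_inj L_col_inj one_mem by (auto simp: inj_on_def)
  have Rf: "(i', x) \<in> R" if t: "(i, x) \<in> R" "i' < \<alpha>" for i x i'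
  proof (cases "x = 1")
    case False
    show ?thesis
    proof (rule fill_fibre[OF lat _ R_less C1' _ _ G(1) _ A_row A_col t(1) False t(2)])
      show "3 \<le> \<alpha>" "1 < \<alpha>" using a by auto
      show "M (i, x) (j, 1) = (A i j, L x 1)" if "(i, x) \<in> R" "x \<noteq> 1" "j < \<alpha>" "i \<noteq> 0 \<or> j \<noteq> 0" for i x j
        using M_eq[OF that(1) C1'[OF that(3)]] not_\<kappa>[of "(j, 1)"] that by (auto simp: P_def)
      show "snd (M (i, 1) (1, 1)) = L 1 1" if "(i, 1) \<in> R" for i
        using M_eq[OF that C1'[of 1]] not_\<kappa>[of "(1, 1)"] a by (auto simp: P_def)
      show "L x 1 \<noteq> L 1 1" if "x \<in> {1..\<mu>}" "x \<noteq> 1" for x using L_col_inj that one_mem by auto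
    qed
  qed (use R1' t in simp)
  have Cf: "(j', y) \<in> C" if t: "(j, y) \<in> C" "j' < \<alpha>" for j y j'
  proof (cases "y = 1")
    case False
    show ?thesis
    proof (rule fill_fibre[OF latin_array_transpose[OF lat] _ C_less R1' _ _ G(2) _ A_col A_row t(1) False t(2)])
      show "3 \<le> \<alpha>" "1 < \<alpha>" using a by auto
      show "M (j, 1) (i, y) = (A j i, L 1 y)" if "(i, y) \<in> C" "y \<noteq> 1" "j < \<alpha>" "i \<noteq> 0 \<or> j \<noteq> 0" for i y j
        using M_eq[OF R1'[OF that(3)] that(1)] not_\<rho>[of "(j, 1)"] that by (auto simp: P_def)
      show "snd (M (1, 1) (i, 1)) = L 1 1" if "(i, 1) \<in> C" for i
        using M_eq[OF R1'[of 1] that] not_\<rho>[of "(1, 1)"] a by (auto simp: P_def)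
      show "L 1 x \<noteq> L 1 1" if "x \<in> {1..\<mu>}" "x \<noteq> 1" for x using L_row_inj that one_mem by auto
    qed
  qed (use C1' t in simp)
  define X Y where "X = snd ` R" and "Y = snd ` C"
  have X: "(i, x) \<in> R \<longleftrightarrow> i < \<alpha> \<and> x \<in> X" for i x
  proof
    assume "(i, x) \<in> R"
    then show "i < \<alpha> \<and> x \<in> X"
      using R_less[of "(i, x)"] image_eqI[of x snd "(i, x)" R] by (simp add: X_def)
  next
    assume ix: "i < \<alpha> \<and> x \<in> X"
    then obtain r where "r \<in> R" "snd r = x" unfolding X_def by blast
    then have "(fst r, x) \<in> R" by (metis prod.collapse)
    then show "(i, x) \<in> R" using Rf ix by blast
  qed
  have Y: "(i, x) \<in> C \<longleftrightarrow> i < \<alpha> \<and> x \<in> Y" for i x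
  proof
    assume "(i, x) \<in> C"
    then show "i < \<alpha> \<and> x \<in> Y"
      using C_less[of "(i, x)"] image_eqI[of x snd "(i, x)" C] by (simp add: Y_def)
  next
    assume ix: "i < \<alpha> \<and> x \<in> Y"
    then obtain r where "r \<in> C" "snd r = x" unfolding Y_def by blast
    then have "(fst r, x) \<in> C" by (metis prod.collapse)
    then show "(i, x) \<in> C" using Cf ix by blast
  qed
  have RC: "R = {..<\<alpha>} \<times> X" "C = {..<\<alpha>} \<times> Y" using X Y by auto
  have XY: "X \<subseteq> {1..\<mu>}" "Y \<subseteq> {1..\<mu>}" using R_less C_less by (auto simp: X_def Y_def)
  have one: "1 \<in> X" "1 \<in> Y" using X[of 0 1] Y[of 0 1] R1' C1' a by auto
  have k: "k = \<alpha> * card X" "k = \<alpha> * card Y" using cards(1,2) RC by (simp_all add: card_cartesian_product)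
  \<comment> \<open>Row 2 of \<open>A\<close> is neither shifted nor switched, so it shows second
    coordinates as in \<open>L\<close>.\<close>
  have snd2: "snd (M (2, x) (j, y)) = L x y" if "x \<in> X" "y \<in> Y" "j < \<alpha>" for x y j
  proof -
    have "(2, x) \<in> R" "(j, y) \<in> C" using that X Y a by auto
    then show ?thesis using M_eq[of "(2, x)" "(j, y)"] fst_ge2[of "(2, x)"] by (simp add: P_def)
  qed
  have "snd ` S = L 1 ` Y"
  proof -
    have "(2, 1) \<in> R" using X one a by auto
    then have "S = M (2, 1) ` C" using latin_array_row[OF lat] by (metis bij_betw_imp_surj_on)
    then have "snd ` S = (\<lambda>x. snd (M (2, 1) x)) ` C" by auto
    also have "\<dots> = L 1 ` Y"
    proof (intro set_eqI iffI)
      fix v assume "v \<in> (\<lambda>x. snd (M (2, 1) x)) ` C"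
      then obtain j y where "(j, y) \<in> C" "v = snd (M (2, 1) (j, y))" by auto
      then show "v \<in> L 1 ` Y" using snd2[OF one(1)] Y by auto
    next
      fix v assume "v \<in> L 1 ` Y"
      then obtain y where y: "y \<in> Y" "v = L 1 y" by auto
      then have "(0, y) \<in> C" "v = snd (M (2, 1) (0, y))" using snd2[OF one(1) y(1), of 0] Y a by auto
      then show "v \<in> (\<lambda>x. snd (M (2, 1) x)) ` C" by blast
    qed
    finally show ?thesis .
  qed
  then have cS: "card (snd ` S) = card Y"
    using G(2) XY(2) by (metis (no_types, lifting) card_image inj_on_subset)
  have "latin_array X Y (snd ` S) L"
  proof (rule latin_arrayI)
    show "finite X" "finite Y" using XY finite_subset by blast+
    show "card X = card (snd ` S)" "card Y = card (snd ` S)" using k a cS by auto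
    show "finite (snd ` S)" using cards by simp
    show "L x y \<in> snd ` S" if "x \<in> X" "y \<in> Y" for x y
    proof -
      have "(2, x) \<in> R" "(0, y) \<in> C" using that X Y a by auto
      then have "M (2, x) (0, y) \<in> S" by (rule latin_array_mem[OF lat])
      then show ?thesis using snd2[OF that, of 0] a by force
    qed
    show "y = y'" if "x \<in> X" "y \<in> Y" "y' \<in> Y" "L x y = L x y'" for x y y'
      using L_row_inj[of x y y'] that XY by blast
    show "x = x'" if "x \<in> X" "x' \<in> X" "y \<in> Y" "L x y = L x' y" for x x' y
      using L_col_inj[of x x' y] that XY by blast
  qed
  then have "card X = 1 \<or> card X = \<mu>" by (rule L_subsquare) (use XY one in auto)
  then show False
  proof
    assume "card X = 1"
    then have "card S = card S1" using k cards assms by simp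
    moreover have "S1 \<subseteq> S" unfolding S1_def by blast
    ultimately have "S1 = S" using card_subset_eq[OF cards(6)] by simp
    moreover have o: "\<omega> \<in> R" "\<omega> \<in> C" using R1'[of 0] C1'[of 0] a by (auto simp: \<omega>_def)
    ultimately have "snd (M \<omega> \<omega>) = L 1 1" using latin_array_mem[OF lat o] S1_iff by blast
    then show False using omega_snd o by blast
  next
    assume "card X = \<mu>"
    then show False using k cards proper by simp
  qed
qed

end

text \<open>By \<open>corner_cases\<close>, at most one cell \<open>(rb, xb)\<close> lies in the block filled by \<open>B\<close>, apart from its
  corner; \<open>bt\<close> records whether there is one.\<close>

locale switched_subarray1 = switched_subarray +
  fixes bt :: bool and rb xb :: "nat \<times> nat"
  assumes bt: "bt \<Longrightarrow> rb \<in> R \<and> xb \<in> C \<and> snd rb = 1 \<and> snd xb = 1 \<and> (fst rb \<noteq> 0 \<or> fst xb \<noteq> 0)"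
    and only_bt: "r \<in> R \<Longrightarrow> x \<in> C \<Longrightarrow> snd r = 1 \<Longrightarrow> snd x = 1 \<Longrightarrow>
        fst r = 0 \<and> fst x = 0 \<or> bt \<and> r = rb \<and> x = xb"
begin

definition special where "special r x \<longleftrightarrow> sw \<and> r = \<rho> b \<and> x \<in> \<kappa> ` {..<3} \<or> bt \<and> r = rb \<and> x = xb"

lemma plain:
  assumes "r \<in> R" "x \<in> C" "\<not> special r x"
  shows "fst (M r x) = A (fst r) (fst x)"
    and "snd (M r x) = (if fst r = 0 \<and> fst x = 0 then sh else id) (L (snd r) (snd x))"
  using M_eq[OF assms(1,2)] only_bt[OF assms(1,2)] assms(3) A00 B00
  by (auto simp: special_def P_def)

lemma snd_rb: "bt \<Longrightarrow> rb \<noteq> \<rho> b' \<and> \<rho> b' \<noteq> rb" using bt snd_\<rho> by metis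
lemma snd_xb: "bt \<Longrightarrow> d < 3 \<Longrightarrow> xb \<noteq> \<kappa> d \<and> \<kappa> d \<noteq> xb" using bt snd_\<kappa> by metis

lemma at_b: assumes bt shows "M rb xb = (B (fst rb) (fst xb), L 1 1)"
  using M_eq[of rb xb] bt[OF assms] snd_rb[OF assms, of b] by (auto simp: P_def)

lemma at_sw:
  assumes sw "d < 3" "\<kappa> d \<in> C"
  shows "fst (M (\<rho> b) (\<kappa> d)) = A (1 - b) d" "snd (M (\<rho> b) (\<kappa> d)) \<noteq> L 1 1"
    "snd (M (\<rho> b) (\<kappa> d)) = snd (P (\<rho> (1 - b)) (\<kappa> d))"
proof -
  have e: "M (\<rho> b) (\<kappa> d) = P (\<rho> (1 - b)) (\<kappa> d)" using M_eq[OF sw_mem(1) assms(3)] assms by simp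
  show "fst (M (\<rho> b) (\<kappa> d)) = A (1 - b) d"
    using e snd_\<rho>[of "1 - b"] by (simp add: P_def) (simp add: \<rho>_def \<kappa>_def)
  show "snd (M (\<rho> b) (\<kappa> d)) = snd (P (\<rho> (1 - b)) (\<kappa> d))" using e by simp
  have "snd (M (\<rho> b) (\<kappa> d)) \<in> w ` {..<3}"
    by (rule M_sw) (use assms sw_mem b in auto)
  then show "snd (M (\<rho> b) (\<kappa> d)) \<noteq> L 1 1" using w11 by (metis imageE lessThan_iff)
qed

lemma at_b_neq: "bt \<Longrightarrow> fst (M rb xb) \<noteq> A (fst rb) (fst xb)"
  using at_b bt AB[of "fst rb" "fst xb"] R_less[of rb] C_less[of xb] by auto

lemma at_sw_neq: "sw \<Longrightarrow> d < 3 \<Longrightarrow> \<kappa> d \<in> C \<Longrightarrow> fst (M (\<rho> b) (\<kappa> d)) \<noteq> A b d"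
  using at_sw A_col_inj[of "1 - b" b d] b1 alpha_ge by auto

definition E0 where "E0 = (if sw then {\<rho> b} else {}) \<union> (if bt then {rb} else {})"
definition Cl where "Cl = R - E0"

lemma E0: "E0 \<subseteq> R" "finite E0" "card E0 = (if sw then 1 else 0) + (if bt then 1 else 0)"
  using sw_mem(1) bt snd_rb[of b] by (auto simp: E0_def)

lemma Cl_not_special: "r \<in> Cl \<Longrightarrow> \<not> special r x" by (auto simp: Cl_def E0_def special_def)
lemma Cl_R: "r \<in> Cl \<Longrightarrow> r \<in> R" by (auto simp: Cl_def)
lemma Cl_clean: "r \<in> Cl \<Longrightarrow> clean r" using plain(1) Cl_not_special Cl_R unfolding clean_def by blast
lemma Cl_card: "k = card Cl + card E0" "finite Cl"
  using card_Diff_subset[OF E0(2,1)] cards card_mono[OF cards(4) E0(1)] by (auto simp: Cl_def)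
lemma Cl_fst: "r \<in> Cl \<Longrightarrow> x \<in> C \<Longrightarrow> fst (M r x) = A (fst r) (fst x)"
  using plain(1) Cl_not_special Cl_R by blast

lemma not_special_rb: "bt \<Longrightarrow> x \<noteq> xb \<Longrightarrow> \<not> special rb x" unfolding special_def using snd_rb[of b] by blast
lemma not_special_sw: "x \<notin> \<kappa> ` {..<3} \<Longrightarrow> \<not> special (\<rho> b) x" unfolding special_def using snd_rb[of b] by blast
lemma not_special_col: "r \<noteq> \<rho> b \<Longrightarrow> d < 3 \<Longrightarrow> \<not> special r (\<kappa> d)" unfolding special_def using snd_xb[of d] by blast

text \<open>All fibres have the same size q, and over a cell of \<open>A\<close> without exceptional
  entries one sees a subsquare of \<open>L\<close> of order q. So q is 1 or \<mu>, and \<mu> gives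
  the whole product. For q = 1 an exceptional cell that is alone in its row or column is impossible;
  without exceptional cells the subarray is a map from \<open>A\<close> to \<open>L\<close> as in
  \<open>no_homotopy\<close>.\<close>

lemma uniform_False:
  assumes "r \<in> Cl" "r' \<in> Cl" "r'' \<in> Cl" "fst r \<noteq> fst r'" "fst r \<noteq> fst r''" "fst r' \<noteq> fst r''"
  shows False
proof -
  note a = alpha_ge
  obtain q where q0: "\<forall>z<\<alpha>. \<chi> z = q" "\<forall>j<\<alpha>. \<gamma> j = q" and q': "k = \<alpha> * q" "0 < q"
    using clean3[OF assms(1-3)[THEN Cl_clean] assms(4-6)] by blast
  note q = q0(1)[rule_format] q0(2)[rule_format] q'
  have "\<alpha> * 1 \<le> k" unfolding q(3) using q(4) by (intro mult_le_mono2) simp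
  then have "8 \<le> k" using a by simp
  have "card (\<kappa> ` {..<3} \<union> {xb}) \<le> 4"
    by (rule order.trans[OF card_Un_le]) (use card_image_le[of "{..<3::nat}" \<kappa>] in simp)
  then have "\<not> C \<subseteq> \<kappa> ` {..<3} \<union> {xb}"
    using card_mono[of "\<kappa> ` {..<3} \<union> {xb}" C] \<open>8 \<le> k\<close> cards by auto
  then obtain x where x: "x \<in> C" "x \<notin> \<kappa> ` {..<3}" "x \<noteq> xb" by auto
  have f: "\<phi> i = q" if "i < \<alpha>" for i
  proof -
    have "\<chi> (A i (fst x)) = \<phi> i"
      by (rule col_fibre) (use x plain(1) that in \<open>auto simp: special_def\<close>)
    then show ?thesis using q(1) A_less that C_less[OF x(1)] by simp
  qed
  \<comment> \<open>The cell (2, j) of \<open>A\<close> must be free of exceptional entries: row 2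
    avoids the shift and the switched rows, and j avoids the cell of \<open>B\<close>.\<close>
  define j where "j = (if fst rb = 2 \<and> fst xb = 3 then 4 else 3 :: nat)"
  have j: "j < \<alpha>" "j \<noteq> 0" "2 < \<alpha>" using a by (auto simp: j_def)
  define X Y V where "X = {x. (2, x) \<in> R}" and "Y = {y. (j, y) \<in> C}" and "V = {v. (A 2 j, v) \<in> S}"
  have im: "{u \<in> T. fst u = l} = Pair l ` {x. (l, x) \<in> T}" for T :: "(nat \<times> nat) set" and l
    by force
  have cX: "card X = q" "card Y = q" "card V = q"
    using f[OF j(3)] q(2)[OF j(1)] q(1)[OF A_less[OF j(3,1)]]
    unfolding \<phi>_def \<gamma>_def \<chi>_def X_def Y_def V_def im by (simp_all add: card_image inj_on_def)
  have XY: "X \<subseteq> {1..\<mu>}" "Y \<subseteq> {1..\<mu>}" using R_less C_less by (auto simp: X_def Y_def)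
  have val: "M (2, x) (j, y) = (A 2 j, L x y)" if "x \<in> X" "y \<in> Y" for x y
  proof -
    have m: "(2, x) \<in> R" "(j, y) \<in> C" using that by (auto simp: X_def Y_def)
    moreover have "\<not> special (2, x) (j, y)"
      using fst_ge2[of "(2, x)"] by (auto simp: special_def j_def split: if_splits)
    ultimately show ?thesis using plain[OF m] by (simp add: prod_eq_iff)
  qed
  have "latin_array X Y V L"
  proof (rule latin_arrayI)
    show "finite X" "finite Y" "finite V" using cX q(4) by (auto intro: card_ge_0_finite)
    show "L x y \<in> V" if "x \<in> X" "y \<in> Y" for x y
      using val[OF that] latin_array_mem[OF lat, of "(2, x)" "(j, y)"] that by (simp add: X_def Y_def V_def)
    show "c = c'" if "r \<in> X" "c \<in> Y" "c' \<in> Y" "L r c = L r c'" for r c c'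
      using L_row_inj[of r c c'] that XY by blast
    show "r = r'" if "r \<in> X" "r' \<in> X" "c \<in> Y" "L r c = L r' c" for r r' c
      using L_col_inj[of r r' c] that XY by blast
  qed (use cX in simp_all)
  then have "q = 1 \<or> q = \<mu>" using L_subsquare[of X Y V] XY cX q(4) by fastforce
  then have q1: "q = 1" using q(3) proper cards by auto
  have bij: "bij_betw fst C {..<\<alpha>}" "bij_betw fst R {..<\<alpha>}" "bij_betw fst S {..<\<alpha>}"
    by (rule fibre_one_bij; use f q q1 R_less C_less S_less in \<open>simp add: \<phi>_def \<gamma>_def \<chi>_def\<close>)+
  have nbt: "\<not> bt"
  proof
    assume bt
    have "(fst \<circ> M rb) xb = (A (fst rb) \<circ> fst) xb"
    proof (rule bij_betw_agree_but_one[of _ C "{..<\<alpha>}"])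
      show "bij_betw (fst \<circ> M rb) C {..<\<alpha>}"
        using bij_betw_trans[OF latin_array_row[OF lat] bij(3)] bt \<open>bt\<close> by blast
      show "bij_betw (A (fst rb) \<circ> fst) C {..<\<alpha>}"
        using bij_betw_trans[OF bij(1) A_row] bt \<open>bt\<close> R_less by blast
      show "(fst \<circ> M rb) x = (A (fst rb) \<circ> fst) x" if "x \<in> C" "x \<noteq> xb" for x
        using plain(1)[of rb x] bt not_special_rb \<open>bt\<close> that by simp
    qed (use bt \<open>bt\<close> in blast)
    then show False using at_b_neq \<open>bt\<close> by simp
  qed
  \<comment> \<open>The row \<open>\<rho> b\<close> may contain up to three switched cells, but each
    column contains only one. Hence the forced value is taken along a column here.\<close>
  have nsw: "\<not> sw"
  proof
    assume sw
    then obtain d where d: "d < 3" "\<kappa> d \<in> C" using sw_mem(2) by blast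
    have "(\<lambda>r. fst (M r (\<kappa> d))) (\<rho> b) = (\<lambda>r. A (fst r) d) (\<rho> b)"
    proof (rule bij_betw_agree_but_one[of _ R "{..<\<alpha>}"])
      show "bij_betw (\<lambda>r. fst (M r (\<kappa> d))) R {..<\<alpha>}"
        using bij_betw_trans[OF latin_array_col[OF lat d(2)] bij(3)] by (simp add: comp_def)
      show "bij_betw (\<lambda>r. A (fst r) d) R {..<\<alpha>}"
        using bij_betw_trans[OF bij(2) A_col[of d]] d a by (simp add: comp_def)
      show "fst (M r (\<kappa> d)) = A (fst r) d" if "r \<in> R" "r \<noteq> \<rho> b" for r
        using plain(1)[OF that(1) d(2) not_special_col[OF that(2) d(1)]] by (simp add: \<kappa>_def)
      show "\<rho> b \<in> R" using sw_mem \<open>sw\<close> by blast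
    qed
    then show False using at_sw_neq[OF \<open>sw\<close> d] by (simp add: \<rho>_def)
  qed
  have ns: "\<not> special r x" for r x unfolding special_def using nbt nsw by blast
  have exR: "\<exists>x. (i, x) \<in> R" if "i < \<alpha>" for i
    using bij_betw_imp_surj_on[OF bij(2)] that by (metis imageE lessThan_iff prod.collapse)
  have exC: "\<exists>x. (i, x) \<in> C" if "i < \<alpha>" for i
    using bij_betw_imp_surj_on[OF bij(1)] that by (metis imageE lessThan_iff prod.collapse)
  obtain x y where xy: "\<And>i. i < \<alpha> \<Longrightarrow> (i, x i) \<in> R" "\<And>j. j < \<alpha> \<Longrightarrow> (j, y j) \<in> C"
    using exR exC by metis
  define v where "v z = (THE u. (z, u) \<in> S)" for z
  have v: "v z = u" if "(z, u) \<in> S" for z u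
  proof -
    have "u' = u" if "(z, u') \<in> S" for u'
      using inj_onD[OF bij_betw_imp_inj_on[OF bij(3)], of "(z, u')" "(z, u)"] that \<open>(z, u) \<in> S\<close> by simp
    then show ?thesis unfolding v_def using that by blast
  qed
  have vM: "v (A i j) = snd (M (i, x i) (j, y j))" if "i < \<alpha>" "j < \<alpha>" for i j
  proof -
    have "fst (M (i, x i) (j, y j)) = A i j"
      using plain(1)[OF xy(1)[OF that(1)] xy(2)[OF that(2)] ns] by simp
    then have "(A i j, snd (M (i, x i) (j, y j))) \<in> S"
      using latin_array_mem[OF lat xy(1)[OF that(1)] xy(2)[OF that(2)]] by (metis prod.collapse)
    then show ?thesis by (rule v)
  qed
  have sM: "snd (M (i, x i) (j, y j)) = (if i = 0 \<and> j = 0 then sh else id) (L (x i) (y j))"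
    if "i < \<alpha>" "j < \<alpha>" for i j
    using plain(2)[OF xy(1)[OF that(1)] xy(2)[OF that(2)] ns] by simp
  show False
  proof (rule no_homotopy[of x y v])
    show "x i \<in> {1..\<mu>}" if "i < \<alpha>" for i using R_less[OF xy(1)[OF that]] by simp
    show "y i \<in> {1..\<mu>}" if "i < \<alpha>" for i using C_less[OF xy(2)[OF that]] by simp
    show "L (x i) (y j) = v (A i j)" if "i < \<alpha>" "j < \<alpha>" "(i, j) \<noteq> (0, 0)" for i j
      using vM[OF that(1,2)] sM[OF that(1,2)] that(3) by auto
    show "sh (L (x 0) (y 0)) = v 0" using vM[of 0 0] sM[of 0 0] A00 a by simp
  qed
qed

end

section \<open>Subarrays with clean rows over at most two rows of \<open>A\<close>\<close>

context switched_subarray1 begin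

lemma at_b_fst: "bt \<Longrightarrow> fst (M rb xb) = B (fst rb) (fst xb)"
  and at_b_snd: "bt \<Longrightarrow> snd (M rb xb) = L 1 1"
  using at_b by simp_all

lemma E0_eq: "\<not> sw \<Longrightarrow> bt \<Longrightarrow> E0 = {rb}" "sw \<Longrightarrow> \<not> bt \<Longrightarrow> E0 = {\<rho> b}" "sw \<Longrightarrow> bt \<Longrightarrow> E0 = {\<rho> b, rb}"
  unfolding E0_def by auto

lemma card2_eq: "card T = 2 \<Longrightarrow> u \<in> T \<Longrightarrow> v \<in> T \<Longrightarrow> u \<noteq> v \<Longrightarrow> T = {u, v}"
  by (metis (no_types, opaque_lifting) card_2_iff insert_commute insertE singletonD)

text \<open>Two exceptional rows alone would form a square of order 2 with the switched cell and the
  cell of \<open>B\<close> on a diagonal. Their symbols differ, since by \<open>w11\<close> no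
  symbol of the cycle lies over \<open>L 1 1\<close>.\<close>

lemma Cl_nonempty: "Cl \<noteq> {}"
proof
  assume "Cl = {}"
  then have "k = card E0" using Cl_card by simp
  then have s: sw bt and k2: "k = 2" using E0(3) cards(7) by (auto split: if_splits)
  obtain d where d: "d < 3" "\<kappa> d \<in> C" using sw_mem(2)[OF s(1)] by blast
  have b: "rb \<in> R" "xb \<in> C" using bt[OF s(2)] by auto
  have "C = {\<kappa> d, xb}" using card2_eq[of C "\<kappa> d" xb] cards k2 d b snd_xb[OF s(2) d(1)] by simp
  then have "M (\<rho> b) (\<kappa> d) = M rb xb"
    using latin_array_square[OF lat sw_mem(1)[OF s(1)] b(1)] snd_rb[OF s(2)] snd_xb[OF s(2) d(1)] by metis
  then show False using at_sw(2)[OF s(1) d] at_b_fst[OF s(2)] at_b_snd[OF s(2)] by simp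
qed

text \<open>The second coordinates would form an intercalate of \<open>L\<close>, unless one of the
  other three cells is shifted. These three positions are excluded by \<open>B_hole2a\<close>,
  \<open>B_hole2b\<close> and \<open>B_hole2c\<close>.\<close>

lemma square_b_False:
  assumes bt "R = {rb, r}" "r \<noteq> rb" "C = {xb, x}" "x \<noteq> xb" "\<not> sw"
  shows False
proof -
  have m: "rb \<in> R" "r \<in> R" "xb \<in> C" "x \<in> C" using assms by auto
  have l: "fst rb < \<alpha>" "fst r < \<alpha>" "fst xb < \<alpha>" "fst x < \<alpha>" "snd r \<in> {1..\<mu>}" "snd x \<in> {1..\<mu>}" "0 < \<alpha>"
    using R_less[OF m(1)] R_less[OF m(2)] C_less[OF m(3)] C_less[OF m(4)] alpha_ge by auto
  note b = bt[OF assms(1)]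
  have ns: "\<not> special rb x" "\<not> special r xb" "\<not> special r x"
    unfolding special_def using assms(3,5,6) by auto
  have e1: "M rb xb = M r x"
    by (rule latin_array_square[OF lat m(1,2)]) (use assms(3,4,5) in auto)
  have e2: "M rb x = M r xb"
    by (rule latin_array_square[OF lat m(1,2), of x xb]) (use assms(3,4,5) in auto)
  have f1: "B (fst rb) (fst xb) = A (fst r) (fst x)"
    using e1 at_b_fst[OF assms(1)] at_b_snd[OF assms(1)] plain(1)[OF m(2,4) ns(3)] by simp
  have f2: "A (fst rb) (fst x) = A (fst r) (fst xb)"
    using e2 plain(1)[OF m(1,4) ns(1)] plain(1)[OF m(2,3) ns(2)] by simp
  have g1: "L 1 1 = (if fst r = 0 \<and> fst x = 0 then sh else id) (L (snd r) (snd x))"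
    using e1 at_b_fst[OF assms(1)] at_b_snd[OF assms(1)] plain(2)[OF m(2,4) ns(3)] by simp
  have g2: "(if fst rb = 0 \<and> fst x = 0 then sh else id) (L 1 (snd x)) =
      (if fst r = 0 \<and> fst xb = 0 then sh else id) (L (snd r) 1)"
    using e2 plain(2)[OF m(1,4) ns(1)] plain(2)[OF m(2,3) ns(2)] b by simp
  consider (a) "fst rb = 0" "fst x = 0" | (b) "fst r = 0" "fst xb = 0" | (c) "fst r = 0" "fst x = 0"
    | (d) "\<not> (fst rb = 0 \<and> fst x = 0)" "\<not> (fst r = 0 \<and> fst xb = 0)" "\<not> (fst r = 0 \<and> fst x = 0)"
    by (cases "fst rb = 0 \<and> fst x = 0"; cases "fst r = 0 \<and> fst xb = 0"; cases "fst r = 0 \<and> fst x = 0") auto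
  then show False
  proof cases
    case a
    then have z: "A (fst r) (fst xb) = 0" "fst xb \<noteq> 0" using f2 A00 b by auto
    have "fst r \<noteq> 0"
    proof
      assume "fst r = 0"
      then have "A 0 (fst xb) = A 0 0" using z(1) A00 by simp
      then show False using A_row_inj[of 0 "fst xb" 0] l z(2) by simp
    qed
    then show False using B_hole2a[of "fst r" "fst xb"] z l f1 a by simp
  next
    case b
    then have z: "A (fst rb) (fst x) = 0" "fst rb \<noteq> 0" using f2 A00 bt[OF assms(1)] by auto
    have "fst x \<noteq> 0"
    proof
      assume "fst x = 0"
      then have "A (fst rb) 0 = A 0 0" using z(1) A00 by simp
      then show False using A_col_inj[of "fst rb" 0 0] l z(2) by simp
    qed
    then show False using B_hole2b[of "fst rb" "fst x"] z l f1 b by simp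
  next
    case c
    then have e: "A (fst rb) 0 = A 0 (fst xb)" "B (fst rb) (fst xb) = 0" using f1 f2 A00 by auto
    have "fst rb \<noteq> 0"
    proof
      assume "fst rb = 0"
      then have "A 0 0 = A 0 (fst xb)" using e by simp
      then show False using A_row_inj[of 0 0 "fst xb"] l b \<open>fst rb = 0\<close> by simp
    qed
    moreover have "fst xb \<noteq> 0"
    proof
      assume "fst xb = 0"
      then have "A (fst rb) 0 = A 0 0" using e by simp
      then show False using A_col_inj[of "fst rb" 0 0] l \<open>fst rb \<noteq> 0\<close> by simp
    qed
    ultimately show False using B_hole2c[of "fst rb" "fst xb"] e l by simp
  next
    case d
    then have g: "L 1 1 = L (snd r) (snd x)" "L 1 (snd x) = L (snd r) 1" using g1 g2 by auto
    have "snd r \<noteq> 1"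
    proof
      assume r1: "snd r = 1"
      then have "snd x = 1" using g(1) L_row_inj[of 1 1 "snd x"] one_mem l by simp
      then show False using only_bt[OF m(2,4) r1] d(3) assms(3) by blast
    qed
    then show False using L_no_intercalate[of 1 "snd r" 1 "snd x"] g one_mem l by simp
  qed
qed

text \<open>With both columns in the cycle, the first coordinates form an intercalate of
  \<open>A\<close> in row \<open>1 - b\<close> and the clean row. With only one, they form a hole of
  order 2 at \<open>(b, d)\<close>.\<close>

lemma square_sw_False:
  assumes sw "\<not> bt" "R = {\<rho> b, r}" "r \<noteq> \<rho> b" "C = {\<kappa> d, x}" "x \<noteq> \<kappa> d" "d < 3"
  shows False
proof -
  have m: "\<rho> b \<in> R" "r \<in> R" "\<kappa> d \<in> C" "x \<in> C" using assms by auto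
  have l: "fst r < \<alpha>" "fst x < \<alpha>" "snd r \<in> {1..\<mu>}" "snd x \<in> {1..\<mu>}" "d < \<alpha>" "2 < \<alpha>" "0 < \<alpha>"
    using R_less[OF m(2)] C_less[OF m(4)] alpha_ge assms by auto
  have ns: "\<not> special r y" for y unfolding special_def using assms(2,4) by auto
  have e1: "M (\<rho> b) (\<kappa> d) = M r x"
    by (rule latin_array_square[OF lat m(1,2)]) (use assms(4-6) in auto)
  have e2: "M (\<rho> b) x = M r (\<kappa> d)"
    by (rule latin_array_square[OF lat m(1,2), of x "\<kappa> d"]) (use assms(4-6) in auto)
  have f1: "A (1 - b) d = A (fst r) (fst x)"
    using e1 at_sw(1)[OF assms(1,7) m(3)] plain(1)[OF m(2,4) ns] by simp
  have f2: "fst (M (\<rho> b) x) = A (fst r) d"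
    using e2 plain(1)[OF m(2,3) ns] by (simp add: \<kappa>_def)
  show False
  proof (cases "x \<in> \<kappa> ` {..<3}")
    case True
    then obtain d' where d': "d' < 3" "x = \<kappa> d'" by auto
    then have "A (1 - b) d' = A (fst r) d" using f2 at_sw(1)[OF assms(1) d'(1)] m(4) by simp
    moreover have "A (1 - b) d = A (fst r) d'" using f1 d' by (simp add: \<kappa>_def)
    moreover have "d \<noteq> d'" using d' assms(6) by auto
    moreover have "d' < \<alpha>" using d' l by simp
    ultimately show False
      using A_no2[of "1 - b" "fst r" d d'] A_row_inj[of "fst r" d d'] b1 l by metis
  next
    case False
    have nsx: "\<not> special (\<rho> b) x" by (rule not_special_sw[OF False])
    have f3: "A b (fst x) = A (fst r) d" using f2 plain(1)[OF m(1,4) nsx] by (simp add: \<rho>_def)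
    have jd: "fst x \<noteq> d"
    proof
      assume "fst x = d"
      then have "fst r = b" using f3 A_col_inj[of b "fst r" d] b1 l by simp
      then show False using f1 \<open>fst x = d\<close> A_col_inj[of "1 - b" b d] b1 l by simp
    qed
    show False
    proof (cases "(b, d) = (0, 2)")
      case False
      then have "\<not> hole2 A \<alpha> b d (A (1 - b) d)" by (rule sw_hole2[OF b assms(7)])
      then show False using l jd f1 f3 unfolding hole2_def by metis
    next
      case True
      \<comment> \<open>Here \<open>A\<close> may have a hole, so the second coordinates must help.
        The switched cell lies over the cell \<open>(r\<^sub>0, c 2)\<close> of \<open>L\<close>,
        and its new symbol over \<open>L r\<^sub>1 (c 2)\<close>: exactly the replacement in
        \<open>no_intercalate\<close>.\<close>
      then have bd: "b = 0" "d = 2" by auto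
      have A12: "A 1 2 = 0" using A1[of 2] by simp
      show False
      proof (cases "fst x = 0")
        case True
        then show False using sw_hole2'[OF l(1)] f1 f3 bd A12 A00 by simp
      next
        case False
        have g1: "L r\<^sub>1 (c 2) = L (snd r) (snd x)"
          using e1 at_sw(3)[OF assms(1,7) m(3)] plain(2)[OF m(2,4) ns] False bd
          by (simp add: P_def) (simp add: \<rho>_def \<kappa>_def)
        have g2: "L r\<^sub>0 (snd x) = L (snd r) (c 2)"
          using e2 plain(2)[OF m(1,4) nsx] plain(2)[OF m(2,3) ns] False bd by (simp add: \<rho>_def \<kappa>_def)
        have mm: "r\<^sub>0 \<in> {1..\<mu>}" "r\<^sub>1 \<in> {1..\<mu>}" "c 2 \<in> {1..\<mu>}" using r01 c[of 2] by auto
        have x0: "snd r \<noteq> r\<^sub>0"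
        proof
          assume "snd r = r\<^sub>0"
          then have "snd x = c 2" using g2 L_row_inj[OF mm(1) l(4) mm(3)] by simp
          then show False using g1 \<open>snd r = r\<^sub>0\<close> L_col_inj[OF mm(2,1,3)] r01 by simp
        qed
        have y0: "snd x \<noteq> c 2" using g2 L_col_inj[OF mm(1) l(3) mm(3)] x0 by auto
        let ?N = "replace (L r\<^sub>1 (c 2)) L r\<^sub>0 (c 2)"
        have N: "?N r\<^sub>0 (c 2) = L r\<^sub>1 (c 2)" "?N r\<^sub>0 (snd x) = L r\<^sub>0 (snd x)"
          "?N (snd r) (c 2) = L r\<^sub>0 (snd x)" "?N (snd r) (snd x) = L r\<^sub>1 (c 2)"
          using g1 g2 x0 y0 by (auto simp: replace_def)
        have ne: "L r\<^sub>1 (c 2) \<noteq> L r\<^sub>0 (snd x)"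
          using g1 g2 y0 L_row_inj[OF l(3,4) mm(3)] by auto
        have "latin_array {r\<^sub>0, snd r} {c 2, snd x} {L r\<^sub>1 (c 2), L r\<^sub>0 (snd x)} ?N"
          by (rule latin_arrayI) (use N ne x0 y0 in \<open>auto simp: card_insert_if\<close>)
        then have "has_intercalate \<mu> ?N"
          by (rule has_subsquareI) (use mm l x0 in \<open>auto simp: card_insert_if\<close>)
        then show False using no_intercalate by blast
      qed
    qed
  qed
qed

text \<open>Three symbols can be located. That of the cell of \<open>B\<close> lies over
  \<open>L 1 1\<close>, so in column \<open>\<kappa> d\<close> it is neither in the switched cell
  nor, by injectivity, in row \<open>rb\<close>; hence it is in row r. The symbols of the cell
  \<open>(\<rho> b, xb)\<close> and of the switched cell are traced likewise, and the first
  coordinates satisfy the equations forbidden by \<open>sw_B\<close>.\<close>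

lemma cube_b_sw_False:
  assumes sw bt "R = {\<rho> b, rb, r}" "r \<noteq> \<rho> b" "r \<noteq> rb"
  shows False
proof -
  obtain d where d: "d < 3" "\<kappa> d \<in> C" using sw_mem(2)[OF assms(1)] by blast
  note b = bt[OF assms(2)]
  have m: "\<rho> b \<in> R" "rb \<in> R" "r \<in> R" "xb \<in> C" using assms b by auto
  have l: "fst rb < \<alpha>" "fst r < \<alpha>" "fst xb < \<alpha>" "d < \<alpha>"
    using R_less[OF m(2)] R_less[OF m(3)] C_less[OF m(4)] alpha_ge d by auto
  have ne: "rb \<noteq> \<rho> b" "\<kappa> d \<noteq> xb" using snd_rb[OF assms(2)] snd_xb[OF assms(2) d(1)] by auto
  have ns: "\<not> special r y" "\<not> special rb (\<kappa> d)" "\<not> special (\<rho> b) xb" for y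
    unfolding special_def using assms(4,5) ne not_\<kappa>[of xb] b by auto
  have rows: "u = \<rho> b \<or> u = rb \<or> u = r" if "u \<in> R" for u using that assms(3) by blast
  have t1: "M r (\<kappa> d) = M rb xb"
  proof -
    obtain u where u: "u \<in> R" "M u (\<kappa> d) = M rb xb"
      using latin_array_col_surj[OF lat d(2) latin_array_mem[OF lat m(2,4)]] by blast
    have "u \<noteq> \<rho> b" using u at_sw(2)[OF assms(1) d] at_b_fst[OF assms(2)] at_b_snd[OF assms(2)] by auto
    moreover have "u \<noteq> rb" using u latin_array_row_inj[OF lat m(2) d(2) m(4)] ne by auto
    ultimately show ?thesis using rows[OF u(1)] u by auto
  qed
  have t2: "M rb (\<kappa> d) = M (\<rho> b) xb"
  proof -
    obtain u where u: "u \<in> R" "M u (\<kappa> d) = M (\<rho> b) xb"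
      using latin_array_col_surj[OF lat d(2) latin_array_mem[OF lat m(1,4)]] by blast
    have "u \<noteq> \<rho> b" using u latin_array_row_inj[OF lat m(1) d(2) m(4)] ne by auto
    moreover have "u \<noteq> r" using u t1 latin_array_col_inj[OF lat m(2,1,4)] ne by auto
    ultimately show ?thesis using rows[OF u(1)] u by auto
  qed
  have t3: "M r xb = M (\<rho> b) (\<kappa> d)"
  proof -
    obtain u where u: "u \<in> R" "M u xb = M (\<rho> b) (\<kappa> d)"
      using latin_array_col_surj[OF lat m(4) latin_array_mem[OF lat m(1) d(2)]] by blast
    have "u \<noteq> \<rho> b" using u latin_array_row_inj[OF lat m(1) m(4) d(2)] ne by auto
    moreover have "u \<noteq> rb" using u at_sw(2)[OF assms(1) d] at_b_fst[OF assms(2)] at_b_snd[OF assms(2)] by auto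
    ultimately show ?thesis using rows[OF u(1)] u by auto
  qed
  have "B (fst rb) (fst xb) = A (fst r) d"
    using t1 at_b_fst[OF assms(2)] at_b_snd[OF assms(2)] plain(1)[OF m(3) d(2) ns(1)] by (simp add: \<kappa>_def)
  moreover have "A b (fst xb) = A (fst rb) d"
    using t2 plain(1)[OF m(2) d(2) ns(2)] plain(1)[OF m(1,4) ns(3)] by (simp add: \<kappa>_def \<rho>_def)
  moreover have "A (1 - b) d = A (fst r) (fst xb)"
    using t3 at_sw(1)[OF assms(1) d] plain(1)[OF m(3,4) ns(1)] by simp
  ultimately show False
    using sw_B[OF switched_subarray.b[OF switched_subarray_axioms] d(1) l(1,3,2)] b by auto
qed

lemma J_bounds: "fst ` C \<subseteq> {..<\<alpha>}" "finite (fst ` C)" using C_less cards by auto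

lemma sum_J: "k = (\<Sum>j\<in>fst ` C. \<gamma> j)"
  unfolding sums(1) by (rule sum.mono_neutral_right) (use J_bounds \<gamma>_pos in auto)

text \<open>In a column over j, the N clean rows show N different symbols over \<open>A i j\<close>,
  so every nonempty column fibre has at least N elements. But k exceeds N by at most 2. Hence there
  is a single column fibre, and the subarray is a subsquare of \<open>L\<close> over one cell of
  \<open>A\<close>, or k is at most 4.\<close>

lemma one_index_False:
  assumes i: "\<And>r. r \<in> Cl \<Longrightarrow> fst r = i" shows False
proof -
  define N J where "N = card Cl" and "J = fst ` C"
  obtain r0 where r0: "r0 \<in> Cl" using Cl_nonempty by blast
  have N0: "0 < N" using Cl_nonempty Cl_card(2) by (simp add: N_def card_gt_0_iff)
  have il: "i < \<alpha>" using R_less[OF Cl_R[OF r0]] i[OF r0] by simp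
  have kN: "k = N + card E0" using Cl_card by (simp add: N_def)
  have u2: "card E0 \<le> 2" using E0(3) by auto
  have gN: "N \<le> \<gamma> j" if j: "j \<in> J" for j
  proof -
    obtain x where x: "x \<in> C" "fst x = j" using j by (auto simp: J_def)
    have "N \<le> \<chi> (A i j)" unfolding N_def
      by (rule col_count[OF x(1)]) (use Cl_R Cl_fst[OF _ x(1)] i x(2) in auto)
    moreover have "\<chi> (A i j) = \<gamma> j" using clean_fibre[OF Cl_clean[OF r0]] i[OF r0] C_less[OF x(1)] x(2) by simp
    ultimately show ?thesis by simp
  qed
  have "(\<Sum>j\<in>J. N) \<le> k" unfolding sum_J J_def[symmetric] by (rule sum_mono) (use gN in simp)
  then have NJ: "card J * N \<le> k" by simp
  have sf: "\<exists>j\<in>J. fst u = A i j" if u: "u \<in> S" for u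
  proof -
    obtain x where "x \<in> C" "M r0 x = u" using latin_array_row_surj[OF lat Cl_R[OF r0] u] by blast
    then show ?thesis using Cl_fst[OF r0, of x] i[OF r0] by (auto simp: J_def)
  qed
  have "J \<noteq> {}" using Cne by (simp add: J_def)
  moreover have fJ: "finite J" "J \<subseteq> {..<\<alpha>}" using J_bounds by (auto simp: J_def)
  ultimately have "0 < card J" by (simp add: card_gt_0_iff)
  then consider "card J = 1" | "2 \<le> card J" by linarith
  then show False
  proof cases
    case 1
    then obtain j where j: "J = {j}" by (rule card_1_singletonE)
    have Cj: "fst x = j" if "x \<in> C" for x using that j by (auto simp: J_def)
    have jl: "j < \<alpha>" using fJ j by simp
    have all: "fst (M r x) = A i j" if "r \<in> R" "x \<in> C" for r x
      using sf[OF latin_array_mem[OF lat that]] j by simp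
    have other: "\<exists>x'\<in>C. x' \<noteq> x" for x
    proof (rule ccontr)
      assume "\<not> ?thesis"
      then have "C \<subseteq> {x}" by blast
      then show False using card_mono[of "{x}" C] cards by simp
    qed
    have nbt: "\<not> bt"
    proof
      assume bt
      note b = bt[OF this]
      obtain x' where x': "x' \<in> C" "x' \<noteq> xb" using other by blast
      have "A (fst rb) j = A i j"
        using plain(1)[of rb x'] all[of rb x'] x' b Cj[of x'] not_special_rb[OF \<open>bt\<close>] by simp
      then show False using at_b_neq[OF \<open>bt\<close>] all[of rb xb] b Cj[of xb] by simp
    qed
    have nsw: "\<not> sw"
    proof
      assume sw
      obtain d where d: "d < 3" "\<kappa> d \<in> C" using sw_mem(2)[OF \<open>sw\<close>] by blast
      have dj: "d = j" using Cj[OF d(2)] by (simp add: \<kappa>_def)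
      obtain x' where x': "x' \<in> C" "x' \<noteq> \<kappa> d" using other by blast
      have "x' \<notin> \<kappa> ` {..<3}" using Cj[OF x'(1)] x'(2) dj by (auto simp: \<kappa>_def)
      then have "A b j = A i j"
        using plain(1)[of "\<rho> b" x'] all[of "\<rho> b" x'] x' sw_mem(1)[OF \<open>sw\<close>] Cj[of x'] not_special_sw
        by (simp add: \<rho>_def)
      then show False using at_sw_neq[OF \<open>sw\<close> d] all[of "\<rho> b" "\<kappa> d"] sw_mem(1)[OF \<open>sw\<close>] d dj by simp
    qed
    have ns: "\<not> special r x" for r x unfolding special_def using nbt nsw by blast
    have Ri: "fst r = i" if "r \<in> R" for r
    proof -
      have "r \<in> Cl" unfolding Cl_def E0_def using that nbt nsw by simp
      then show ?thesis by (rule i)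
    qed
    define f where "f = (if i = 0 \<and> j = 0 then sh else id)"
    have fi: "f v = f v' \<longleftrightarrow> v = v'" if "v \<in> {1..\<mu>}" "v' \<in> {1..\<mu>}" for v v'
      using sh_inj[OF that] by (auto simp: f_def)
    have val: "M r x = (A i j, f (L (snd r) (snd x)))" if "r \<in> R" "x \<in> C" for r x
      using plain[OF that ns] Ri[OF that(1)] Cj[OF that(2)] by (simp add: f_def prod_eq_iff)
    define X Y V where "X = snd ` R" and "Y = snd ` C" and "V = {v \<in> {1..\<mu>}. (A i j, f v) \<in> S}"
    have XY: "X \<subseteq> {1..\<mu>}" "Y \<subseteq> {1..\<mu>}" using R_less C_less by (auto simp: X_def Y_def)
    have ii: "inj_on snd R" "inj_on snd C" using Ri Cj by (auto simp: inj_on_def prod_eq_iff)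
    have cX: "card X = k" "card Y = k" using ii cards by (simp_all add: X_def Y_def card_image)
    have "(\<lambda>v. (A i j, f v)) ` V = S"
    proof (intro set_eqI iffI)
      fix u assume u: "u \<in> S"
      obtain r x where rx: "r \<in> R" "x \<in> C" "M r x = u"
        using latin_array_row_surj[OF lat Cl_R[OF r0] u] Cl_R[OF r0] by blast
      then have "u = (A i j, f (L (snd r) (snd x)))" using val by simp
      moreover have "L (snd r) (snd x) \<in> {1..\<mu>}" using L_mem R_less[OF rx(1)] C_less[OF rx(2)] by blast
      ultimately show "u \<in> (\<lambda>v. (A i j, f v)) ` V" using u by (auto simp: V_def)
    qed (auto simp: V_def)
    moreover have "inj_on (\<lambda>v. (A i j, f v)) V" using fi by (auto simp: inj_on_def V_def)
    ultimately have cV: "card V = k" using cards by (metis card_image)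
    have "latin_array X Y V L"
    proof (rule latin_arrayI)
      show "finite X" "finite Y" using cards by (simp_all add: X_def Y_def)
      show "finite V" by (simp add: V_def)
      show "L x y \<in> V" if xy: "x \<in> X" "y \<in> Y" for x y
      proof -
        obtain r u where ru: "r \<in> R" "u \<in> C" "x = snd r" "y = snd u" using xy unfolding X_def Y_def by blast
        then show ?thesis
          using val[OF ru(1,2)] latin_array_mem[OF lat ru(1,2)]
            L_mem[OF subsetD[OF XY(1) xy(1)] subsetD[OF XY(2) xy(2)]] by (simp add: V_def)
      qed
      show "y = y'" if "x \<in> X" "y \<in> Y" "y' \<in> Y" "L x y = L x y'" for x y y'
        using L_row_inj[of x y y'] that XY by blast
      show "x = x'" if "x \<in> X" "x' \<in> X" "y \<in> Y" "L x y = L x' y" for x x' y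
        using L_col_inj[of x x' y] that XY by blast
    qed (use cX cV in simp_all)
    then have "card X = 1 \<or> card X = \<mu>"
      by (rule L_subsquare) (use XY Rne Cne in \<open>auto simp: X_def Y_def\<close>)
    then have km: "k = \<mu>" using cX cards(7) by simp
    then have full: "X = {1..\<mu>}" "Y = {1..\<mu>}"
      using card_subset_eq[OF _ XY(1)] card_subset_eq[OF _ XY(2)] cX by auto
    have inR: "(i, x) \<in> R" if x: "x \<in> {1..\<mu>}" for x
    proof -
      have "x \<in> X" using x full(1) by simp
      then obtain r where "r \<in> R" "snd r = x" unfolding X_def by (metis imageE)
      then show ?thesis using Ri by (metis prod.collapse)
    qed
    have inC: "(j, y) \<in> C" if y: "y \<in> {1..\<mu>}" for y
    proof -
      have "y \<in> Y" using y full(2) by simp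
      then obtain r where "r \<in> C" "snd r = y" unfolding Y_def by (metis imageE)
      then show ?thesis using Cj by (metis prod.collapse)
    qed
    \<comment> \<open>A full copy of \<open>L\<close> contains the cell over (1, 1). As there is no
      cell of \<open>B\<close> besides the corner, this must be the corner, and the copy is the
      shifted one.\<close>
    have ij: "i = 0" "j = 0" using only_bt[OF inR[OF one_mem] inC[OF one_mem]] nbt by auto
    have "R \<subseteq> {0} \<times> {1..\<mu>}" using Ri R_less ij by (metis SigmaI prod.collapse singletonI subsetI)
    moreover have "{0} \<times> {1..\<mu>} \<subseteq> R" using inR ij by auto
    moreover have "C \<subseteq> {0} \<times> {1..\<mu>}" using Cj C_less ij by (metis SigmaI prod.collapse singletonI subsetI)
    moreover have "{0} \<times> {1..\<mu>} \<subseteq> C" using inC ij by auto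
    ultimately show False using not_copy nsw by blast
  next
    case 2
    then have "2 * N \<le> card J * N" by simp
    then have "2 * N \<le> N + card E0" using NJ kN by linarith
    then have NE: "N \<le> card E0" by simp
    have Rsplit: "R = Cl \<union> E0" using E0(1) by (auto simp: Cl_def)
    consider (b1) "\<not> sw" bt | (s1) sw "\<not> bt" | (s2) sw bt
      using NE N0 E0(3) by (cases sw; cases bt) auto
    then show False
    proof cases
      case b1
      have e0: "E0 = {rb}" by (rule E0_eq(1)[OF b1])
      have e: "E0 = {rb}" "N = 1" "k = 2" using NE N0 kN unfolding e0 by auto
      have "Cl = {r0}" using e(2) r0 by (metis N_def card_1_singletonE singletonD)
      then have R: "R = {rb, r0}" using Rsplit e by auto
      have "rb \<noteq> r0" using r0 e by (auto simp: Cl_def)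
      note b = bt[OF b1(2)]
      obtain x where x: "x \<in> C" "x \<noteq> xb"
      proof -
        have "\<not> C \<subseteq> {xb}" using card_mono[of "{xb}" C] cards by auto
        then show ?thesis using that by blast
      qed
      then have "C = {xb, x}" using card2_eq[of C xb x] cards e b by auto
      then show False using square_b_False[OF b1(2) R _ _ x(2) b1(1)] \<open>rb \<noteq> r0\<close> by auto
    next
      case s1
      have e0: "E0 = {\<rho> b}" by (rule E0_eq(2)[OF s1])
      have e: "E0 = {\<rho> b}" "N = 1" "k = 2" using NE N0 kN unfolding e0 by auto
      have "Cl = {r0}" using e(2) r0 by (metis N_def card_1_singletonE singletonD)
      then have R: "R = {\<rho> b, r0}" using Rsplit e by auto
      have ne: "r0 \<noteq> \<rho> b" using r0 e by (auto simp: Cl_def)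
      obtain d where d: "d < 3" "\<kappa> d \<in> C" using sw_mem(2)[OF s1(1)] by blast
      obtain x where x: "x \<in> C" "x \<noteq> \<kappa> d"
      proof -
        have "\<not> C \<subseteq> {\<kappa> d}" using card_mono[of "{\<kappa> d}" C] cards by auto
        then show ?thesis using that by blast
      qed
      then have "C = {\<kappa> d, x}" using card2_eq[of C "\<kappa> d" x] cards e d by auto
      then show False using square_sw_False[OF s1 R ne _ x(2) d(1)] by blast
    next
      case s2
      have e: "E0 = {\<rho> b, rb}" "card E0 = 2" using E0_eq(3)[OF s2] snd_rb[OF s2(2), of b] by auto
      have "N = 1 \<or> N = 2" using NE N0 e by linarith
      then show False
      proof
        assume "N = 1"
        then have "Cl = {r0}" using r0 by (metis N_def card_1_singletonE singletonD)
        then have R: "R = {\<rho> b, rb, r0}" using Rsplit e by auto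
        have "r0 \<noteq> \<rho> b" "r0 \<noteq> rb" using r0 e by (auto simp: Cl_def)
        then show False using cube_b_sw_False[OF s2 R] by blast
      next
        \<comment> \<open>Order 4, with two symbol fibres of size 2, each filled by the clean rows
          in the columns over one index. So row \<open>rb\<close> must show the other symbol over
          each column index, which makes an intercalate of \<open>A\<close>. Each column fibre has a
          column other than \<open>xb\<close> in which this can be read off.\<close>
        assume N2: "N = 2"
        then have k4: "k = 4" using kN e by simp
        then have "card J = 2" using NJ 2 N2 by simp
        then obtain j j' where J: "J = {j, j'}" "j \<noteq> j'" by (meson card_2_iff)
        have jl: "j < \<alpha>" "j' < \<alpha>" using J fJ by auto
        have "\<gamma> j + \<gamma> j' = 4" using sum_J J k4 unfolding J_def[symmetric] by simp
        then have g: "\<gamma> j = 2" "\<gamma> j' = 2" using gN[of j] gN[of j'] J N2 by auto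
        have ch: "\<chi> (A i u) = 2" if "u \<in> J" for u
          using clean_fibre[OF Cl_clean[OF r0]] i[OF r0] that g jl J by auto
        note b = bt[OF s2(2)]
        have step: "A (fst rb) u \<noteq> A i u \<and> A (fst rb) u \<in> {A i j, A i j'}" if u: "u \<in> J" for u
        proof -
          have "\<not> {x \<in> C. fst x = u} \<subseteq> {xb}"
            using card_mono[of "{xb}" "{x \<in> C. fst x = u}"] g J u unfolding \<gamma>_def by auto
          then obtain x where x: "x \<in> C" "fst x = u" "x \<noteq> xb" by blast
          have fx: "fst (M rb x) = A (fst rb) u"
            using plain(1)[of rb x] not_special_rb[OF s2(2)] x b by simp
          have "A (fst rb) u \<noteq> A i u"
          proof
            assume eq: "A (fst rb) u = A i u"
            have "card (insert rb Cl) \<le> \<chi> (A i u)"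
            proof (rule col_count[OF x(1)])
              show "insert rb Cl \<subseteq> R" using b Cl_R by blast
              show "fst (M r x) = A i u" if "r \<in> insert rb Cl" for r
                using that fx eq Cl_fst[of r x] i[of r] x by auto
            qed
            moreover have "rb \<notin> Cl" using e by (simp add: Cl_def)
            ultimately show False using ch[OF u] N2 Cl_card(2) by (simp add: N_def)
          qed
          moreover have "M rb x \<in> S" using latin_array_mem[OF lat _ x(1)] b by blast
          ultimately show ?thesis using sf[of "M rb x"] fx J by auto
        qed
        have "A (fst rb) j = A i j'" "A (fst rb) j' = A i j" using step[of j] step[of j'] J by auto
        moreover have "fst rb < \<alpha>" using R_less b by blast
        moreover have "i \<noteq> fst rb" using step[of j] J by auto
        ultimately show False using A_no2[of i "fst rb" j j'] il jl by simp
      qed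
    qed
  qed
qed

end

lemma card3_with:
  assumes "card T = 3" "u \<in> T"
  shows "\<exists>v w. T = {u, v, w} \<and> u \<noteq> v \<and> u \<noteq> w \<and> v \<noteq> w"
proof -
  have "finite T" using assms by (auto intro: card_ge_0_finite)
  then have "card (T - {u}) = 2" using assms by simp
  then obtain v w where vw: "T - {u} = {v, w}" "v \<noteq> w" by (meson card_2_iff)
  have "T = insert u (T - {u})" using assms(2) by blast
  then have "T = {u, v, w}" unfolding vw(1) .
  moreover have "u \<noteq> v" "u \<noteq> w" using vw(1) by blast+
  ultimately show ?thesis using vw(2) by blast
qed

lemma card3_with2:
  assumes "card T = 3" "u \<in> T" "v \<in> T" "u \<noteq> v"
  shows "\<exists>w. T = {u, v, w} \<and> u \<noteq> w \<and> v \<noteq> w"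
proof -
  have "finite T" using assms by (auto intro: card_ge_0_finite)
  then have "card (T - {u, v}) = 1" using assms by (simp add: card_Diff_subset)
  then obtain w where w: "T - {u, v} = {w}" by (rule card_1_singletonE)
  have "T = insert u (insert v (T - {u, v}))" using assms(2,3) by blast
  then have "T = {u, v, w}" unfolding w .
  moreover have "u \<noteq> w" "v \<noteq> w" using w by blast+
  ultimately show ?thesis by blast
qed

context corrupting_pair begin

lemma A_mem_iff:
  assumes "t < \<alpha>" "D \<subseteq> {..<\<alpha>}" "A t ` D = Z" "j < \<alpha>" shows "A t j \<in> Z \<longleftrightarrow> j \<in> D"
proof
  assume "A t j \<in> Z"
  then obtain j' where j': "j' \<in> D" "A t j = A t j'" using assms(3) by auto
  then have "j' < \<alpha>" using assms(2) by auto
  then show "j \<in> D" using A_row_inj[OF assms(1,4)] j' by blast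
qed (use assms(3) in blast)

end

context switched_subarray1 begin

text \<open>The cyclic form of a square of order 3 turns the first coordinates into a hole of order
  3 at the cell of \<open>B\<close>.\<close>

lemma cube_b_False:
  assumes "\<not> sw" bt "R = {rb, r, r'}" "rb \<noteq> r" "rb \<noteq> r'" "r \<noteq> r'" "inj_on fst C" "card C = 3"
  shows False
proof -
  note b = bt[OF assms(2)]
  obtain x1 x2 where x: "C = {xb, x1, x2}" "xb \<noteq> x1" "xb \<noteq> x2" "x1 \<noteq> x2"
    using card3_with[OF assms(8)] b by blast
  have m: "rb \<in> R" "r \<in> R" "r' \<in> R" "xb \<in> C" "x1 \<in> C" "x2 \<in> C" using assms(3) x(1) by auto
  obtain a d where ad: "a \<in> {r, r'}" "d \<in> {r, r'}" "a \<noteq> d"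
    "M a xb = M rb x1" "M a x1 = M rb x2" "M a x2 = M rb xb"
    "M d xb = M rb x2" "M d x1 = M rb xb" "M d x2 = M rb x1"
    using latin_array_cube[OF lat assms(3-6) x] by blast
  have ns: "\<not> special rb x1" "\<not> special rb x2" using not_special_rb[OF assms(2)] x by auto
  have ns2: "\<not> special u y" if "u \<in> {r, r'}" for u y
    unfolding special_def using assms(1,4,5) that by auto
  have mm: "a \<in> R" "d \<in> R" using ad(1,2) m by auto
  have l: "fst rb < \<alpha>" "fst a < \<alpha>" "fst d < \<alpha>" "fst xb < \<alpha>" "fst x1 < \<alpha>" "fst x2 < \<alpha>"
    using R_less m(1) mm C_less m by auto
  have f: "fst (M u y) = A (fst u) (fst y)" if "u \<in> {r, r'}" "y \<in> C" for u y
    using plain(1)[OF _ that(2) ns2[OF that(1)]] that(1) m by auto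
  have g: "fst (M rb x1) = A (fst rb) (fst x1)" "fst (M rb x2) = A (fst rb) (fst x2)"
    using plain(1)[OF m(1,5) ns(1)] plain(1)[OF m(1,6) ns(2)] by auto
  have ne: "fst x1 \<noteq> fst xb" "fst x2 \<noteq> fst xb" using assms(7) m x(2,3) by (metis inj_onD)+
  have "hole3 A \<alpha> (fst rb) (fst xb) (B (fst rb) (fst xb))"
    unfolding hole3_def
    using l ne ad(4-9) f[OF ad(1)] f[OF ad(2)] g m at_b_fst[OF assms(2)]
    by (intro exI[of _ "fst a"] exI[of _ "fst d"] exI[of _ "fst x1"] exI[of _ "fst x2"]) metis
  then show False using B_hole3[OF l(1,4)] b by auto
qed

text \<open>The argument depends on the number of cycle columns in C. One gives a hole of order 3,
  two give the pattern of \<open>sw_hole33\<close>, and three give a set of three symbols that is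
  closed under three rows of \<open>A\<close>.\<close>

lemma cube_sw_False:
  assumes sw "\<not> bt" "R = {\<rho> b, r, r'}" "\<rho> b \<noteq> r" "\<rho> b \<noteq> r'" "r \<noteq> r'" "inj_on fst C" "card C = 3"
  shows False
proof -
  have m: "\<rho> b \<in> R" "r \<in> R" "r' \<in> R" using assms(3) by auto
  have ns2: "\<not> special u y" if "u \<in> {r, r'}" for u y
    unfolding special_def using assms(2,4,5) that by auto
  have f: "fst (M u y) = A (fst u) (fst y)" if "u \<in> {r, r'}" "y \<in> C" for u y
    using plain(1)[OF _ that(2) ns2[OF that(1)]] that(1) m by auto
  have g: "fst (M (\<rho> b) y) = A b (fst y)" if "y \<in> C" "y \<notin> \<kappa> ` {..<3}" for y
    using plain(1)[OF m(1) that(1) not_special_sw[OF that(2)]] by (simp add: \<rho>_def)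
  have a3: "3 < \<alpha>" using alpha_ge by simp
  have fk: "fst (\<kappa> d) = d" for d by (simp add: \<kappa>_def)
  obtain d where d: "d < 3" "\<kappa> d \<in> C" using sw_mem(2)[OF assms(1)] by blast
  show False
  proof (cases "\<exists>d'<3. d' \<noteq> d \<and> \<kappa> d' \<in> C")
    case True
    then obtain d' where d': "d' < 3" "d' \<noteq> d" "\<kappa> d' \<in> C" by blast
    then obtain x where x: "C = {\<kappa> d, \<kappa> d', x}" "\<kappa> d \<noteq> x" "\<kappa> d' \<noteq> x"
      using card3_with2[OF assms(8) d(2) d'(3)] by (auto simp: \<kappa>_inj)
    have xC: "x \<in> C" using x by simp
    have kn: "\<kappa> d \<noteq> \<kappa> d'" using d' \<kappa>_inj by auto
    obtain a e where ad: "a \<in> {r, r'}" "e \<in> {r, r'}" "a \<noteq> e"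
      "M a (\<kappa> d) = M (\<rho> b) (\<kappa> d')" "M a (\<kappa> d') = M (\<rho> b) x" "M a x = M (\<rho> b) (\<kappa> d)"
      "M e (\<kappa> d) = M (\<rho> b) x" "M e (\<kappa> d') = M (\<rho> b) (\<kappa> d)" "M e x = M (\<rho> b) (\<kappa> d')"
      using latin_array_cube[OF lat assms(3-6) x(1) kn x(2,3)] by blast
    have mm: "a \<in> R" "e \<in> R" using ad(1,2) m by auto
    have l: "fst a < \<alpha>" "fst e < \<alpha>" "fst x < \<alpha>" "d < \<alpha>" "d' < \<alpha>"
      using R_less mm C_less xC d d' a3 by auto
    have v: "A (fst a) d = A (1 - b) d'" "A (fst a) (fst x) = A (1 - b) d"
      "A (fst e) d' = A (1 - b) d" "A (fst e) (fst x) = A (1 - b) d'"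
      "A (fst a) d' = fst (M (\<rho> b) x)" "A (fst e) d = fst (M (\<rho> b) x)"
      using f[OF ad(1) d(2)] f[OF ad(1) xC] f[OF ad(2) d'(3)] f[OF ad(2) xC] f[OF ad(1) d'(3)] f[OF ad(2) d(2)]
        ad(4-9) at_sw(1)[OF assms(1) d] at_sw(1)[OF assms(1) d'(1,3)] by (auto simp: fk)
    show False
    proof (cases "x \<in> \<kappa> ` {..<3}")
      case False
      then show False
        using sw_hole33[OF b d(1) d'(1) d'(2)[symmetric] l(1,3) v(1) _ v(2) l(2) _ v(3)] v g[OF xC] by auto
    next
      case True
      then obtain d2 where d2: "d2 < 3" "x = \<kappa> d2" by auto
      have dd: "d2 \<noteq> d" "d2 \<noteq> d'" "d2 < \<alpha>" using x d2 a3 by auto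
      have v2: "fst (M (\<rho> b) x) = A (1 - b) d2" "fst x = d2"
        using at_sw(1)[OF assms(1) d2(1)] d2 xC by (auto simp: fk)
      let ?Z = "{A (1 - b) d, A (1 - b) d', A (1 - b) d2}" and ?D = "{d, d', d2}"
      have D: "?D \<subseteq> {..<\<alpha>}" using l dd by auto
      have inj: "A (1 - b) d \<noteq> A (1 - b) d'" "A (1 - b) d \<noteq> A (1 - b) d2" "A (1 - b) d' \<noteq> A (1 - b) d2"
        using A_row_inj[OF b1(4)] l dd d' by auto
      have im: "A (1 - b) ` ?D = ?Z" "A (fst a) ` ?D = ?Z" "A (fst e) ` ?D = ?Z"
        using v v2 by auto
      have n: "1 - b \<noteq> fst a" "1 - b \<noteq> fst e" "fst a \<noteq> fst e"
        using v v2 inj by metis+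
      have "?Z = {..<\<alpha>}"
        by (rule closed3_full[OF b1(4) l(1,2) n])
          (use A_mem_iff[OF b1(4) D im(1)] A_mem_iff[OF l(1) D im(2)] A_mem_iff[OF l(2) D im(3)]
            A_less[OF b1(4)] l dd in auto)
      then have "card ?Z = \<alpha>" by simp
      moreover have "card ?Z \<le> 3" by (simp add: card_insert_if)
      ultimately show False using a3 by simp
    qed
  next
    case False
    obtain x1 x2 where x: "C = {\<kappa> d, x1, x2}" "\<kappa> d \<noteq> x1" "\<kappa> d \<noteq> x2" "x1 \<noteq> x2"
      using card3_with[OF assms(8) d(2)] by blast
    have xC: "x1 \<in> C" "x2 \<in> C" using x by auto
    have nk: "x1 \<notin> \<kappa> ` {..<3}" "x2 \<notin> \<kappa> ` {..<3}" using False x xC by auto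
    obtain a e where ad: "a \<in> {r, r'}" "e \<in> {r, r'}" "a \<noteq> e"
      "M a (\<kappa> d) = M (\<rho> b) x1" "M a x1 = M (\<rho> b) x2" "M a x2 = M (\<rho> b) (\<kappa> d)"
      "M e (\<kappa> d) = M (\<rho> b) x2" "M e x1 = M (\<rho> b) (\<kappa> d)" "M e x2 = M (\<rho> b) x1"
      using latin_array_cube[OF lat assms(3-6) x] by blast
    have mm: "a \<in> R" "e \<in> R" using ad(1,2) m by auto
    have l: "fst a < \<alpha>" "fst e < \<alpha>" "fst x1 < \<alpha>" "fst x2 < \<alpha>" "d < \<alpha>"
      using R_less mm C_less xC d a3 by auto
    have ne: "fst x1 \<noteq> d" "fst x2 \<noteq> d" using assms(7) d(2) xC x(2,3) fk by (metis inj_onD)+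
    have v: "A (fst a) d = A b (fst x1)" "A (fst a) (fst x1) = A b (fst x2)" "A (fst a) (fst x2) = A (1 - b) d"
      "A (fst e) d = A b (fst x2)" "A (fst e) (fst x1) = A (1 - b) d" "A (fst e) (fst x2) = A b (fst x1)"
      using f[OF ad(1) d(2)] f[OF ad(1) xC(1)] f[OF ad(1) xC(2)] f[OF ad(2) d(2)] f[OF ad(2) xC(1)] f[OF ad(2) xC(2)]
        ad(4-9) at_sw(1)[OF assms(1) d] g[OF xC(1) nk(1)] g[OF xC(2) nk(2)] by (auto simp: fk)
    then have "hole3 A \<alpha> b d (A (1 - b) d)"
      unfolding hole3_def using l ne by blast
    then show False using sw_hole3[OF b d(1)] by blast
  qed
qed

text \<open>The supports K and J are exchanged by two rows of \<open>A\<close>, so K has at least 3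
  elements; a column with its at most two exceptional entries bounds K by 4. All fibres over K have
  one size q, and each clean fibre has at most q rows. Comparing \<open>card K * q\<close> with the
  number of rows leaves orders 3, 4 and 6.\<close>

lemma two_index_False:
  assumes ii: "i \<noteq> i'" and only: "\<And>r. r \<in> Cl \<Longrightarrow> fst r = i \<or> fst r = i'"
    and ex: "ri \<in> Cl" "fst ri = i" "ri' \<in> Cl" "fst ri' = i'"
  shows False
proof -
  have il: "i < \<alpha>" "i' < \<alpha>" using R_less[OF Cl_R[OF ex(1)]] R_less[OF Cl_R[OF ex(3)]] ex by auto
  define K J where "K = {z. z < \<alpha> \<and> 0 < \<chi> z}" and "J = fst ` C"
  have AJ: "\<chi> (A i j) = \<gamma> j" "\<chi> (A i' j) = \<gamma> j" if "j < \<alpha>" for j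
    using clean_fibre[OF Cl_clean[OF ex(1)] that] clean_fibre[OF Cl_clean[OF ex(3)] that] ex by auto
  have JK: "A i j \<in> K \<longleftrightarrow> j \<in> J" "A i' j \<in> K \<longleftrightarrow> j \<in> J" if "j < \<alpha>" for j
    using AJ[OF that] \<gamma>_pos[of j] A_less il that by (auto simp: K_def J_def)
  have J\<alpha>: "J \<subseteq> {..<\<alpha>}" "finite J" using J_bounds by (auto simp: J_def)
  have fK: "finite K" "K \<subseteq> {..<\<alpha>}" by (auto simp: K_def)
  have KS: "fst u \<in> K" if "u \<in> S" for u using that S_less \<chi>_pos[of "fst u"] by (auto simp: K_def)
  have level: "3 \<le> card {z. z < \<alpha> \<and> \<chi> z = v}" if v: "\<exists>z<\<alpha>. \<chi> z = v" for v
    by (rule closed_card_ge_3[OF il ii]) (use v AJ A_less il in auto)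
  obtain x0 where x0: "x0 \<in> C" using Cne by blast
  have "0 < \<chi> (A i (fst x0))" using AJ(1) C_less[OF x0] \<gamma>_pos x0 by auto
  then have z0: "A i (fst x0) \<in> K" using A_less il C_less[OF x0] by (simp add: K_def)
  define q where "q = \<chi> (A i (fst x0))"
  have q0: "0 < q" using z0 by (simp add: K_def q_def)
  have K3: "3 \<le> card K"
    by (rule closed_card_ge_3[OF il ii]) (use fK z0 JK in auto)
  have Ku: "card K \<le> 2 + card E0"
  proof -
    have "K \<subseteq> {A i (fst x0), A i' (fst x0)} \<union> (\<lambda>e. fst (M e x0)) ` E0"
    proof
      fix z assume "z \<in> K"
      then have "z \<in> fst ` S" using \<chi>_pos by (simp add: K_def)
      then obtain u where u: "u \<in> S" "fst u = z" by auto
      obtain r where r: "r \<in> R" "M r x0 = u" using latin_array_col_surj[OF lat x0 u(1)] by blast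
      show "z \<in> {A i (fst x0), A i' (fst x0)} \<union> (\<lambda>e. fst (M e x0)) ` E0"
      proof (cases "r \<in> E0")
        case False
        then have "r \<in> Cl" using r by (simp add: Cl_def)
        then show ?thesis using Cl_fst[of r x0] only[of r] x0 r u by auto
      qed (use r u in auto)
    qed
    then have "card K \<le> card ({A i (fst x0), A i' (fst x0)} \<union> (\<lambda>e. fst (M e x0)) ` E0)"
      by (rule card_mono[rotated]) (use E0(2) in simp)
    also have "\<dots> \<le> card {A i (fst x0), A i' (fst x0)} + card ((\<lambda>e. fst (M e x0)) ` E0)" by (rule card_Un_le)
    also have "\<dots> \<le> 2 + card E0" using card_image_le[OF E0(2), of "\<lambda>e. fst (M e x0)"] by (simp add: card_insert_if)
    finally show ?thesis .
  qed
  have u2: "card E0 \<le> 2" using E0(3) by auto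
  \<comment> \<open>Each level set of \<open>\<chi>\<close> is closed under a row permutation and
    has at least 3 elements; two of them do not fit into K.\<close>
  have const: "\<chi> z = q" if z: "z \<in> K" for z
  proof (rule ccontr)
    assume ne: "\<chi> z \<noteq> q"
    let ?Z = "{u. u < \<alpha> \<and> \<chi> u = q}" and ?W = "{u. u < \<alpha> \<and> \<chi> u = \<chi> z}"
    have "3 \<le> card ?Z" "3 \<le> card ?W" using level z z0 by (auto simp: K_def q_def)
    moreover have "card (?Z \<union> ?W) = card ?Z + card ?W" by (rule card_Un_disjoint) (use ne in auto)
    moreover have "card (?Z \<union> ?W) \<le> card K" 
    proof (rule card_mono[OF fK(1)])
      show "?Z \<union> ?W \<subseteq> K" using q0 z by (auto simp: K_def)
    qed
    ultimately show False using Ku u2 by linarith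
  qed
  have gq: "\<gamma> j = q" if "j \<in> J" for j
    using const[of "A i j"] JK AJ(1) that J\<alpha> by auto
  have kq: "k = card K * q"
  proof -
    have "k = (\<Sum>z\<in>K. \<chi> z)" unfolding sums(2)
      by (rule sum.mono_neutral_right) (auto simp: K_def)
    then show ?thesis using const by simp
  qed
  have cJ: "card J = card K"
  proof -
    have "A i ` J = K"
    proof (intro set_eqI iffI)
      fix z assume "z \<in> A i ` J"
      then show "z \<in> K" using JK(1) J\<alpha> by auto
    next
      fix z assume z: "z \<in> K"
      then obtain j where "j < \<alpha>" "A i j = z" using A_row_surj[OF il(1), of z] by (auto simp: K_def)
      then show "z \<in> A i ` J" using JK(1) z by blast
    qed
    moreover have "inj_on (A i) J" using A_row_inj il J\<alpha> by (auto simp: inj_on_def subset_iff)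
    ultimately show ?thesis by (metis card_image)
  qed
  define n n' where "n = card {r \<in> Cl. fst r = i}" and "n' = card {r \<in> Cl. fst r = i'}"
  have nq: "n \<le> q" "n' \<le> q"
  proof -
    have "n \<le> \<chi> (A i (fst x0))" unfolding n_def
      by (rule col_count[OF x0]) (use Cl_R Cl_fst[OF _ x0] in auto)
    then show "n \<le> q" by (simp add: q_def)
    have "n' \<le> \<chi> (A i' (fst x0))" unfolding n'_def
      by (rule col_count[OF x0]) (use Cl_R Cl_fst[OF _ x0] in auto)
    then show "n' \<le> q" using AJ C_less[OF x0] by (simp add: q_def)
  qed
  have nn: "card Cl = n + n'"
  proof -
    have "Cl = {r \<in> Cl. fst r = i} \<union> {r \<in> Cl. fst r = i'}" using only by auto
    moreover have "card ({r \<in> Cl. fst r = i} \<union> {r \<in> Cl. fst r = i'}) = n + n'"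
      unfolding n_def n'_def by (rule card_Un_disjoint) (use Cl_card(2) ii in auto)
    ultimately show ?thesis by simp
  qed
  have "{ri} \<subseteq> {r \<in> Cl. fst r = i}" "{ri'} \<subseteq> {r \<in> Cl. fst r = i'}" using ex by auto
  then have n1: "1 \<le> n" "1 \<le> n'" unfolding n_def n'_def
    using card_mono[of "{r \<in> Cl. fst r = i}" "{ri}"] card_mono[of "{r \<in> Cl. fst r = i'}" "{ri'}"] Cl_card(2) by auto
  have kn: "card K * q = n + n' + card E0" using Cl_card(1) nn kq by simp
  have K3q: "3 * q \<le> card K * q" using K3 by simp
  have Rsplit: "R = Cl \<union> E0" using E0(1) by (auto simp: Cl_def)
  have rowb: "A (fst rb) u \<in> K \<and> A (fst rb) u \<noteq> A i u \<and> A (fst rb) u \<noteq> A i' u"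
    if x: "bt" "x \<in> C" "fst x = u" "x \<noteq> xb" "n = q" "n' = q" for u x
  proof -
    note b = bt[OF x(1)]
    have fx: "fst (M rb x) = A (fst rb) u"
      using plain(1)[of rb x] not_special_rb[OF x(1)] x b by simp
    have "M rb x \<in> S" using latin_array_mem[OF lat _ x(2)] b by blast
    then have "A (fst rb) u \<in> K" using KS[of "M rb x"] fx by simp
    moreover have "A (fst rb) u \<noteq> A l u" if l: "l = i \<or> l = i'" for l
    proof
      assume eq: "A (fst rb) u = A l u"
      let ?T = "{r \<in> Cl. fst r = l}"
      have "card (insert rb ?T) \<le> \<chi> (A l u)"
      proof (rule col_count[OF x(2)])
        show "insert rb ?T \<subseteq> R" using b Cl_R by blast
        show "fst (M r x) = A l u" if "r \<in> insert rb ?T" for r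
          using that fx eq Cl_fst[of r x] x by auto
      qed
      moreover have "rb \<notin> Cl" unfolding Cl_def E0_def using x(1) by simp
      moreover have "\<chi> (A l u) = q" using l AJ[of u] C_less[OF x(2)] x(3) gq[of u] x(2) by (auto simp: J_def)
      moreover have "card ?T = q" using l x(5,6) by (auto simp: n_def n'_def)
      ultimately show False using Cl_card(2) by simp
    qed
    ultimately show ?thesis by blast
  qed
  consider "card E0 = 0" | (e1) "card E0 = 1" | (e2) "card E0 = 2" using u2 by linarith
  then show False
  proof cases
    case 1
    then show False using kn K3q nq n1 by linarith
  next
    case e1
    then have q1: "q = 1" and nn1: "n = 1" "n' = 1" using kn K3q nq n1 by linarith+
    have K3': "card K = 3" using K3 Ku e1 by simp
    then have k3: "k = 3" using kq q1 by simp
    have cl: "Cl = {ri, ri'}"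
      using card2_eq[of Cl ri ri'] nn nn1 ex ii by auto
    have rr: "ri \<noteq> ri'" using ex ii by auto
    have injC: "inj_on fst C"
    proof (rule inj_onI)
      fix x y assume a: "x \<in> C" "y \<in> C" "fst x = fst y"
      have "card {u \<in> C. fst u = fst x} = 1" using gq[of "fst x"] a(1) q1 by (simp add: \<gamma>_def J_def)
      then obtain v where "{u \<in> C. fst u = fst x} = {v}" by (rule card_1_singletonE)
      then show "x = y" using a by (metis (mono_tags, lifting) mem_Collect_eq singletonD)
    qed
    have c3: "card C = 3" using cards k3 by simp
    consider (b1) "\<not> sw" bt | (s1) sw "\<not> bt" using e1 E0(3) by (cases sw; cases bt) auto
    then show False
    proof cases
      case b1
      have R: "R = {rb, ri, ri'}" using Rsplit cl E0_eq(1)[OF b1] by auto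
      have "rb \<noteq> ri" "rb \<noteq> ri'" using ex E0_eq(1)[OF b1] by (auto simp: Cl_def)
      then show False using cube_b_False[OF b1 R _ _ rr injC c3] by blast
    next
      case s1
      have R: "R = {\<rho> b, ri, ri'}" using Rsplit cl E0_eq(2)[OF s1] by auto
      have "\<rho> b \<noteq> ri" "\<rho> b \<noteq> ri'" using ex E0_eq(2)[OF s1] by (auto simp: Cl_def)
      then show False using cube_sw_False[OF s1 R _ _ rr injC c3] by blast
    qed
  next
    case e2
    then have s2: sw bt using E0(3) by (auto split: if_splits)
    note b = bt[OF s2(2)]
    have lb: "fst rb < \<alpha>" "fst xb < \<alpha>" using R_less C_less b by auto
    have "card K = 3 \<or> card K = 4" using K3 Ku e2 by linarith
    then show False
    proof
      \<comment> \<open>The count forces q = 2 with both clean fibres full. Row \<open>rb\<close>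
        then avoids the symbols of rows i and i' in every column fibre while staying in K, so K is
        closed under a third row of \<open>A\<close>.\<close>
      assume k3: "card K = 3"
      then have h: "3 * q = n + n' + 2" using kn e2 by simp
      have "q < 3" using h nq by linarith
      moreover have "1 < q" using h n1 by linarith
      ultimately have "q = 2" by simp
      then have q2: "q = 2" "n = q" "n' = q" using h nq by linarith+
      have st: "A (fst rb) u \<in> K \<and> A (fst rb) u \<noteq> A i u \<and> A (fst rb) u \<noteq> A i' u" if u: "u \<in> J" for u
      proof -
        have "card {x \<in> C. fst x = u} = 2" using gq[OF u] q2(1) by (simp add: \<gamma>_def)
        then have "\<not> {x \<in> C. fst x = u} \<subseteq> {xb}" using card_mono[of "{xb}" "{x \<in> C. fst x = u}"] by auto
        then obtain x where "x \<in> C" "fst x = u" "x \<noteq> xb" by blast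
        then show ?thesis using rowb[OF s2(2)] q2 by blast
      qed
      have u0: "fst x0 \<in> J" using x0 by (simp add: J_def)
      have ne: "i \<noteq> fst rb" "i' \<noteq> fst rb" using st[OF u0] by auto
      have "A (fst rb) ` J \<subseteq> K" using st by blast
      moreover have "inj_on (A (fst rb)) J" using A_row_inj lb J\<alpha> by (auto simp: inj_on_def subset_iff)
      ultimately have im: "A (fst rb) ` J = K" using card_subset_eq[OF fK(1)] cJ by (metis card_image)
      have "K = {..<\<alpha>}"
        by (rule closed3_full[OF il lb(1) ii ne]) (use fK z0 JK A_mem_iff[OF lb(1) J\<alpha>(1) im] in auto)
      then show False using k3 alpha_ge by simp
    next
      \<comment> \<open>The count forces q = 1, and J is a single 4-cycle of the permutation between
        rows i and i'. In the column \<open>xb\<close> row \<open>rb\<close> shows an entry of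
        \<open>B\<close>, so only three columns are controlled; this explains the three entries in
        \<open>A_no4\<close>.\<close>
      assume k4: "card K = 4"
      then have h: "4 * q = n + n' + 2" using kn e2 by simp
      have "q \<le> 1" using h nq by linarith
      then have "q = 1" using q0 by simp
      then have q1: "q = 1" "n = q" "n' = q" using nq n1 by linarith+
      have st: "A (fst rb) u \<in> K \<and> A (fst rb) u \<noteq> A i u \<and> A (fst rb) u \<noteq> A i' u" if u: "u \<in> J" "u \<noteq> fst xb" for u
      proof -
        obtain x where "x \<in> C" "fst x = u" using u(1) by (auto simp: J_def)
        then show ?thesis using rowb[OF s2(2)] q1 u(2) by blast
      qed
      have next_: "\<exists>j'. j' \<in> J \<and> A i j' = A i' j \<and> j' < \<alpha>" if "j \<in> J" for j
      proof -
        have "j < \<alpha>" using J\<alpha>(1) that by auto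
        then have "A i' j \<in> K" using JK that by blast
        moreover obtain j' where "j' < \<alpha>" "A i j' = A i' j" using A_row_surj[OF il(1) A_less[OF il(2) \<open>j < \<alpha>\<close>]] by blast
        ultimately show ?thesis using JK(1)[of j'] by auto
      qed
      define j3 where "j3 = fst xb"
      have j3: "j3 \<in> J" "j3 < \<alpha>" using b lb by (auto simp: J_def j3_def)
      obtain j0 where j0: "j0 \<in> J" "A i j0 = A i' j3" "j0 < \<alpha>" using next_[OF j3(1)] by blast
      obtain j1 where j1: "j1 \<in> J" "A i j1 = A i' j0" "j1 < \<alpha>" using next_[OF j0(1)] by blast
      obtain j2 where j2: "j2 \<in> J" "A i j2 = A i' j1" "j2 < \<alpha>" using next_[OF j1(1)] by blast
      have fp: "A i j \<noteq> A i' j" if "j < \<alpha>" for j using A_col_inj[OF il that] ii by simp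
      have d: "j0 \<noteq> j3" "j1 \<noteq> j0" "j2 \<noteq> j1"
        using fp[OF j3(2)] fp[OF j0(3)] fp[OF j1(3)] j0(2) j1(2) j2(2) by auto
      have d2: "j1 \<noteq> j3" "j2 \<noteq> j0"
        using A_no2[OF il ii j3(2) j0(3) j0(2)] A_no2[OF il ii j0(3) j1(3) j1(2)] j1(2) j2(2) by auto
      \<comment> \<open>A 3-cycle would leave the fourth column of J fixed, but there are no fixed
        points.\<close>
      have d3: "j2 \<noteq> j3"
      proof
        assume e: "j2 = j3"
        have "card {j0, j1, j3} = 3" using d d2 by simp
        moreover have "card J = 4" using cJ k4 by simp
        ultimately have "\<not> J \<subseteq> {j0, j1, j3}" using card_mono[of "{j0, j1, j3}" J] by auto
        then obtain j4 where j4: "j4 \<in> J" "j4 \<notin> {j0, j1, j3}" by blast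
        then have "{j0, j1, j3, j4} \<subseteq> J" "card {j0, j1, j3, j4} = 4" using j0 j1 j3 d d2 by auto
        then have J4: "J = {j0, j1, j3, j4}" using card_subset_eq[OF J\<alpha>(2)] \<open>card J = 4\<close> by metis
        obtain j5 where j5: "j5 \<in> J" "A i j5 = A i' j4" "j5 < \<alpha>" using next_[OF j4(1)] by blast
        have j4l: "j4 < \<alpha>" using J\<alpha> j4 by auto
        have "j5 \<noteq> j4" using fp[OF j4l] j5 by auto
        moreover have "j5 \<noteq> j0" using j5 j0 A_row_inj[OF il(2) j4l j3(2)] j4 by auto
        moreover have "j5 \<noteq> j1" using j5 j1 A_row_inj[OF il(2) j4l j0(3)] j4 by auto
        moreover have "j5 \<noteq> j3" using j5 j2 e A_row_inj[OF il(2) j4l j1(3)] j4 by auto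
        ultimately show False using j5 J4 by blast
      qed
      have "{j0, j1, j2, j3} \<subseteq> J" "card {j0, j1, j2, j3} = 4" using j0 j1 j2 j3 d d2 d3 by auto
      then have J4: "J = {j0, j1, j2, j3}" using card_subset_eq[OF J\<alpha>(2)] cJ k4 by metis
      obtain j5 where j5: "j5 \<in> J" "A i j5 = A i' j2" "j5 < \<alpha>" using next_[OF j2(1)] by blast
      have "j5 \<noteq> j2" using fp[OF j2(3)] j5 by auto
      moreover have "j5 \<noteq> j0" using j5 j0 A_row_inj[OF il(2) j2(3) j3(2)] d3 by auto
      moreover have "j5 \<noteq> j1" using j5 j1 A_row_inj[OF il(2) j2(3) j0(3)] d2 by auto
      ultimately have "j5 = j3" using j5 J4 by blast
      then have c3: "A i' j2 = A i j3" using j5 by simp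
      have KA: "K = {A i j0, A i j1, A i j2, A i j3}"
      proof -
        have "{A i j0, A i j1, A i j2, A i j3} \<subseteq> K"
          using JK(1)[OF j0(3)] JK(1)[OF j1(3)] JK(1)[OF j2(3)] JK(1)[OF j3(2)] j0(1) j1(1) j2(1) j3(1) by simp
        moreover have "card {A i j0, A i j1, A i j2, A i j3} = 4"
          using A_row_inj[OF il(1)] j0(3) j1(3) j2(3) j3(2) d d2 d3 by auto
        ultimately show ?thesis using card_subset_eq[OF fK(1)] k4 by metis
      qed
      have "{A (fst rb) j0, A (fst rb) j1, A (fst rb) j2} \<subseteq> K"
        using st[of j0] st[of j1] st[of j2] j0 j1 j2 d d2 d3 j3_def by auto
      moreover have "fst rb \<noteq> i" "fst rb \<noteq> i'" using st[of j0] j0 d j3_def by auto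
      ultimately show False
        using A_no4[OF il lb(1) ii _ _ j0(3) j1(3) j2(3) j3(2) j1(2)[symmetric] j2(2)[symmetric] c3 j0(2)[symmetric]] KA
        by simp
    qed
  qed
qed

lemma contradiction: False
proof -
  obtain r where r: "r \<in> Cl" using Cl_nonempty by blast
  obtain r' where r': "r' \<in> Cl" "fst r' \<noteq> fst r" using one_index_False[of "fst r"] by blast
  obtain r'' where r'': "r'' \<in> Cl" "fst r'' \<noteq> fst r" "fst r'' \<noteq> fst r'"
    using two_index_False[of "fst r" "fst r'" r r'] r r' by metis
  show False using uniform_False[OF r r'(1) r''(1)] r' r'' by metis
qed

end

lemma (in switched_subarray) switched_False: False
proof -
  from corner_cases consider (a) "\<exists>p. \<forall>r\<in>R1. \<forall>x\<in>C1. (r, x) = (\<omega>, \<omega>) \<or> (r, x) = p"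
    | (b) "card R1 = \<alpha>" "card C1 = \<alpha>" "card S1 = \<alpha>" by blast
  then show False
  proof cases
    case a
    then obtain p where p: "\<forall>r\<in>R1. \<forall>x\<in>C1. (r, x) = (\<omega>, \<omega>) \<or> (r, x) = p" by blast
    define bt where "bt \<longleftrightarrow> fst p \<in> R1 \<and> snd p \<in> C1 \<and> p \<noteq> (\<omega>, \<omega>)"
    interpret switched_subarray1 \<alpha> A B \<mu> L s r\<^sub>0 r\<^sub>1 \<sigma> c w R C S M b sw bt "fst p" "snd p"
    proof
      show "fst p \<in> R \<and> snd p \<in> C \<and> snd (fst p) = 1 \<and> snd (snd p) = 1 \<and> (fst (fst p) \<noteq> 0 \<or> fst (snd p) \<noteq> 0)"
        if bt using that by (auto simp: bt_def R1_iff C1_iff eq_\<omega> prod_eq_iff[of p])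
      show "fst r = 0 \<and> fst x = 0 \<or> bt \<and> r = fst p \<and> x = snd p"
        if "r \<in> R" "x \<in> C" "snd r = 1" "snd x = 1" for r x
      proof (cases "(r, x) = (\<omega>, \<omega>)")
        case True
        then show ?thesis by (simp add: fst_\<omega>)
      next
        case False
        have m: "r \<in> R1" "x \<in> C1" using that by (simp_all add: R1_iff C1_iff)
        then have e: "(r, x) = p" using p False by blast
        then have "r = fst p" "x = snd p" by auto
        moreover have bt unfolding bt_def using m e False by auto
        ultimately show ?thesis by blast
      qed
    qed
    show False by (rule contradiction)
  next
    case b
    then show False by (rule full_corner_False)
  qed
qed

section \<open>From subarrays of \<open>Q\<close> to subarrays of \<open>P\<close>\<close>

context corrupted_product begin

lemma sw_values:
  assumes "r \<in> \<rho> ` {..<2}" "x \<in> \<kappa> ` {..<3}"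
  shows "P r x \<in> \<epsilon> ` {..<3}" "Q r x \<in> \<epsilon> ` {..<3}"
proof -
  obtain b d where bd: "b < 2" "r = \<rho> b" "d < 3" "x = \<kappa> d" using assms by auto
  have d1: "(d + 1) mod 3 \<in> {..<3}" "d \<in> {..<3}" using bd by auto
  show "P r x \<in> \<epsilon> ` {..<3}" "Q r x \<in> \<epsilon> ` {..<3}"
    using bd P_\<rho>0[of d] P_\<rho>1[of d] Q_\<rho>0[of d] Q_\<rho>1[of d] d1
    by (auto simp: less_2_cases_iff simp del: lessThan_iff)
qed

lemma \<epsilon>_values: "z \<in> \<epsilon> ` {..<3} \<Longrightarrow> fst z < 3 \<and> snd z \<in> w ` {..<3}" by (auto simp: \<epsilon>_def)

text \<open>If the rows and columns of the cycle all belong to the subarray, undoing the switch only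
  moves entries inside it.\<close>

lemma Q_P_subarray:
  assumes "latin_array R C S Q" "R \<subseteq> U" "C \<subseteq> U" "C \<noteq> {}" "2 \<le> card R"
    "\<rho> 0 \<in> R" "\<rho> 1 \<in> R" "\<kappa> ` {..<3} \<subseteq> C"
  shows "latin_array R C S P"
proof -
  have k: "0 < card R" using assms by linarith
  note c = latin_array_card[OF assms(1) refl k assms(4)]
  show ?thesis
  proof (rule latin_arrayI)
    show "P r x \<in> S" if rx: "r \<in> R" "x \<in> C" for r x
    proof -
      define r' where "r' = (if x \<in> \<kappa> ` {..<3} then if r = \<rho> 0 then \<rho> 1 else if r = \<rho> 1 then \<rho> 0 else r else r)"
      have "r' \<in> R" using rx assms by (auto simp: r'_def)
      moreover have "Q r' x = P r x" using \<rho>_01 by (auto simp: Q_def r'_def)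
      ultimately show ?thesis using latin_array_mem[OF assms(1) _ rx(2)] by metis
    qed
    show "x = x'" if "r \<in> R" "x \<in> C" "x' \<in> C" "P r x = P r x'" for r x x'
      using P_row_inj[of r x x'] that assms by blast
    show "r = r'" if "r \<in> R" "r' \<in> R" "x \<in> C" "P r x = P r' x" for r r' x
      using P_col_inj[of x r r'] that assms by blast
  qed (use c latin_array_finite[OF assms(1)] in simp_all)
qed

text \<open>A subarray sees nothing of the switch, or contains both switched rows and by closure the
  whole cycle, or sees it through one row. The first two cases lead back to \<open>P\<close>, the
  third is the genuine \<open>switched_subarray\<close>.\<close>

lemma Q_subarray_False:
  assumes lat: "latin_array R C S Q" and RU: "R \<subseteq> U" and CU: "C \<subseteq> U" and ne: "C \<noteq> {}"
    and k: "2 \<le> card R" "card R \<noteq> \<alpha> * \<mu>"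
  shows False
proof -
  have base: "product_subarray \<alpha> A B \<mu> L s r\<^sub>0 r\<^sub>1 \<sigma> c w R C S M {}"
    if "latin_array R C S M" "M = P \<or> M = Q" for M
  proof
    show "latin_array R C S M" by fact
    show "snd (M r x) = snd (P r x)"
      if "r \<in> R" "x \<in> C" "\<not> (r \<in> \<rho> ` {..<2} \<and> x \<in> \<kappa> ` {..<3})" for r x
      using that \<open>M = P \<or> M = Q\<close> Q_eq_P[of x r] by (auto simp: image_iff)
    show "fst (M r x) = fst (P r x)"
      if "r \<in> R" "x \<in> C" "(r, x) \<notin> {}" "\<not> (r \<in> \<rho> ` {..<2} \<and> x \<in> \<kappa> ` {..<3})" for r x
      using that \<open>M = P \<or> M = Q\<close> Q_eq_P[of x r] by (auto simp: image_iff)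
    show "snd (M r x) \<in> w ` {..<3}"
      if "r \<in> R" "x \<in> C" "r \<in> \<rho> ` {..<2}" "x \<in> \<kappa> ` {..<3}" for r x
      using sw_values[OF that(3,4)] \<epsilon>_values \<open>M = P \<or> M = Q\<close> by blast
    show "fst (M r x) < \<alpha>" if "r \<in> R" "x \<in> C" for r x
      using P_mem[of r x] Q_mem[of r x] that RU CU \<open>M = P \<or> M = Q\<close> U_iff by blast
  qed (use RU CU ne k in auto)
  have plain: False if P: "latin_array R C S P" and nc: "R \<noteq> {0} \<times> {1..\<mu>} \<or> C \<noteq> {0} \<times> {1..\<mu>}"
  proof -
    interpret product_subarray \<alpha> A B \<mu> L s r\<^sub>0 r\<^sub>1 \<sigma> c w R C S P "{}" by (rule base[OF P]) simp
    interpret switched_subarray \<alpha> A B \<mu> L s r\<^sub>0 r\<^sub>1 \<sigma> c w R C S P 0 False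
      by unfold_locales (use nc k in auto)
    show False by (rule switched_False)
  qed
  show False
  proof (cases "(\<rho> 0 \<in> R \<or> \<rho> 1 \<in> R) \<and> (\<exists>d<3. \<kappa> d \<in> C)")
    case False
    have "latin_array R C S P"
      by (rule latin_array_cong[OF lat]) (use False in \<open>auto simp: Q_def\<close>)
    \<comment> \<open>The shifted copy of \<open>L\<close> contains \<open>\<rho> 0\<close> and
      \<open>\<kappa> 0\<close> and would see the switch.\<close>
    moreover have "R \<noteq> {0} \<times> {1..\<mu>} \<or> C \<noteq> {0} \<times> {1..\<mu>}"
    proof (rule ccontr)
      assume "\<not> ?thesis"
      then have "\<rho> 0 \<in> R" "\<kappa> 0 \<in> C" using r01 c[of 0] by (auto simp: \<rho>_def \<kappa>_def)
      then show False using False by (metis zero_less_numeral)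
    qed
    ultimately show False by (rule plain)
  next
    case True
    then obtain d where d: "d < 3" "\<kappa> d \<in> C" by blast
    show False
    proof (cases "\<rho> 0 \<in> R \<and> \<rho> 1 \<in> R")
      case both: True
      \<comment> \<open>The symbol of row \<open>\<rho> 0\<close> in one column of the cycle occurs
        in row \<open>\<rho> 1\<close> in the next column. So one column brings in all
        three.\<close>
      have nxt: "\<kappa> ((d + 1) mod 3) \<in> C" if "d < 3" "\<kappa> d \<in> C" for d
      proof -
        have "\<epsilon> ((d + 1) mod 3) \<in> S"
          using latin_array_mem[OF lat _ that(2), of "\<rho> 0"] both Q_\<rho>0[OF that(1)] by simp
        then obtain x where x: "x \<in> C" "Q (\<rho> 1) x = \<epsilon> ((d + 1) mod 3)"
          using latin_array_row_surj[OF lat] both by blast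
        moreover have "Q (\<rho> 1) (\<kappa> ((d + 1) mod 3)) = \<epsilon> ((d + 1) mod 3)" by (rule Q_\<rho>1) simp
        ultimately have "x = \<kappa> ((d + 1) mod 3)"
          using Q_row_inj[OF \<rho>_U[of 1], of x "\<kappa> ((d + 1) mod 3)"] CU \<kappa>_U[of "(d + 1) mod 3"] by auto
        then show ?thesis using x by simp
      qed
      have "d = 0 \<or> d = 1 \<or> d = 2" using d(1) by linarith
      then have "\<kappa> 0 \<in> C \<and> \<kappa> 1 \<in> C \<and> \<kappa> 2 \<in> C"
        using nxt[OF d] nxt[of 0] nxt[of 1] nxt[of 2] d(2) by (auto simp: numeral_2_eq_2)
      moreover have "{..<3::nat} = {0, 1, 2}" by auto
      ultimately have "\<kappa> ` {..<3} \<subseteq> C" by simp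
      then have "latin_array R C S P"
        using Q_P_subarray[OF lat RU CU ne k(1)] both by blast
      moreover have "R \<noteq> {0} \<times> {1..\<mu>} \<or> C \<noteq> {0} \<times> {1..\<mu>}"
        using both by (auto simp: \<rho>_def)
      ultimately show False by (rule plain)
    next
      case False
      then obtain b where b: "b < 2" "\<rho> b \<in> R" "\<rho> (1 - b) \<notin> R"
      proof (cases "\<rho> 0 \<in> R")
        case True
        then show ?thesis using that[of 0] False by simp
      next
        case False
        then show ?thesis using that[of 1] True by simp
      qed
      interpret product_subarray \<alpha> A B \<mu> L s r\<^sub>0 r\<^sub>1 \<sigma> c w R C S Q "{}" by (rule base[OF lat]) simp
      interpret switched_subarray \<alpha> A B \<mu> L s r\<^sub>0 r\<^sub>1 \<sigma> c w R C S Q b True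
      proof
        show "Q r x = (if True \<and> r = \<rho> b \<and> x \<in> \<kappa> ` {..<3} then P (\<rho> (1 - b)) x else P r x)"
          if "r \<in> R" "x \<in> C" for r x
        proof -
          have n: "r \<noteq> \<rho> (1 - b)" using that(1) b(3) by auto
          consider "b = 0" | "b = 1" using b(1) by linarith
          then show ?thesis
          proof cases
            case 1
            then show ?thesis using n by (simp add: Q_def)
          next
            case 2
            then show ?thesis using n \<rho>_01 by (simp add: Q_def)
          qed
        qed
      qed (use b d k in auto)
      show False by (rule switched_False)
    qed
  qed
qed

end

section \<open>Subsquares through a replaced cell\<close>

text \<open>Only the orders 8 and 9 of condition (i) matter here. The order is large enough compared
  with the number of exceptional rows and columns for counting to replace most of the local
  conditions.\<close>

locale starred_subarray = product_subarray where St = "{(rs, xs)}" for rs xs :: "nat \<times> nat" +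
  assumes rs: "rs \<in> R" and xs: "xs \<in> C" and k89: "card R = 8 \<or> card R = 9"
    and M_eq: "r \<in> R \<Longrightarrow> x \<in> C \<Longrightarrow>
        M r x = (if r = rs \<and> x = xs then ((fst (Q r x) + 3) mod \<alpha>, snd (Q r x)) else Q r x)"
begin

definition ex where "ex r x \<longleftrightarrow> fst (M r x) \<noteq> A (fst r) (fst x)"

lemma kk: "8 \<le> k" "k \<le> 9" using k89 by (auto simp: k_def)

lemma Q_fst:
  assumes "r \<in> R" "x \<in> C"
  shows "fst (Q r x) = A (fst r) (fst x) \<or> fst (Q r x) = B (fst r) (fst x) \<or> fst (Q r x) < 3 \<and> fst (A (fst r) (fst x), 0::nat) < 3"
proof (cases "r \<in> \<rho> ` {..<2} \<and> x \<in> \<kappa> ` {..<3}")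
  case True
  then obtain b d where bd: "b < 2" "r = \<rho> b" "d < 3" "x = \<kappa> d" by auto
  have "A b d < 3" using A0[OF bd(3)] A1[OF bd(3)] bd by (auto simp: less_2_cases_iff)
  then show ?thesis using sw_values(2)[of r x] True \<epsilon>_values[of "Q r x"] bd by (simp add: \<rho>_def \<kappa>_def)
next
  case False
  then have "Q r x = P r x" using Q_eq_P[of x r] by (auto simp: less_2_cases_iff image_iff)
  then show ?thesis by (simp add: P_def)
qed

text \<open>The changed entry never agrees with \<open>A\<close> by accident. Adding 3 moves an
  entry of \<open>A\<close> itself, does not lead from \<open>B\<close> to \<open>A\<close> by
  \<open>AB3\<close>, and leads out of {0, 1, 2} at a switched cell, where the entry of
  \<open>A\<close> is below 3.\<close>

lemma star_ex: "ex rs xs"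
proof -
  have l: "fst rs < \<alpha>" "fst xs < \<alpha>" using R_less[OF rs] C_less[OF xs] by auto
  have "(fst (Q rs xs) + 3) mod \<alpha> \<noteq> A (fst rs) (fst xs)"
  proof -
    from Q_fst[OF rs xs] consider "fst (Q rs xs) = A (fst rs) (fst xs)" | "fst (Q rs xs) = B (fst rs) (fst xs)"
      | "fst (Q rs xs) < 3" "A (fst rs) (fst xs) < 3" by auto
    then show ?thesis
    proof cases
      case 1
      then show ?thesis using A_less[OF l] alpha_ge by (auto simp: mod_if split: if_splits)
    next
      case 2
      then show ?thesis using AB3[OF l] by simp
    next
      case 3
      then show ?thesis using alpha_ge by (simp add: mod_if)
    qed
  qed
  then show ?thesis using M_eq[OF rs xs] by (simp add: ex_def)
qed

lemma ex_cases:
  assumes "r \<in> R" "x \<in> C" "ex r x"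
  shows "r = rs \<and> x = xs \<or> r \<in> \<rho> ` {..<2} \<and> x \<in> \<kappa> ` {..<3} \<or> r \<in> R1 \<and> x \<in> C1 \<and> (r, x) \<noteq> (\<omega>, \<omega>)"
proof (rule ccontr)
  assume n: "\<not> ?thesis"
  then have "fst (M r x) = fst (P r x)" using M_fst[OF assms(1,2)] by simp
  moreover have "\<not> (snd r = 1 \<and> snd x = 1) \<or> fst r = 0 \<and> fst x = 0"
    using n assms by (auto simp: R1_iff C1_iff eq_\<omega>)
  ultimately show False using assms(3) A00 B00 by (auto simp: ex_def P_def split: if_splits)
qed

text \<open>Apart from the changed cell, the exceptional cells of a row are either switched cells or
  cells of the block, not both, since the switched rows do not lie over row 1 of \<open>L\<close>.
  In either kind the columns have distinct first coordinates.\<close>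

lemma ex_unique:
  assumes "r \<in> R" "r \<noteq> rs" "x \<in> C" "x' \<in> C" "ex r x" "ex r x'" "fst x = fst x'"
  shows "x = x'"
  using ex_cases[OF assms(1,3,5)] ex_cases[OF assms(1,4,6)] assms(2,7) snd_\<rho>
  by (auto simp: R1_iff C1_iff \<kappa>_def prod_eq_iff)

text \<open>The orders \<alpha> and k are 8 or 9. If they agree, the subarray is the block and the
  corner symbol sticks out. Otherwise S has one symbol outside \<open>S1\<close>, but a column
  outside the block shows symbols outside \<open>S1\<close> in at least two rows.\<close>

lemma full_corner_False:
  assumes "card R1 = \<alpha>" "card C1 = \<alpha>" "card S1 = \<alpha>" shows False
proof -
  note a = alpha_ge
  have sub: "R1 \<subseteq> R" "C1 \<subseteq> C" "S1 \<subseteq> S" unfolding R1_def C1_def S1_def by auto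
  have ak: "\<alpha> \<le> k" using card_mono[OF cards(4) sub(1)] cards assms by simp
  show False
  proof (cases "k = \<alpha>")
    case True
    then have e: "R1 = R" "C1 = C" "S1 = S"
      using card_subset_eq[OF cards(4) sub(1)] card_subset_eq[OF cards(5) sub(2)] card_subset_eq[OF cards(6) sub(3)]
        assms cards by auto
    have "fst ` R1 \<subseteq> {..<\<alpha>}" "fst ` C1 \<subseteq> {..<\<alpha>}" using R_less C_less sub by auto
    then have "fst ` R1 = {..<\<alpha>}" "fst ` C1 = {..<\<alpha>}"
      using card_subset_eq[of "{..<\<alpha>}"] assms fst_inj1 by (simp_all add: card_image)
    then have "0 \<in> fst ` R1" "0 \<in> fst ` C1" using a by auto
    then obtain r x where "r \<in> R1" "x \<in> C1" "fst r = 0" "fst x = 0" by auto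
    then have o: "\<omega> \<in> R" "\<omega> \<in> C" using eq_\<omega> by (metis R1_iff) (metis C1_iff eq_\<omega> \<open>x \<in> C1\<close> \<open>fst x = 0\<close>)
    have "M \<omega> \<omega> \<in> S1" using latin_array_mem[OF lat o] e by simp
    then show False using omega_snd[OF o] by (simp add: S1_iff)
  next
    case False
    then have "\<not> C \<subseteq> C1" using card_mono[OF fin1(2), of C] assms cards ak by auto
    then obtain x where x: "x \<in> C" "x \<notin> C1" by blast
    have cS: "card (S - S1) \<le> 1"
      using card_Diff_subset[OF fin1(3) sub(3)] cards assms kk a False ak by simp
    have "2 \<le> card (R1 - {\<omega>})" using assms fin1 a card_Diff1_le[of R1 \<omega>] by (cases "\<omega> \<in> R1") auto
    then obtain T where "T \<subseteq> R1 - {\<omega>}" "card T = 2" by (meson obtain_subset_with_card_n)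
    then obtain r r' where r: "r \<in> R1" "r \<noteq> \<omega>" "r' \<in> R1" "r' \<noteq> \<omega>" "r \<noteq> r'" by (auto simp: card_2_iff)
    have out: "M u x \<in> S - S1" if u: "u \<in> R1" "u \<noteq> \<omega>" for u
    proof -
      have uR: "u \<in> R" using u sub by blast
      have "M u x \<notin> S1"
      proof
        assume "M u x \<in> S1"
        then obtain x' where "x' \<in> C1" "M u x' = M u x"
          using bij_betw_imp_surj_on[OF row_bij1[OF u]] by (metis imageE)
        then show False using latin_array_row_inj[OF lat uR _ x(1)] sub(2) x(2) by blast
      qed
      then show ?thesis using latin_array_mem[OF lat uR x(1)] by simp
    qed
    have "M r x = M r' x" using out[OF r(1,2)] out[OF r(3,4)] cS cards(6)
      by (metis One_nat_def card_le_Suc0_iff_eq finite_Diff)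
    then show False using latin_array_col_inj[OF lat _ _ x(1), of r r'] r sub(1) by blast
  qed
qed

end

section \<open>Counting exceptional rows and columns\<close>

context starred_subarray begin

definition corner_one where
  "corner_one p \<longleftrightarrow> (\<forall>r\<in>R1. \<forall>x\<in>C1. (r, x) = (\<omega>, \<omega>) \<or> (r, x) = p)"

definition corner_sub where
  "corner_sub \<longleftrightarrow> card R1 \<in> {2, 3} \<and> card C1 = card R1 \<and> card S1 = card R1 \<and> rs \<in> R1 \<and> xs \<in> C1 \<and>
     (\<forall>r\<in>R1. \<forall>x\<in>C1. fst (M r x) \<in> fst ` S1)"

lemma corner: "(\<exists>p. corner_one p) \<or> corner_sub"
  using corner_cases full_corner_False unfolding corner_one_def corner_sub_def by auto

lemma not_clean_ex: "r \<in> R \<Longrightarrow> \<not> clean r \<Longrightarrow> \<exists>x\<in>C. ex r x"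
  by (auto simp: clean_def ex_def)

definition E where "E = {r \<in> R. \<not> clean r}"
definition Cl where "Cl = R - E"

lemma Cl_clean: "r \<in> Cl \<Longrightarrow> clean r" "r \<in> Cl \<Longrightarrow> r \<in> R" by (auto simp: Cl_def E_def)
lemma Cl_fst: "r \<in> Cl \<Longrightarrow> x \<in> C \<Longrightarrow> fst (M r x) = A (fst r) (fst x)"
  using Cl_clean[of r] by (simp add: clean_def)

lemma E_one: assumes "corner_one p" shows "E \<subseteq> {\<rho> 0, \<rho> 1, rs, fst p}"
proof
  fix r assume "r \<in> E"
  then have r: "r \<in> R" "\<not> clean r" by (simp_all add: E_def)
  from not_clean_ex[OF this] obtain x where x: "x \<in> C" "ex r x" by blast
  from ex_cases[OF r(1) x] consider "r = rs" | "r \<in> \<rho> ` {..<2}" | "r \<in> R1" "x \<in> C1" "(r, x) \<noteq> (\<omega>, \<omega>)" by blast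
  then show "r \<in> {\<rho> 0, \<rho> 1, rs, fst p}"
  proof cases
    case 2
    then obtain b where "b < 2" "r = \<rho> b" by auto
    then show ?thesis by (auto simp: less_2_cases_iff)
  next
    case 3
    then have "(r, x) = p" using assms unfolding corner_one_def by blast
    then show ?thesis by auto
  qed simp
qed

lemma E_sub: assumes corner_sub shows "E \<subseteq> {\<rho> 0, \<rho> 1} \<union> R1"
proof
  fix r assume "r \<in> E"
  then have r: "r \<in> R" "\<not> clean r" by (simp_all add: E_def)
  from not_clean_ex[OF this] obtain x where x: "x \<in> C" "ex r x" by blast
  from ex_cases[OF r(1) x] consider "r = rs" | "r \<in> \<rho> ` {..<2}" | "r \<in> R1" by blast
  then show "r \<in> {\<rho> 0, \<rho> 1} \<union> R1"
  proof cases
    case 1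
    then show ?thesis using assms by (simp add: corner_sub_def)
  next
    case 2
    then obtain b where "b < 2" "r = \<rho> b" by auto
    then show ?thesis by (auto simp: less_2_cases_iff)
  qed simp
qed

text \<open>The two switched rows, the row of the changed cell and one row of the block make four.
  If the changed cell lies in a small block, its row is already one of the at most three rows of the
  block.\<close>

lemma cardE: "card E \<le> 4 \<or> card E \<le> 5 \<and> 3 \<le> card C1" "finite E" "E \<subseteq> R"
proof -
  show "finite E" "E \<subseteq> R" using cards by (auto simp: E_def)
  from corner show "card E \<le> 4 \<or> card E \<le> 5 \<and> 3 \<le> card C1"
  proof
    assume "\<exists>p. corner_one p"
    then obtain p where "corner_one p" by blast
    then have "E \<subseteq> {\<rho> 0, \<rho> 1, rs, fst p}" by (rule E_one)
    then have "card E \<le> card {\<rho> 0, \<rho> 1, rs, fst p}" by (rule card_mono[rotated]) simp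
    also have "\<dots> \<le> 4" by (simp add: card_insert_if)
    finally show ?thesis by simp
  next
    assume s: corner_sub
    have "card E \<le> card ({\<rho> 0, \<rho> 1} \<union> R1)" by (rule card_mono) (use E_sub[OF s] fin1 in auto)
    also have "\<dots> \<le> card {\<rho> 0, \<rho> 1} + card R1" by (rule card_Un_le)
    also have "\<dots> \<le> 2 + card R1" by (simp add: card_insert_if)
    finally show ?thesis using s by (auto simp: corner_sub_def)
  qed
qed

text \<open>Serves the extremal case of the next count: two exceptional rows are needed that lie
  over different rows of \<open>A\<close>, and \<open>\<rho> 0\<close>, \<open>\<rho> 1\<close> lie
  over rows 0 and 1.\<close>

lemma four_imp_\<rho>:
  assumes "card E = 4" "card C1 \<le> 2" shows "\<rho> 0 \<in> E \<and> \<rho> 1 \<in> E"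
  using corner
proof
  assume "\<exists>p. corner_one p"
  then obtain p where p: "corner_one p" by blast
  note sub = E_one[OF p]
  have "card {\<rho> 0, \<rho> 1, rs, fst p} \<le> 4" by (simp add: card_insert_if)
  then have "E = {\<rho> 0, \<rho> 1, rs, fst p}" using card_seteq[OF _ sub] assms(1) by simp
  then show ?thesis by simp
next
  assume s: corner_sub
  have "card ({\<rho> 0, \<rho> 1} \<union> R1) \<le> card {\<rho> 0, \<rho> 1} + card R1" by (rule card_Un_le)
  also have "\<dots> \<le> 2 + card R1" by (simp add: card_insert_if)
  also have "\<dots> \<le> 4" using s assms(2) by (simp add: corner_sub_def)
  finally have "E = {\<rho> 0, \<rho> 1} \<union> R1" using card_seteq[OF _ E_sub[OF s]] assms(1) fin1 by simp
  then show ?thesis by simp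
qed

text \<open>Exceptional cells occupy at most six columns: three of the cycle and two more, or three
  of the cycle and at most three of the block. The order is at least 8. Along a clean column the
  sizes of row fibres can be read off.\<close>

lemma clean_column: "\<exists>x\<in>C. \<forall>r\<in>R. fst (M r x) = A (fst r) (fst x)"
proof -
  have "\<exists>T. finite T \<and> card T \<le> 6 \<and> (\<forall>r\<in>R. \<forall>x\<in>C. ex r x \<longrightarrow> x \<in> T)"
    using corner
  proof
    assume "\<exists>p. corner_one p"
    then obtain p where p: "corner_one p" by blast
    have "x \<in> \<kappa> ` {..<3} \<union> {xs, snd p}" if "r \<in> R" "x \<in> C" "ex r x" for r x
    proof -
      from ex_cases[OF that] consider "x = xs" | "x \<in> \<kappa> ` {..<3}" | "r \<in> R1" "x \<in> C1" "(r, x) \<noteq> (\<omega>, \<omega>)" by blast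
      then show ?thesis
      proof cases
        case 3
        then have "(r, x) = p" using p unfolding corner_one_def by blast
        then show ?thesis by auto
      qed auto
    qed
    moreover have "card (\<kappa> ` {..<3} \<union> {xs, snd p}) \<le> 6"
      by (rule order.trans[OF card_Un_le]) (use card_image_le[of "{..<3::nat}" \<kappa>] in \<open>simp add: card_insert_if\<close>)
    ultimately show ?thesis by (intro exI[of _ "\<kappa> ` {..<3} \<union> {xs, snd p}"]) blast
  next
    assume s: corner_sub
    have "x \<in> \<kappa> ` {..<3} \<union> C1" if "r \<in> R" "x \<in> C" "ex r x" for r x
      using ex_cases[OF that] s unfolding corner_sub_def by auto
    moreover have "card (\<kappa> ` {..<3} \<union> C1) \<le> 6"
      by (rule order.trans[OF card_Un_le])
        (use card_image_le[of "{..<3::nat}" \<kappa>] s in \<open>auto simp: corner_sub_def\<close>)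
    ultimately show ?thesis using fin1 by (intro exI[of _ "\<kappa> ` {..<3} \<union> C1"]) blast
  qed
  then obtain T where T: "finite T" "card T \<le> 6" "\<forall>r\<in>R. \<forall>x\<in>C. ex r x \<longrightarrow> x \<in> T" by blast
  then have "\<not> C \<subseteq> T" using card_mono[OF T(1), of C] cards kk by auto
  then obtain x where "x \<in> C" "x \<notin> T" by blast
  then show ?thesis using T(3) by (auto simp: ex_def)
qed

lemma C1_J: "card C1 \<le> card (fst ` C)"
  using card_mono[of "fst ` C" "fst ` C1"] card_image[OF fst_inj1(2)] cards by (auto simp: C1_def)

lemma N3: "3 \<le> card Cl" "k = card Cl + card E" "finite Cl"
proof -
  have "card Cl = card R - card E" unfolding Cl_def by (rule card_Diff_subset[OF cardE(2,3)])
  then show k: "k = card Cl + card E" using card_mono[OF cards(4) cardE(3)] cards by simp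
  then show "3 \<le> card Cl" using cardE(1) kk by auto
  show "finite Cl" using cards by (simp add: Cl_def)
qed

text \<open>Every column fibre has at least N elements, where N counts the clean rows. One column
  fibre would put all first coordinates of symbols at one value, against \<open>star_ex\<close>. Two
  or more leave only k = 8 with four clean and four exceptional rows, so that the exceptional rows
  \<open>\<rho> 0\<close> and \<open>\<rho> 1\<close> must agree in a clean column after projection
  to \<open>A\<close>.\<close>

lemma one_index_False:
  assumes i: "\<And>r. r \<in> Cl \<Longrightarrow> fst r = i" shows False
proof -
  define N J where "N = card Cl" and "J = fst ` C"
  have "Cl \<noteq> {}" using N3(1) by auto
  then obtain r0 where r0: "r0 \<in> Cl" by blast
  have il: "i < \<alpha>" using R_less[OF Cl_clean(2)[OF r0]] i[OF r0] by simp
  have gc: "\<chi> (A i j) = \<gamma> j" if "j < \<alpha>" for j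
    using clean_fibre[OF Cl_clean(1)[OF r0] that] i[OF r0] by simp
  have fJ: "finite J" "J \<subseteq> {..<\<alpha>}" using C_less cards by (auto simp: J_def)
  have gN: "N \<le> \<gamma> j" if j: "j \<in> J" for j
  proof -
    obtain x where x: "x \<in> C" "fst x = j" using j by (auto simp: J_def)
    have "N \<le> \<chi> (A i j)" unfolding N_def
      by (rule col_count[OF x(1)]) (use Cl_clean(2) Cl_fst[OF _ x(1)] i x(2) in auto)
    then show ?thesis using gc j fJ by auto
  qed
  have kJ: "k = (\<Sum>j\<in>J. \<gamma> j)"
    unfolding sums(1) by (rule sum.mono_neutral_right) (use fJ \<gamma>_pos J_def in auto)
  have "(\<Sum>j\<in>J. N) \<le> k" unfolding kJ by (rule sum_mono) (use gN in simp)
  then have NJ: "card J * N \<le> k" by simp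
  have sf: "\<exists>j\<in>J. fst u = A i j" if u: "u \<in> S" for u
  proof -
    obtain x where "x \<in> C" "M r0 x = u" using latin_array_row_surj[OF lat Cl_clean(2)[OF r0] u] by blast
    then show ?thesis using Cl_fst[OF r0, of x] i[OF r0] by (auto simp: J_def)
  qed
  obtain x where x: "x \<in> C" "\<forall>r\<in>R. fst (M r x) = A (fst r) (fst x)" using clean_column by blast
  have xl: "fst x < \<alpha>" using C_less x(1) by blast
  have xJ: "fst x \<in> J" using x by (simp add: J_def)
  then have "0 < card J" using fJ by (auto simp: card_gt_0_iff)
  then consider "card J = 1" | "2 \<le> card J" by linarith
  then show False
  proof cases
    case 1
    then have J: "J = {fst x}" using xJ by (metis card_1_singletonE singletonD)
    have Ri: "fst r = i" if "r \<in> R" for r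
    proof -
      have "fst (M r x) = A i (fst x)" using sf[OF latin_array_mem[OF lat that x(1)]] J by simp
      then have "A (fst r) (fst x) = A i (fst x)" using x(2) that by simp
      then show ?thesis using A_col_inj[OF _ il xl] R_less[OF that] by blast
    qed
    have "fst (M rs xs) = A i (fst x)" using sf[OF latin_array_mem[OF lat rs xs]] J by simp
    moreover have "fst xs = fst x" using J xs by (auto simp: J_def)
    ultimately show False using star_ex Ri[OF rs] by (simp add: ex_def)
  next
    case 2
    have N4: "N \<le> 4"
    proof -
      have "2 * N \<le> card J * N" using 2 by simp
      then show ?thesis using NJ kk by linarith
    qed
    have kN: "k = N + card E" using N3 by (simp add: N_def)
    have "\<not> 3 \<le> card C1"
    proof
      assume "3 \<le> card C1"
      then have "3 \<le> card J" using C1_J by (simp add: J_def)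
      then have "3 * N \<le> card J * N" by simp
      then show False using NJ kN cardE(1) kk by linarith
    qed
    then have E4: "card E \<le> 4" "card C1 \<le> 2" using cardE(1) by auto
    then have e: "k = 8" "N = 4" "card E = 4"
    proof -
      have "2 * N \<le> card J * N" using 2 by simp
      then have "2 * N \<le> k" using NJ by linarith
      then show "k = 8" "N = 4" "card E = 4" using kN E4(1) kk N4 by linarith+
    qed
    then have "card J = 2" using NJ 2 by simp
    then obtain j' where J: "J = {fst x, j'}" "j' \<noteq> fst x"
      using xJ by (metis card_2_iff insert_commute insertE singletonD)
    have "\<gamma> (fst x) + \<gamma> j' = 8" using kJ J e(1) by simp
    then have g4: "\<gamma> (fst x) = 4" using gN[of "fst x"] gN[of j'] J e by auto
    have rho: "\<rho> 0 \<in> E" "\<rho> 1 \<in> E" using four_imp_\<rho>[OF e(3) E4(2)] by auto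
    have step: "A (fst r) (fst x) = A i j'" if r: "r \<in> E" for r
    proof -
      have rR: "r \<in> R" using r cardE(3) by blast
      have fx: "fst (M r x) = A (fst r) (fst x)" using x(2) rR by simp
      have "fst (M r x) \<noteq> A i (fst x)"
      proof
        assume eq: "fst (M r x) = A i (fst x)"
        have "card (insert r Cl) \<le> \<chi> (A i (fst x))"
        proof (rule col_count[OF x(1)])
          show "insert r Cl \<subseteq> R" using rR Cl_clean(2) by blast
          show "fst (M u x) = A i (fst x)" if "u \<in> insert r Cl" for u
            using that eq Cl_fst[of u x] i[of u] x(1) by auto
        qed
        moreover have "r \<notin> Cl" using r by (simp add: Cl_def)
        ultimately show False using gc[OF xl] g4 e(2) N3(3) by (simp add: N_def)
      qed
      then show ?thesis using sf[OF latin_array_mem[OF lat rR x(1)]] J fx by auto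
    qed
    have "A 0 (fst x) = A 1 (fst x)" using step[OF rho(1)] step[OF rho(2)] by (simp add: \<rho>_def)
    then show False using A_col_inj[of 0 1 "fst x"] xl alpha_ge by simp
  qed
qed

text \<open>One of the two clean fibres has at least two rows, so each symbol fibre over K has at
  least two elements and K has at most four. Then all these fibres are equally large, and K turns
  out to be closed under a third row of \<open>A\<close>.\<close>

lemma two_index_False:
  assumes ii: "i \<noteq> i'" and only: "\<And>r. r \<in> Cl \<Longrightarrow> fst r = i \<or> fst r = i'"
    and wx: "ri \<in> Cl" "fst ri = i" "ri' \<in> Cl" "fst ri' = i'"
  shows False
proof -
  have il: "i < \<alpha>" "i' < \<alpha>" using R_less[OF Cl_clean(2)[OF wx(1)]] R_less[OF Cl_clean(2)[OF wx(3)]] wx by auto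
  define K J where "K = {z. z < \<alpha> \<and> 0 < \<chi> z}" and "J = fst ` C"
  have AJ: "\<chi> (A i j) = \<gamma> j" "\<chi> (A i' j) = \<gamma> j" if "j < \<alpha>" for j
    using clean_fibre[OF Cl_clean(1)[OF wx(1)] that] clean_fibre[OF Cl_clean(1)[OF wx(3)] that] wx by auto
  have JK: "A i j \<in> K \<longleftrightarrow> j \<in> J" "A i' j \<in> K \<longleftrightarrow> j \<in> J" if "j < \<alpha>" for j
    using AJ[OF that] \<gamma>_pos[of j] A_less il that by (auto simp: K_def J_def)
  have J\<alpha>: "J \<subseteq> {..<\<alpha>}" "finite J" using C_less cards by (auto simp: J_def)
  have fK: "finite K" "K \<subseteq> {..<\<alpha>}" by (auto simp: K_def)
  have KS: "fst u \<in> K" if "u \<in> S" for u using that S_less \<chi>_pos[of "fst u"] by (auto simp: K_def)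
  have level: "3 \<le> card {z. z < \<alpha> \<and> \<chi> z = v}" if v: "\<exists>z<\<alpha>. \<chi> z = v" for v
    by (rule closed_card_ge_3[OF il ii]) (use v AJ A_less il in auto)
  obtain x0 where x0: "x0 \<in> C" "\<forall>r\<in>R. fst (M r x0) = A (fst r) (fst x0)" using clean_column by blast
  have xl: "fst x0 < \<alpha>" using C_less x0(1) by blast
  have "0 < \<chi> (A i (fst x0))" using AJ(1) xl \<gamma>_pos x0 by auto
  then have z0: "A i (fst x0) \<in> K" using A_less il xl by (simp add: K_def)
  define q where "q = \<chi> (A i (fst x0))"
  have q0: "0 < q" using z0 by (simp add: K_def q_def)
  have K3: "3 \<le> card K"
    by (rule closed_card_ge_3[OF il ii]) (use fK z0 JK in auto)
  define n n' where "n = card {r \<in> Cl. fst r = i}" and "n' = card {r \<in> Cl. fst r = i'}"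
  have nn: "card Cl = n + n'"
  proof -
    have "Cl = {r \<in> Cl. fst r = i} \<union> {r \<in> Cl. fst r = i'}" using only by auto
    moreover have "card ({r \<in> Cl. fst r = i} \<union> {r \<in> Cl. fst r = i'}) = n + n'"
      unfolding n_def n'_def by (rule card_Un_disjoint) (use N3(3) ii in auto)
    ultimately show ?thesis by simp
  qed
  have chi2: "2 \<le> \<chi> z" if z: "z \<in> K" for z
  proof -
    have zl: "z < \<alpha>" using z by (simp add: K_def)
    obtain j where j: "j < \<alpha>" "A i j = z" using A_row_surj[OF il(1) zl] by blast
    then have jJ: "j \<in> J" using JK z by blast
    then obtain x where x: "x \<in> C" "fst x = j" by (auto simp: J_def)
    have "n \<le> \<chi> z" unfolding n_def
      by (rule col_count[OF x(1)]) (use Cl_clean(2) Cl_fst[OF _ x(1)] j x in auto)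
    moreover obtain j' where j': "j' < \<alpha>" "A i' j' = z" using A_row_surj[OF il(2) zl] by blast
    then have jJ': "j' \<in> J" using JK z by blast
    then obtain x' where x': "x' \<in> C" "fst x' = j'" by (auto simp: J_def)
    have "n' \<le> \<chi> z" unfolding n'_def
      by (rule col_count[OF x'(1)]) (use Cl_clean(2) Cl_fst[OF _ x'(1)] j' x' in auto)
    ultimately show ?thesis using nn N3(1) by linarith
  qed
  have kK: "k = (\<Sum>z\<in>K. \<chi> z)" unfolding sums(2)
    by (rule sum.mono_neutral_right) (auto simp: K_def)
  have "(\<Sum>z\<in>K. 2) \<le> k" unfolding kK by (rule sum_mono) (use chi2 in simp)
  then have K4: "card K \<le> 4" using kk by simp
  have const: "\<chi> z = q" if z: "z \<in> K" for z
  proof (rule ccontr)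
    assume ne: "\<chi> z \<noteq> q"
    let ?Z = "{u. u < \<alpha> \<and> \<chi> u = q}" and ?W = "{u. u < \<alpha> \<and> \<chi> u = \<chi> z}"
    have "3 \<le> card ?Z" "3 \<le> card ?W" using level z z0 by (auto simp: K_def q_def)
    moreover have "card (?Z \<union> ?W) = card ?Z + card ?W" by (rule card_Un_disjoint) (use ne in auto)
    moreover have "card (?Z \<union> ?W) \<le> card K"
    proof (rule card_mono[OF fK(1)])
      show "?Z \<union> ?W \<subseteq> K" using q0 z by (auto simp: K_def)
    qed
    ultimately show False using K4 by linarith
  qed
  have q2: "2 \<le> q" using chi2[OF z0] by (simp add: q_def)
  have gq: "\<gamma> j = q" if "j \<in> J" for j
    using const[of "A i j"] JK AJ(1) that J\<alpha> by auto
  have cJ: "card J = card K"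
  proof -
    have "A i ` J = K"
    proof (intro set_eqI iffI)
      fix z assume "z \<in> A i ` J"
      then show "z \<in> K" using JK(1) J\<alpha> by auto
    next
      fix z assume z: "z \<in> K"
      then obtain j where "j < \<alpha>" "A i j = z" using A_row_surj[OF il(1), of z] by (auto simp: K_def)
      then show "z \<in> A i ` J" using JK(1) z by blast
    qed
    moreover have "inj_on (A i) J" using A_row_inj il J\<alpha> by (auto simp: inj_on_def subset_iff)
    ultimately show ?thesis by (metis card_image)
  qed
  have phi: "\<phi> l = \<chi> (A l (fst x0))" if "l < \<alpha>" for l using col_fibre[OF x0(1) _ that] x0(2) by simp
  have "\<not> K \<subseteq> {A i (fst x0), A i' (fst x0)}"
    using card_mono[of "{A i (fst x0), A i' (fst x0)}" K] K3 by (auto simp: card_insert_if split: if_splits)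
  then obtain z where z: "z \<in> K" "z \<noteq> A i (fst x0)" "z \<noteq> A i' (fst x0)" by blast
  then have zl: "z < \<alpha>" by (simp add: K_def)
  obtain l where l: "l < \<alpha>" "A l (fst x0) = z" using A_col_surj[OF xl zl] by blast
  have li: "i \<noteq> l" "i' \<noteq> l" using l z by auto
  have pl: "\<phi> l = q" using phi[OF l(1)] const[OF z(1)] l(2) by simp
  \<comment> \<open>The row fibre over l has two rows, one of which misses the changed cell; the
    column fibre over j has two columns, and by \<open>ex_unique\<close> one of them is not
    exceptional in that row.\<close>
  have AlJ: "A l j \<in> K" if j: "j \<in> J" for j
  proof -
    have "\<not> {r \<in> R. fst r = l} \<subseteq> {rs}"
      using card_mono[of "{rs}" "{r \<in> R. fst r = l}"] pl q2 by (auto simp: \<phi>_def)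
    then obtain r where r: "r \<in> R" "fst r = l" "r \<noteq> rs" by blast
    have "2 \<le> card {x \<in> C. fst x = j}" using gq[OF j] q2 by (simp add: \<gamma>_def)
    then obtain T where "T \<subseteq> {x \<in> C. fst x = j}" "card T = 2" by (meson obtain_subset_with_card_n)
    then obtain x x' where x: "x \<in> C" "fst x = j" "x' \<in> C" "fst x' = j" "x \<noteq> x'" by (auto simp: card_2_iff)
    have "\<not> ex r x \<or> \<not> ex r x'" using ex_unique[OF r(1,3) x(1,3)] x by auto
    then obtain y where y: "y \<in> C" "fst y = j" "\<not> ex r y" using x by blast
    then have "fst (M r y) = A l j" using r by (simp add: ex_def)
    then show ?thesis using KS[OF latin_array_mem[OF lat r(1) y(1)]] by simp
  qed
  have "A l ` J \<subseteq> K" using AlJ by blast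
  moreover have "inj_on (A l) J" using A_row_inj l J\<alpha> by (auto simp: inj_on_def subset_iff)
  ultimately have im: "A l ` J = K" using card_subset_eq[OF fK(1)] cJ by (metis card_image)
  have "K = {..<\<alpha>}"
    by (rule closed3_full[OF il l(1) ii li]) (use fK z0 JK A_mem_iff[OF l(1) J\<alpha>(1) im] in auto)
  then show False using K4 alpha_ge by simp
qed

text \<open>All fibres are singletons, since 16 exceeds the order. So every exceptional cell has
  another one in its row and another one in its column, and the few exceptional cells cannot satisfy
  this.\<close>

lemma three_index_False:
  assumes "r \<in> Cl" "r' \<in> Cl" "r'' \<in> Cl" "fst r \<noteq> fst r'" "fst r \<noteq> fst r''" "fst r' \<noteq> fst r''"
  shows False
proof -
  note a = alpha_ge
  obtain q where q0: "\<forall>z<\<alpha>. \<chi> z = q" "\<forall>j<\<alpha>. \<gamma> j = q" and q': "k = \<alpha> * q" "0 < q"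
    using clean3[OF assms(1-3)[THEN Cl_clean(1)] assms(4-6)] by blast
  have q1: "q = 1"
  proof (rule ccontr)
    assume "q \<noteq> 1"
    then have "2 \<le> q" using q'(2) by simp
    then have "\<alpha> * 2 \<le> k" unfolding q'(1) by (rule mult_le_mono2)
    then show False using kk a by simp
  qed
  obtain x0 where x0: "x0 \<in> C" "\<forall>r\<in>R. fst (M r x0) = A (fst r) (fst x0)" using clean_column by blast
  have f: "\<phi> l = 1" if "l < \<alpha>" for l
    using col_fibre[OF x0(1) _ that] x0(2) q0(1) q1 A_less[OF that] C_less[OF x0(1)] by simp
  have bij: "bij_betw fst C {..<\<alpha>}" "bij_betw fst R {..<\<alpha>}" "bij_betw fst S {..<\<alpha>}"
    by (rule fibre_one_bij; use f q0 q1 R_less C_less S_less in \<open>simp add: \<phi>_def \<gamma>_def \<chi>_def\<close>)+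
  have Sinj: "u = u'" if "u \<in> S" "u' \<in> S" "fst u = fst u'" for u u'
    using bij_betw_imp_inj_on[OF bij(3)] that by (meson inj_onD)
  have Minj: "x = x'" if "r \<in> R" "x \<in> C" "x' \<in> C" "fst (M r x) = fst (M r x')" for r x x'
    using Sinj latin_array_mem[OF lat that(1)] latin_array_row_inj[OF lat that(1-3)] that by blast
  have row: "\<exists>x'\<in>C. x' \<noteq> x \<and> ex r x'" if t: "r \<in> R" "x \<in> C" "ex r x" for r x
  proof (rule ccontr)
    assume n: "\<not> ?thesis"
    have "(fst \<circ> M r) x = (A (fst r) \<circ> fst) x"
    proof (rule bij_betw_agree_but_one[of _ C "{..<\<alpha>}"])
      show "bij_betw (fst \<circ> M r) C {..<\<alpha>}" using bij_betw_trans[OF latin_array_row[OF lat t(1)] bij(3)] .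
      show "bij_betw (A (fst r) \<circ> fst) C {..<\<alpha>}" using bij_betw_trans[OF bij(1) A_row] R_less[OF t(1)] by blast
      show "(fst \<circ> M r) x' = (A (fst r) \<circ> fst) x'" if "x' \<in> C" "x' \<noteq> x" for x'
        using n that by (auto simp: ex_def)
    qed (rule t(2))
    then show False using t(3) by (simp add: ex_def)
  qed
  have col: "\<exists>r'\<in>R. r' \<noteq> r \<and> ex r' x" if t: "r \<in> R" "x \<in> C" "ex r x" for r x
  proof (rule ccontr)
    assume n: "\<not> ?thesis"
    have "fst (M r x) = A (fst r) (fst x)"
    proof (rule bij_betw_agree_but_one[of "\<lambda>r. fst (M r x)" R "{..<\<alpha>}" "\<lambda>r. A (fst r) (fst x)" r])
      show "bij_betw (\<lambda>r. fst (M r x)) R {..<\<alpha>}"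
        using bij_betw_trans[OF latin_array_col[OF lat t(2)] bij(3)] by (simp add: comp_def)
      show "bij_betw (\<lambda>r. A (fst r) (fst x)) R {..<\<alpha>}"
        using bij_betw_trans[OF bij(2) A_col[of "fst x"]] C_less[OF t(2)] by (simp add: comp_def)
      show "fst (M r' x) = A (fst r') (fst x)" if "r' \<in> R" "r' \<noteq> r" for r'
        using n that by (auto simp: ex_def)
    qed (rule t(1))
    then show False using t(3) by (simp add: ex_def)
  qed
  from corner show False
  proof
    assume "\<exists>p. corner_one p"
    then obtain p where p: "corner_one p" by blast
    have cp: "(r, x) = p" if "r \<in> R1" "x \<in> C1" "(r, x) \<noteq> (\<omega>, \<omega>)" for r x
      using that p unfolding corner_one_def by blast
    \<comment> \<open>A lone cell of the block could have only the changed cell as partner, both in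
      its row and in its column. These would have to be different cells.\<close>
    have only: "r = rs \<and> x = xs \<or> r \<in> \<rho> ` {..<2} \<and> x \<in> \<kappa> ` {..<3}" if t: "r \<in> R" "x \<in> C" "ex r x" for r x
    proof (rule ccontr)
      assume n: "\<not> ?thesis"
      then have c1: "r \<in> R1" "x \<in> C1" "(r, x) \<noteq> (\<omega>, \<omega>)" using ex_cases[OF t] by blast+
      have pe: "p = (r, x)" using cp[OF c1] by simp
      obtain x' where x': "x' \<in> C" "x' \<noteq> x" "ex r x'" using row[OF t] by blast
      have "r = rs"
        using ex_cases[OF t(1) x'(1,3)] cp[of r x'] pe x'(2) not_sw[of r x'] c1(1) by (auto simp: R1_iff)
      obtain r' where r': "r' \<in> R" "r' \<noteq> r" "ex r' x" using col[OF t] by blast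
      have "r' = rs"
        using ex_cases[OF r'(1) t(2) r'(3)] cp[of r' x] pe r'(2) not_sw[of r' x] c1(2) by (auto simp: C1_iff)
      then show False using \<open>r = rs\<close> r'(2) by simp
    qed
    obtain x' where x': "x' \<in> C" "x' \<noteq> xs" "ex rs x'" using row[OF rs xs star_ex] by blast
    have "rs \<in> \<rho> ` {..<2}" using only[OF rs x'(1,3)] x'(2) by blast
    then obtain b where b: "b < 2" "rs = \<rho> b" by auto
    obtain r' where r': "r' \<in> R" "r' \<noteq> rs" "ex r' xs" using col[OF rs xs star_ex] by blast
    have "xs \<in> \<kappa> ` {..<3}" using only[OF r'(1) xs r'(3)] r'(2) by blast
    then obtain d where d: "d < 3" "xs = \<kappa> d" by auto
    \<comment> \<open>The changed cell is now also a switched cell and shows v + 3 with v < 3. Row b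
      of \<open>A\<close> has the value v + 3 in a column from 3 on, which is not exceptional, so
      the symbol would occur twice in the row.\<close>
    have Ab: "A b e < 3" if "e < 3" for e
      using A0[OF that] A1[OF that] b(1) that by (auto simp: less_2_cases_iff)
    define v where "v = fst (Q rs xs)"
    have v3: "v < 3" using sw_values(2)[of rs xs] \<epsilon>_values[of "Q rs xs"] b d by (simp add: v_def)
    have Mv: "fst (M rs xs) = v + 3" using M_eq[OF rs xs] v3 a by (simp add: v_def)
    have bl: "b < \<alpha>" using b a by simp
    obtain j where j: "j < \<alpha>" "A b j = v + 3" using A_row_surj[OF bl, of "v + 3"] v3 a by auto
    have j3: "3 \<le> j" using Ab[of j] j(2) by (cases "j < 3") auto
    have "j \<in> fst ` C" using bij_betw_imp_surj_on[OF bij(1)] j(1) by simp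
    then obtain x where x: "x \<in> C" "fst x = j" by auto
    have "\<not> ex rs x" using only[OF rs x(1)] x(2) j3 d by (auto simp: \<kappa>_def)
    then have "fst (M rs x) = fst (M rs xs)" using Mv j x b by (simp add: ex_def \<rho>_def)
    then have "x = xs" using Minj[OF rs x(1) xs] by simp
    then show False using x j3 d by (simp add: \<kappa>_def)
  next
    assume s: corner_sub
    define J K where "J = fst ` C1" and "K = fst ` S1"
    have cJ: "card J = card R1" "card K = card R1" "card (fst ` R1) = card R1"
      using s fst_inj1 by (auto simp: J_def K_def card_image corner_sub_def)
    have JK: "J \<subseteq> {..<\<alpha>}" "K \<subseteq> {..<\<alpha>}" "finite K" "K \<noteq> {}" "finite J"
      using C_less S_less fin1 cJ s by (auto simp: J_def K_def C1_iff S1_iff corner_sub_def)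
    \<comment> \<open>Outside the block these rows multiply as in \<open>A\<close>. By bijectivity
      of the projection, \<open>A\<close> therefore maps J onto K just as the block does, and K
      would be a closed set of 2 or 3 symbols.\<close>
    have im: "A (fst r) ` J = K" if r: "r \<in> R1" for r
    proof -
      have rR: "r \<in> R" and rl: "fst r < \<alpha>" using r R_less by (auto simp: R1_iff)
      have "A (fst r) ` J \<subseteq> K"
      proof
        fix z assume "z \<in> A (fst r) ` J"
        then obtain x where x: "x \<in> C1" "z = A (fst r) (fst x)" by (auto simp: J_def)
        have xC: "x \<in> C" using x by (simp add: C1_iff)
        have "A (fst r) (fst x) < \<alpha>" using A_less[OF rl] C_less[OF xC] by blast
        then have "A (fst r) (fst x) \<in> fst ` S" using bij_betw_imp_surj_on[OF bij(3)] by simp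
        then obtain u where u: "u \<in> S" "fst u = z" using x(2) by auto
        obtain y where y: "y \<in> C" "M r y = u" using latin_array_row_surj[OF lat rR u(1)] by blast
        show "z \<in> K"
        proof (cases "y \<in> C1")
          case True
          then have "fst (M r y) \<in> fst ` S1" using s r unfolding corner_sub_def by blast
          then show ?thesis using y u by (simp add: K_def)
        next
          case False
          have "\<not> ex r y"
            using ex_cases[OF rR y(1)] False s not_sw[of r y] r by (auto simp: corner_sub_def R1_iff)
          then have "A (fst r) (fst y) = A (fst r) (fst x)" using y u x by (simp add: ex_def)
          then have "fst y = fst x" using A_row_inj[OF rl] C_less[OF y(1)] C_less[OF xC] by blast
          then have "y = x" using bij_betw_imp_inj_on[OF bij(1)] y(1) xC by (meson inj_onD)
          then show ?thesis using False x by simp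
        qed
      qed
      moreover have "inj_on (A (fst r)) J" using A_row_inj[OF rl] JK by (auto simp: inj_on_def subset_iff)
      ultimately show ?thesis using card_subset_eq[OF JK(3)] cJ by (metis card_image)
    qed
    have mem: "A i j \<in> K \<longleftrightarrow> j \<in> J" if i: "i \<in> fst ` R1" and j: "j < \<alpha>" for i j
    proof -
      obtain r where r: "r \<in> R1" "i = fst r" using i by auto
      have "i < \<alpha>" using r R_less by (auto simp: R1_iff)
      then show ?thesis using A_mem_iff[OF _ JK(1) _ j, of i K] im[OF r(1)] r(2) by simp
    qed
    have Il: "i < \<alpha>" if "i \<in> fst ` R1" for i using that R_less by (auto simp: R1_iff)
    have "card R1 = 2 \<or> card R1 = 3" using s by (auto simp: corner_sub_def)
    then show False
    proof
      assume c2: "card R1 = 2"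
      then obtain i i' where i: "fst ` R1 = {i, i'}" "i \<noteq> i'" using cJ by (metis card_2_iff)
      have "3 \<le> card K"
        by (rule closed_card_ge_3[of i i']) (use i Il mem JK in auto)
      then show False using cJ c2 by simp
    next
      assume c3: "card R1 = 3"
      then obtain i i' i'' where i: "fst ` R1 = {i, i', i''}" "i \<noteq> i'" "i \<noteq> i''" "i' \<noteq> i''"
        using cJ by (metis card_3_iff)
      have "K = {..<\<alpha>}"
        by (rule closed3_full[of i i' i'']) (use i Il mem JK in auto)
      then show False using cJ c3 a by simp
    qed
  qed
qed

lemma starred_False: False
proof -
  have "Cl \<noteq> {}" using N3(1) by auto
  then obtain r where r: "r \<in> Cl" by blast
  obtain r' where r': "r' \<in> Cl" "fst r' \<noteq> fst r" using one_index_False[of "fst r"] by blast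
  obtain r'' where r'': "r'' \<in> Cl" "fst r'' \<noteq> fst r" "fst r'' \<noteq> fst r'"
    using two_index_False[of "fst r" "fst r'" r r'] r r' by metis
  show False using three_index_False[OF r r'(1) r''(1)] r' r'' by metis
qed

end

section \<open>Encoding as a matrix\<close>

lemma row_perm_latin:
  assumes "latin_square n T" "i \<in> {1..n}" "x \<in> {1..n}"
  shows "row_perm n T i j (T i x) = T j x"
proof -
  have lat: "latin_array {1..n} {1..n} {1..n} T"
    using assms(1) latin_on_imp_array unfolding latin_square_def by blast
  have "(THE y. y \<in> {1..n} \<and> T i y = T i x) = x"
    by (rule the_equality) (use latin_array_row_inj[OF lat assms(2)] assms(3) in auto)
  then show ?thesis using latin_array_mem[OF lat assms(2,3)] by (simp add: row_perm_def)
qed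

lemma cyclic_on_three:
  assumes "f a = b" "f b = d" "f d = a" shows "cyclic_on f {a, b, d}"
proof (rule cyclic_on_singleI)
  show "a \<in> {a, b, d}" by simp
  have a: "a \<in> orbit f a" "b \<in> orbit f a" "d \<in> orbit f a"
    using assms orbit.base[of f a] orbit.step[of _ f a] by metis+
  have "z \<in> {a, b, d}" if "z \<in> orbit f a" for z
    using that by induction (use assms in auto)
  then show "{a, b, d} = orbit f a" using a by blast
qed

text \<open>The cycle is given by unordered sets. Following the row permutation from the symbol in
  column y3 numbers it cyclically.\<close>

lemma cond_ii_cycle:
  assumes "latin_square n T" "cond_ii n T s"
  shows "\<exists>x1 x2 (y :: nat \<Rightarrow> nat) (\<zeta> :: nat \<Rightarrow> nat). x1 \<in> {2..n} \<and> x2 \<in> {2..n} \<and> x1 \<noteq> x2 \<and> (\<forall>d<3. y d \<in> {2..n}) \<and>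
    (\<forall>d<3. T x1 (y d) = \<zeta> d \<and> T x2 (y d) = \<zeta> ((d + 1) mod 3) \<and> \<zeta> d \<noteq> add_mod n (T 1 1) s) \<and>
    \<not> has_intercalate n (replace (T x2 (y 2)) T x1 (y 2))"
proof -
  have lat: "latin_array {1..n} {1..n} {1..n} T"
    using assms(1) latin_on_imp_array unfolding latin_square_def by blast
  from assms(2) obtain x1 x2 y1 y2 y3 z1 z2 z3 where
    h: "row_cycle n T x1 x2 {y1, y2, y3} {z1, z2, z3}" "card {y1, y2, y3} = 3"
      "1 \<notin> {x1, x2, y1, y2, y3}" "add_mod n (T 1 1) s \<notin> {z1, z2, z3}"
      "\<not> has_intercalate n (replace (T x2 y3) T x1 y3)" unfolding cond_ii_def by blast
  define Y Z where "Y = {y1, y2, y3}" and "Z = {z1, z2, z3}"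
  define \<tau> where "\<tau> = row_perm n T x1 x2"
  have r: "x1 \<in> {1..n}" "x2 \<in> {1..n}" "x1 \<noteq> x2" "Z \<subseteq> {1..n}" "cyclic_on \<tau> Z" "Y = {v \<in> {1..n}. T x1 v \<in> Z}"
    using h(1) unfolding row_cycle_def Y_def Z_def \<tau>_def by auto
  have \<tau>: "\<tau> (T x1 v) = T x2 v" if "v \<in> {1..n}" for v
    unfolding \<tau>_def by (rule row_perm_latin[OF assms(1) r(1) that])
  have zin: "\<tau> z \<in> Z" if "z \<in> Z" for z using cyclic_on_inI[OF r(5) that] .
  have col: "\<exists>v\<in>Y. T x1 v = z" if z: "z \<in> Z" for z
  proof -
    have "z \<in> {1..n}" using z r(4) by blast
    then obtain v where "v \<in> {1..n}" "T x1 v = z" using latin_array_row_surj[OF lat r(1)] by blast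
    then show ?thesis using r(6) z by blast
  qed
  have cZ: "card Z = 3"
  proof -
    have "T x1 ` Y = Z" using col r(6) by blast
    moreover have "inj_on (T x1) Y" using latin_array_row_inj[OF lat r(1)] r(6) by (auto simp: inj_on_def)
    ultimately show ?thesis using h(2) card_image[of "T x1" Y] unfolding Y_def by simp
  qed
  have fp: "\<tau> z \<noteq> z" if z: "z \<in> Z" for z
  proof -
    obtain v where v: "v \<in> Y" "T x1 v = z" using col[OF z] by blast
    then have "v \<in> {1..n}" using r(6) by blast
    then show ?thesis using \<tau>[of v] v latin_array_col_inj[OF lat r(1,2), of v] r(3) by auto
  qed
  have inj: "z = z'" if z: "z \<in> Z" "z' \<in> Z" "\<tau> z = \<tau> z'" for z z'
  proof -
    obtain v v' where v: "v \<in> Y" "T x1 v = z" "v' \<in> Y" "T x1 v' = z'" using col[OF z(1)] col[OF z(2)] by blast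
    then have "v \<in> {1..n}" "v' \<in> {1..n}" using r(6) by auto
    then show ?thesis using \<tau>[of v] \<tau>[of v'] v latin_array_row_inj[OF lat r(2), of v v'] z by auto
  qed
  define a where "a = T x1 y3"
  have y3: "y3 \<in> {1..n}" "a \<in> Z" using r(6) unfolding a_def Y_def by auto
  define u v where "u = \<tau> a" and "v = \<tau> (\<tau> a)"
  have uv: "u \<in> Z" "v \<in> Z" "u \<noteq> a" "v \<noteq> u" using zin fp y3 by (auto simp: u_def v_def)
  have va: "v \<noteq> a"
  proof
    assume va: "v = a"
    have "orbit \<tau> a \<subseteq> {a, u}"
    proof
      fix z assume "z \<in> orbit \<tau> a"
      then show "z \<in> {a, u}" by induction (use va in \<open>auto simp: u_def v_def\<close>)
    qed
    moreover have "Z = orbit \<tau> a" using orbit_cyclic_eq3[OF r(5) y3(2)] by simp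
    ultimately have "card Z \<le> card {a, u}" by (intro card_mono) auto
    then show False using cZ by (simp add: card_insert_if split: if_splits)
  qed
  have "{a, u, v} \<subseteq> Z" "card {a, u, v} = 3" using y3 uv va by auto
  then have Zeq: "Z = {a, u, v}" using cZ card_subset_eq[of Z "{a, u, v}"] Z_def by auto
  have tv: "\<tau> v = a"
  proof -
    have "\<tau> v \<noteq> u" using inj[of v a] uv y3 va by (auto simp: u_def)
    then show ?thesis using zin[OF uv(2)] fp[OF uv(2)] Zeq by auto
  qed
  obtain yu yv where y: "yu \<in> Y" "T x1 yu = u" "yv \<in> Y" "T x1 yv = v" using col uv by blast
  have yn: "yu \<in> {1..n}" "yv \<in> {1..n}" using y r(6) by auto
  \<comment> \<open>The column of the replaced cell comes last, at index 2.\<close>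
  define yy where "yy d = (if d = 0 then yu else if d = 1 then yv else y3)" for d :: nat
  define \<zeta> where "\<zeta> d = (if d = 0 then u else if d = 1 then v else a)" for d :: nat
  have ne1: "x1 \<noteq> 1" "x2 \<noteq> 1" "yu \<noteq> 1" "yv \<noteq> 1" "y3 \<noteq> 1" using h(3) y(1,3) unfolding Y_def by auto
  have main: "T x1 (yy d) = \<zeta> d \<and> T x2 (yy d) = \<zeta> ((d + 1) mod 3) \<and> \<zeta> d \<noteq> add_mod n (T 1 1) s"
    if d: "d < 3" for d
  proof -
    have "\<zeta> d \<in> Z" using uv y3 by (auto simp: \<zeta>_def)
    then have "\<zeta> d \<noteq> add_mod n (T 1 1) s" using h(4) unfolding Z_def by auto
    moreover have "d = 0 \<or> d = 1 \<or> d = 2" using d by linarith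
    moreover have "T x2 yu = v" "T x2 yv = a" "T x2 y3 = u"
      using \<tau>[OF yn(1)] \<tau>[OF yn(2)] \<tau>[OF y3(1)] y tv by (auto simp: u_def v_def a_def)
    ultimately show ?thesis using y by (auto simp: yy_def \<zeta>_def a_def)
  qed
  have rng: "yy d \<in> {2..n}" for d using yn y3(1) ne1 by (auto simp: yy_def)
  have "x1 \<in> {2..n}" "x2 \<in> {2..n}" using r(1,2) ne1 by auto
  moreover have "\<not> has_intercalate n (replace (T x2 (yy 2)) T x1 (yy 2))" using h(5) by (simp add: yy_def)
  ultimately have "x1 \<in> {2..n} \<and> x2 \<in> {2..n} \<and> x1 \<noteq> x2 \<and> (\<forall>d<3. yy d \<in> {2..n}) \<and>
    (\<forall>d<3. T x1 (yy d) = \<zeta> d \<and> T x2 (yy d) = \<zeta> ((d + 1) mod 3) \<and> \<zeta> d \<noteq> add_mod n (T 1 1) s) \<and>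
    \<not> has_intercalate n (replace (T x2 (yy 2)) T x1 (yy 2))" using r(3) main rng by blast
  then show ?thesis by blast
qed

section \<open>The switched product as a matrix\<close>

context corrupted_product begin

text \<open>The first coordinate is the leading digit, so that adding a multiple of \<mu> changes
  only it. The pair (0, 1) becomes 1, hence the cell (1, 1) of the new square is the corner in which
  both corruptions meet.\<close>

definition enc :: "nat \<times> nat \<Rightarrow> nat" where "enc r = fst r * \<mu> + snd r"
definition dec :: "nat \<Rightarrow> nat \<times> nat" where "dec m = ((m - 1) div \<mu>, (m - 1) mod \<mu> + 1)"
definition NQ :: matrix where "NQ m m' = enc (Q (dec m) (dec m'))"

lemma dec_enc: assumes "snd r \<in> {1..\<mu>}" shows "dec (enc r) = r"
proof -
  obtain v where v: "snd r = Suc v" "v < \<mu>" using assms by (cases "snd r") auto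
  then have "enc r - 1 = fst r * \<mu> + v" by (simp add: enc_def)
  then show ?thesis using v by (simp add: dec_def prod_eq_iff)
qed

lemma enc_mem: assumes "r \<in> U" shows "enc r \<in> {1..\<alpha> * \<mu>}"
proof -
  have "fst r + 1 \<le> \<alpha>" "snd r \<in> {1..\<mu>}" using assms by (auto simp: U_iff)
  then have "(fst r + 1) * \<mu> \<le> \<alpha> * \<mu>" by (intro mult_le_mono1)
  then show ?thesis using \<open>snd r \<in> _\<close> by (auto simp: enc_def)
qed

lemma dec_mem: assumes "m \<in> {1..\<alpha> * \<mu>}" shows "dec m \<in> U" "enc (dec m) = m"
proof -
  have "m - 1 < \<alpha> * \<mu>" using assms by auto
  then have "(m - 1) div \<mu> < \<alpha>" using mu by (simp add: less_mult_imp_div_less)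
  then show "dec m \<in> U" using mu by (auto simp: dec_def U_iff Suc_le_eq)
  show "enc (dec m) = m" using assms by (simp add: dec_def enc_def)
qed

lemma enc_inj: "r \<in> U \<Longrightarrow> r' \<in> U \<Longrightarrow> enc r = enc r' \<longleftrightarrow> r = r'"
  using dec_enc U_iff by metis

lemma dec_inj: "inj_on dec {1..\<alpha> * \<mu>}" by (rule inj_on_inverseI[of _ enc]) (rule dec_mem(2))

lemma subsquare_decode:
  assumes "has_subsquare (\<alpha> * \<mu>) T k" "0 < k"
    and T: "\<And>m m'. m \<in> {1..\<alpha> * \<mu>} \<Longrightarrow> m' \<in> {1..\<alpha> * \<mu>} \<Longrightarrow> T m m' = enc (M (dec m) (dec m'))"
    and M: "\<And>r x. r \<in> U \<Longrightarrow> x \<in> U \<Longrightarrow> M r x \<in> U"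
  shows "\<exists>R C S. latin_array R C S M \<and> R \<subseteq> U \<and> C \<subseteq> U \<and> card R = k \<and> card C = k"
proof -
  obtain R C S where lat: "latin_array R C S T" and s: "R \<subseteq> {1..\<alpha> * \<mu>}" "C \<subseteq> {1..\<alpha> * \<mu>}"
    and c: "card R = k" "card C = k" using assms(1) by (rule has_subsquareE)
  have Cne: "C \<noteq> {}" "R \<noteq> {}" using c assms(2) by auto
  note cS = latin_array_card[OF lat c(1) assms(2) Cne(1)]
  have dM: "dec (T m m') = M (dec m) (dec m')" if "m \<in> R" "m' \<in> C" for m m'
  proof -
    have mm: "m \<in> {1..\<alpha> * \<mu>}" "m' \<in> {1..\<alpha> * \<mu>}" using that s by auto
    have "M (dec m) (dec m') \<in> U" by (rule M[OF dec_mem(1)[OF mm(1)] dec_mem(1)[OF mm(2)]])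
    then show ?thesis using T[OF mm] dec_enc U_iff by metis
  qed
  have S: "S \<subseteq> {1..\<alpha> * \<mu>}"
  proof
    fix z assume "z \<in> S"
    obtain m where m: "m \<in> R" using Cne by blast
    then obtain m' where m': "m' \<in> C" "T m m' = z" using latin_array_row_surj[OF lat m \<open>z \<in> S\<close>] by blast
    have mm: "m \<in> {1..\<alpha> * \<mu>}" "m' \<in> {1..\<alpha> * \<mu>}" using m m' s by auto
    show "z \<in> {1..\<alpha> * \<mu>}"
      using T[OF mm] m'(2) enc_mem[OF M[OF dec_mem(1)[OF mm(1)] dec_mem(1)[OF mm(2)]]] by simp
  qed
  have cd: "card (dec ` R) = k" "card (dec ` C) = k" "card (dec ` S) = k"
    using c cS(2) card_image[OF inj_on_subset[OF dec_inj]] s S by metis+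
  have "latin_array (dec ` R) (dec ` C) (dec ` S) M"
  proof (rule latin_arrayI)
    show "M r x \<in> dec ` S" if rx: "r \<in> dec ` R" "x \<in> dec ` C" for r x
    proof -
      obtain m m' where m: "m \<in> R" "m' \<in> C" "r = dec m" "x = dec m'" using rx by blast
      then show ?thesis using dM[OF m(1,2)] latin_array_mem[OF lat m(1,2)] by (metis imageI)
    qed
    show "x = x'" if rx: "r \<in> dec ` R" "x \<in> dec ` C" "x' \<in> dec ` C" "M r x = M r x'" for r x x'
    proof -
      obtain m a b where m: "m \<in> R" "a \<in> C" "b \<in> C" "r = dec m" "x = dec a" "x' = dec b" using rx by blast
      have "T m a \<in> S" "T m b \<in> S" using latin_array_mem[OF lat m(1)] m by auto
      moreover have "dec (T m a) = dec (T m b)" using dM[OF m(1,2)] dM[OF m(1,3)] m rx(4) by simp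
      ultimately have "T m a = T m b" using dec_inj S by (meson inj_onD subsetD)
      then show ?thesis using latin_array_row_inj[OF lat m(1-3)] m by blast
    qed
    show "r = r'" if rx: "r \<in> dec ` R" "r' \<in> dec ` R" "x \<in> dec ` C" "M r x = M r' x" for r r' x
    proof -
      obtain m a b where m: "m \<in> C" "a \<in> R" "b \<in> R" "x = dec m" "r = dec a" "r' = dec b" using rx by blast
      have "T a m \<in> S" "T b m \<in> S" using latin_array_mem[OF lat _ m(1)] m by auto
      moreover have "dec (T a m) = dec (T b m)" using dM[OF m(2,1)] dM[OF m(3,1)] m rx(4) by simp
      ultimately have "T a m = T b m" using dec_inj S by (meson inj_onD subsetD)
      then show ?thesis using latin_array_col_inj[OF lat m(2,3,1)] m by blast
    qed
  qed (use cd cS latin_array_finite[OF lat] in simp_all)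
  moreover have "dec ` R \<subseteq> U" "dec ` C \<subseteq> U" using dec_mem(1) s by blast+
  ultimately show ?thesis using cd by blast
qed

lemma NQ_enc: "r \<in> U \<Longrightarrow> x \<in> U \<Longrightarrow> NQ (enc r) (enc x) = enc (Q r x)"
  using dec_enc U_iff by (simp add: NQ_def)

lemma am: "80 \<le> \<alpha> * \<mu>" using mult_le_mono[OF alpha_ge(1) mu] by simp

lemma NQ_latin: "latin_square (\<alpha> * \<mu>) NQ"
proof -
  let ?I = "{1..\<alpha> * \<mu>}"
  have "latin_array ?I ?I ?I NQ"
  proof (rule latin_arrayI)
    show "NQ r x \<in> ?I" if "r \<in> ?I" "x \<in> ?I" for r x
      unfolding NQ_def by (rule enc_mem[OF Q_mem[OF dec_mem(1)[OF that(1)] dec_mem(1)[OF that(2)]]])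
    show "x = x'" if t: "r \<in> ?I" "x \<in> ?I" "x' \<in> ?I" "NQ r x = NQ r x'" for r x x'
    proof -
      note d = dec_mem(1)[OF t(1)] dec_mem(1)[OF t(2)] dec_mem(1)[OF t(3)]
      have "Q (dec r) (dec x) = Q (dec r) (dec x')"
        using t(4) enc_inj[OF Q_mem[OF d(1,2)] Q_mem[OF d(1,3)]] by (simp add: NQ_def)
      then have "dec x = dec x'" by (rule Q_row_inj[OF d])
      then show ?thesis using dec_mem(2)[OF t(2)] dec_mem(2)[OF t(3)] by metis
    qed
    show "r = r'" if t: "r \<in> ?I" "r' \<in> ?I" "x \<in> ?I" "NQ r x = NQ r' x" for r r' x
    proof -
      note d = dec_mem(1)[OF t(3)] dec_mem(1)[OF t(1)] dec_mem(1)[OF t(2)]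
      have "Q (dec r) (dec x) = Q (dec r') (dec x)"
        using t(4) enc_inj[OF Q_mem[OF d(2,1)] Q_mem[OF d(3,1)]] by (simp add: NQ_def)
      then have "dec r = dec r'" by (rule Q_col_inj[OF d])
      then show ?thesis using dec_mem(2)[OF t(1)] dec_mem(2)[OF t(2)] by metis
    qed
  qed simp_all
  then have "latin_on ?I ?I ?I NQ" by (rule array_imp_latin_on) (use alpha_ge mu in auto)
  then show ?thesis by (simp add: latin_square_def)
qed

lemma NQ_no_subsquare:
  assumes "has_subsquare (\<alpha> * \<mu>) NQ k" "2 \<le> k" "k \<noteq> \<alpha> * \<mu>" shows False
proof -
  obtain R C S where "latin_array R C S Q" "R \<subseteq> U" "C \<subseteq> U" "card R = k" "card C = k"
    using subsquare_decode[OF assms(1), of Q] Q_mem assms(2) by (auto simp: NQ_def)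
  then show False using Q_subarray_False[of R C S] assms by force
qed

lemma NQ_N_infinity: "N_infinity (\<alpha> * \<mu>) NQ"
  unfolding N_infinity_def
proof (intro conjI ballI notI)
  show "latin_square (\<alpha> * \<mu>) NQ" by (rule NQ_latin)
  fix k assume k: "k \<in> {2..\<alpha> * \<mu> - 1}" "has_subsquare (\<alpha> * \<mu>) NQ k"
  have "k \<noteq> \<alpha> * \<mu>" using k(1) am unfolding atLeastAtMost_iff by linarith
  then show False using NQ_no_subsquare[of k] k by simp
qed

lemma add_mod_enc:
  assumes "r \<in> U" shows "add_mod (\<alpha> * \<mu>) (enc r) (3 * \<mu>) = enc ((fst r + 3) mod \<alpha>, snd r)"
proof -
  have "snd r \<in> {1..\<mu>}" using assms U_iff by blast
  then obtain v where v: "snd r = Suc v" "v < \<mu>" by (cases "snd r") auto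
  define m where "m = (fst r + 3) * \<mu> + v"
  have "enc r + 3 * \<mu> - 1 = m" using v by (simp add: enc_def m_def algebra_simps)
  moreover have "m mod (\<mu> * \<alpha>) = \<mu> * (m div \<mu> mod \<alpha>) + m mod \<mu>" by (rule mod_mult2_eq)
  moreover have "m div \<mu> = fst r + 3" "m mod \<mu> = v" using v by (auto simp: m_def)
  ultimately show ?thesis using v by (simp add: add_mod_def enc_def mult.commute)
qed

text \<open>A subsquare that misses the replaced cell would be a subsquare of \<open>Q\<close>,
  which \<open>Q_subarray_False\<close> excludes.\<close>

lemma NQ_replaced:
  assumes "has_subsquare (\<alpha> * \<mu>) (replace (enc z) NQ i j) k" "2 \<le> k" "k \<noteq> \<alpha> * \<mu>" "z \<in> U"
    "i \<in> {1..\<alpha> * \<mu>}" "j \<in> {1..\<alpha> * \<mu>}"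
  shows "\<exists>R C S. latin_array R C S (\<lambda>r x. if r = dec i \<and> x = dec j then z else Q r x) \<and>
    R \<subseteq> U \<and> C \<subseteq> U \<and> card R = k \<and> card C = k \<and> dec i \<in> R \<and> dec j \<in> C"
proof -
  let ?M = "\<lambda>r x. if r = dec i \<and> x = dec j then z else Q r x"
  have "\<exists>R C S. latin_array R C S ?M \<and> R \<subseteq> U \<and> C \<subseteq> U \<and> card R = k \<and> card C = k"
  proof (rule subsquare_decode[OF assms(1)])
    show "replace (enc z) NQ i j m m' = enc (?M (dec m) (dec m'))"
      if "m \<in> {1..\<alpha> * \<mu>}" "m' \<in> {1..\<alpha> * \<mu>}" for m m'
    proof -
      have "dec m = dec i \<longleftrightarrow> m = i" "dec m' = dec j \<longleftrightarrow> m' = j"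
        using dec_inj that assms(5,6) by (auto dest: inj_onD)
      then show ?thesis by (auto simp: replace_def NQ_def)
    qed
  qed (use assms Q_mem in auto)
  then obtain R C S where h: "latin_array R C S ?M" "R \<subseteq> U" "C \<subseteq> U" "card R = k" "card C = k" by blast
  have "dec i \<in> R \<and> dec j \<in> C"
  proof (rule ccontr)
    assume n: "\<not> ?thesis"
    have "latin_array R C S Q" by (rule latin_array_cong[OF h(1)]) (use n in auto)
    then show False using Q_subarray_False[of R C S] h assms by force
  qed
  then show ?thesis using h by blast
qed

lemma NQ_strong_shift:
  assumes "k = 8 \<or> k = 9" shows "strong_allowable_shift (\<alpha> * \<mu>) NQ (3 * \<mu>) k"
  unfolding strong_allowable_shift_def
proof (intro conjI ballI notI)
  have "3 * \<mu> < 8 * \<mu>" using mu by simp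
  also have "\<dots> \<le> \<alpha> * \<mu>" using alpha_ge by (intro mult_le_mono1)
  finally have "3 * \<mu> < \<alpha> * \<mu>" .
  then have "3 * \<mu> \<le> \<alpha> * \<mu> - 1" by linarith
  then show "3 * \<mu> \<in> {1..\<alpha> * \<mu> - 1}" using mu by auto
  fix i j assume ij: "i \<in> {1..\<alpha> * \<mu>}" "j \<in> {1..\<alpha> * \<mu>}"
    and h: "has_subsquare (\<alpha> * \<mu>) (replace (add_mod (\<alpha> * \<mu>) (NQ i j) (3 * \<mu>)) NQ i j) k"
  define rs xs where "rs = dec i" and "xs = dec j"
  have U: "rs \<in> U" "xs \<in> U" using dec_mem ij by (auto simp: rs_def xs_def)
  define z where "z = ((fst (Q rs xs) + 3) mod \<alpha>, snd (Q rs xs))"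
  have QU: "Q rs xs \<in> U" by (rule Q_mem[OF U])
  have zU: "z \<in> U" using QU alpha_ge by (auto simp: z_def U_iff)
  have "add_mod (\<alpha> * \<mu>) (NQ i j) (3 * \<mu>) = enc z"
    using add_mod_enc[OF QU] by (simp add: NQ_def rs_def xs_def z_def)
  then obtain R C S where t: "latin_array R C S (\<lambda>r x. if r = rs \<and> x = xs then z else Q r x)"
    "R \<subseteq> U" "C \<subseteq> U" "card R = k" "card C = k" "rs \<in> R" "xs \<in> C"
    using NQ_replaced[of z i j k] h assms am zU ij unfolding rs_def[symmetric] xs_def[symmetric] by auto
  let ?M = "\<lambda>r x. if r = rs \<and> x = xs then z else Q r x"
  interpret product_subarray \<alpha> A B \<mu> L s r\<^sub>0 r\<^sub>1 \<sigma> c w R C S ?M "{(rs, xs)}"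
  proof
    show "latin_array R C S ?M" by (rule t(1))
    show "snd (?M r x) = snd (P r x)"
      if "r \<in> R" "x \<in> C" "\<not> (r \<in> \<rho> ` {..<2} \<and> x \<in> \<kappa> ` {..<3})" for r x
      using that Q_eq_P[of x r] by (auto simp: image_iff z_def)
    show "fst (?M r x) = fst (P r x)"
      if "r \<in> R" "x \<in> C" "(r, x) \<notin> {(rs, xs)}" "\<not> (r \<in> \<rho> ` {..<2} \<and> x \<in> \<kappa> ` {..<3})" for r x
      using that Q_eq_P[of x r] by (auto simp: image_iff)
    show "snd (?M r x) \<in> w ` {..<3}"
      if "r \<in> R" "x \<in> C" "r \<in> \<rho> ` {..<2}" "x \<in> \<kappa> ` {..<3}" for r x
    proof -
      have "snd (?M r x) = snd (Q r x)" by (simp add: z_def)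
      then show ?thesis using sw_values(2)[OF that(3,4)] \<epsilon>_values by simp
    qed
    show "fst (?M r x) < \<alpha>" if "r \<in> R" "x \<in> C" for r x
    proof -
      have "Q r x \<in> U" using Q_mem that t(2,3) by blast
      then show ?thesis using zU U_iff by simp
    qed
  qed (use t assms in auto)
  interpret starred_subarray \<alpha> A B \<mu> L s r\<^sub>0 r\<^sub>1 \<sigma> c w R C S ?M rs xs
    by unfold_locales (use t assms in \<open>auto simp: z_def\<close>)
  show False by (rule starred_False)
qed

end

section \<open>Conditions (ii) and (iii) at the new order\<close>

lemma less_3_cases: "d < 3 \<Longrightarrow> d = 0 \<or> d = 1 \<or> d = (2::nat)" by linarith

text \<open>\<open>path\<close> is a 3-cycle of \<open>A\<close> that misses closing by 3, the
  leading digit of the new shift. Rows from 2 on avoid the shift and the switch, and a last column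
  from 3 on avoids the columns of the cycle. \<open>path_hole\<close>, \<open>path_sw\<close> and
  \<open>copy_sw\<close> exclude intercalates through the replaced cells, according to whether the
  opposite corner is plain or switched. The cell (2, 3) in \<open>copy_sw\<close> is the one over
  which the cycle of condition (ii) is repeated.\<close>

locale corrupting_step = corrupting_pair +
  fixes p q l\<^sub>0 l\<^sub>1 l\<^sub>2 :: nat
  assumes pq: "2 \<le> p" "p < \<alpha>" "2 \<le> q" "q < \<alpha>" "p \<noteq> q"
    and l: "l\<^sub>0 < \<alpha>" "l\<^sub>1 < \<alpha>" "3 \<le> l\<^sub>2" "l\<^sub>2 < \<alpha>"
    and path: "A q l\<^sub>0 = A p l\<^sub>1" "A q l\<^sub>1 = A p l\<^sub>2" "A q l\<^sub>2 = (A p l\<^sub>0 + 3) mod \<alpha>"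
    and path_hole: "i < \<alpha> \<Longrightarrow> j < \<alpha> \<Longrightarrow> A i l\<^sub>2 = A p j \<Longrightarrow> A i j \<noteq> A q l\<^sub>2"
    and path_sw: "b < 2 \<Longrightarrow> d < 3 \<Longrightarrow> A b l\<^sub>2 = A p d \<Longrightarrow> A (1 - b) d \<noteq> A q l\<^sub>2"
    and copy_sw: "b < 2 \<Longrightarrow> d < 3 \<Longrightarrow> A b 3 = A 2 d \<Longrightarrow> A (1 - b) d \<noteq> A 2 3"

locale product_step = corrupting_step + corrupted_product +
  fixes x\<^sub>1 x\<^sub>2 :: nat and y \<zeta> :: "nat \<Rightarrow> nat"
  assumes x12: "x\<^sub>1 \<in> {2..\<mu>}" "x\<^sub>2 \<in> {2..\<mu>}" "x\<^sub>1 \<noteq> x\<^sub>2"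
    and y: "d < 3 \<Longrightarrow> y d \<in> {2..\<mu>}"
    and cyc: "d < 3 \<Longrightarrow> L x\<^sub>1 (y d) = \<zeta> d" "d < 3 \<Longrightarrow> L x\<^sub>2 (y d) = \<zeta> ((d + 1) mod 3)"
    and \<zeta>11: "d < 3 \<Longrightarrow> \<zeta> d \<noteq> sh (L 1 1)"
    and no_int: "\<not> has_intercalate \<mu> (replace (L x\<^sub>2 (y 2)) L x\<^sub>1 (y 2))"
begin

lemma rng: "x\<^sub>1 \<in> {1..\<mu>}" "x\<^sub>2 \<in> {1..\<mu>}" "d < 3 \<Longrightarrow> y d \<in> {1..\<mu>}" "d < 3 \<Longrightarrow> \<zeta> d \<in> {1..\<mu>}" "1 \<in> {1..\<mu>}"
proof -
  show 1: "x\<^sub>1 \<in> {1..\<mu>}" "x\<^sub>2 \<in> {1..\<mu>}" using x12 by auto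
  show "1 \<in> {1..\<mu>}" using mu by simp
  assume d: "d < 3"
  show 2: "y d \<in> {1..\<mu>}" using y[OF d] by auto
  show "\<zeta> d \<in> {1..\<mu>}" using L_mem[OF 1(1) 2] cyc(1)[OF d] by simp
qed

lemma no_L_intercalate:
  assumes "X \<in> {1..\<mu>}" "X \<noteq> x\<^sub>1" "Y \<in> {1..\<mu>}" "L X Y = L x\<^sub>2 (y 2)" "L x\<^sub>1 Y = L X (y 2)"
  shows False
proof -
  have y2: "y 2 \<in> {1..\<mu>}" by (rule rng) simp
  have Y: "Y \<noteq> y 2" using assms L_col_inj[OF rng(1) assms(1) y2] by auto
  let ?N = "replace (L x\<^sub>2 (y 2)) L x\<^sub>1 (y 2)"
  have N: "?N x\<^sub>1 (y 2) = L x\<^sub>2 (y 2)" "?N x\<^sub>1 Y = L x\<^sub>1 Y" "?N X (y 2) = L x\<^sub>1 Y" "?N X Y = L x\<^sub>2 (y 2)"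
    using assms Y by (auto simp: replace_def)
  have ne: "L x\<^sub>2 (y 2) \<noteq> L x\<^sub>1 Y" using assms Y L_row_inj[OF assms(1,3) y2] by auto
  have "latin_array {x\<^sub>1, X} {y 2, Y} {L x\<^sub>2 (y 2), L x\<^sub>1 Y} ?N"
    by (rule latin_arrayI) (use N ne assms(2) Y in \<open>auto simp: card_insert_if\<close>)
  then have "has_intercalate \<mu> ?N"
    by (rule has_subsquareI) (use rng y2 assms in \<open>auto simp: card_insert_if\<close>)
  then show False using no_int by blast
qed

lemma Q_pure_row:
  assumes "2 \<le> fst r" "snd r \<noteq> 1" shows "Q r x = (A (fst r) (fst x), L (snd r) (snd x))"
proof -
  have "r \<noteq> \<rho> 0" "r \<noteq> \<rho> 1" using assms by (auto simp: \<rho>_def)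
  then show ?thesis using assms by (simp add: Q_def P_def)
qed

lemma Q_pure_col:
  assumes "3 \<le> fst x" "snd x \<noteq> 1" shows "Q r x = (A (fst r) (fst x), L (snd r) (snd x))"
proof -
  have "x \<notin> \<kappa> ` {..<3}" using assms by (auto simp: \<kappa>_def)
  then show ?thesis using assms by (simp add: Q_def P_def)
qed

text \<open>The row of the replaced cell and its column are free of corruptions, so only the
  opposite corner of an intercalate can be exceptional. A switched corner is excluded by
  \<open>sw\<close>. A corner in the block of \<open>B\<close>, or a plain one, which
  \<open>hole\<close> moves over the cell (i, j), yields an intercalate in \<open>L\<close> with the
  entry of condition (ii) replaced.\<close>

lemma no_lifted_intercalate:
  assumes i: "2 \<le> i" "i < \<alpha>" and j: "3 \<le> j" "j < \<alpha>" and z: "z < \<alpha>"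
    and sw: "\<And>b d. b < 2 \<Longrightarrow> d < 3 \<Longrightarrow> A b j = A i d \<Longrightarrow> A (1 - b) d \<noteq> z"
    and hole: "\<And>i' j'. i' < \<alpha> \<Longrightarrow> j' < \<alpha> \<Longrightarrow> A i' j = A i j' \<Longrightarrow> A i' j' = z \<Longrightarrow> i' = i \<and> j' = j"
  shows "\<not> has_intercalate (\<alpha> * \<mu>) (replace (enc (z, L x\<^sub>2 (y 2))) NQ (enc (i, x\<^sub>1)) (enc (j, y 2)))"
proof
  assume h: "has_intercalate (\<alpha> * \<mu>) (replace (enc (z, L x\<^sub>2 (y 2))) NQ (enc (i, x\<^sub>1)) (enc (j, y 2)))"
  define r0 x0 z0 where "r0 = (i, x\<^sub>1)" and "x0 = (j, y 2)" and "z0 = (z, L x\<^sub>2 (y 2))"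
  have y2: "y 2 \<in> {1..\<mu>}" "y 2 \<noteq> 1" "x\<^sub>1 \<noteq> 1" using rng(3)[of 2] y[of 2] x12 by auto
  have U: "r0 \<in> U" "x0 \<in> U" "z0 \<in> U"
    using i j z rng(1) y2(1) L_mem[OF rng(2) y2(1)] by (auto simp: U_iff r0_def x0_def z0_def)
  have d: "dec (enc r0) = r0" "dec (enc x0) = x0" using dec_enc U U_iff by blast+
  have "2 \<noteq> \<alpha> * \<mu>" using am by linarith
  then obtain R C S where t: "latin_array R C S (\<lambda>r x. if r = r0 \<and> x = x0 then z0 else Q r x)"
    "R \<subseteq> U" "C \<subseteq> U" "card R = 2" "card C = 2" "r0 \<in> R" "x0 \<in> C"
    using NQ_replaced[OF h[folded r0_def x0_def z0_def] _ _ U(3) enc_mem[OF U(1)] enc_mem[OF U(2)]]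
    unfolding d by auto
  obtain r' where r': "r' \<in> R" "r' \<noteq> r0" using t(4,6) by (metis card_2_iff insertI1 insert_iff)
  obtain x' where x': "x' \<in> C" "x' \<noteq> x0" using t(5,7) by (metis card_2_iff insertI1 insert_iff)
  have C: "C = {x0, x'}" using t(5,7) x' by (metis card_2_iff insert_commute insertE singletonD)
  let ?M = "\<lambda>r x. if r = r0 \<and> x = x0 then z0 else Q r x"
  have "?M r0 x0 = ?M r' x'"
    by (rule latin_array_square[OF t(1) t(6) r'(1) r'(2)[symmetric] C x'(2)[symmetric]])
  then have e1: "Q r' x' = z0" using r' by simp
  have "?M r0 x' = ?M r' x0"
    by (rule latin_array_square[OF t(1) t(6) r'(1) r'(2)[symmetric] _ x'(2)]) (use C in auto)
  then have e2: "Q r0 x' = Q r' x0" using r' x' by simp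
  have p0: "Q r0 x' = (A i (fst x'), L x\<^sub>1 (snd x'))"
    using Q_pure_row[of r0 x'] i y2 by (simp add: r0_def)
  have p1: "Q r' x0 = (A (fst r') j, L (snd r') (y 2))"
    using Q_pure_col[of x0 r'] j y2 by (simp add: x0_def)
  have f: "A (fst r') j = A i (fst x')" "L x\<^sub>1 (snd x') = L (snd r') (y 2)" using e2 p0 p1 by auto
  have l: "fst r' < \<alpha>" "snd r' \<in> {1..\<mu>}" "fst x' < \<alpha>" "snd x' \<in> {1..\<mu>}"
    using r' x' t(2,3) U_iff by blast+
  show False
  proof (cases "r' \<in> \<rho> ` {..<2} \<and> x' \<in> \<kappa> ` {..<3}")
    case True
    then obtain b d where bd: "b < 2" "r' = \<rho> b" "d < 3" "x' = \<kappa> d" by auto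
    have "Q r' x' = P (\<rho> (1 - b)) (\<kappa> d)" using bd \<rho>_01 by (auto simp: Q_def less_2_cases_iff)
    then have "A (1 - b) d = z" using e1 snd_\<rho>[of "1 - b"] by (simp add: P_def z0_def) (simp add: \<rho>_def \<kappa>_def)
    moreover have "A b j = A i d" using f(1) bd by (simp add: \<rho>_def \<kappa>_def)
    ultimately show False using sw[OF bd(1,3)] by blast
  next
    case False
    then have QP: "Q r' x' = P r' x'" using Q_eq_P[of x' r'] by (auto simp: image_iff less_2_cases_iff)
    show False
    proof (cases "snd r' = 1 \<and> snd x' = 1 \<and> (fst r' \<noteq> 0 \<or> fst x' \<noteq> 0)")
      case True
      then have "L 1 1 = L x\<^sub>2 (y 2)" "L x\<^sub>1 1 = L 1 (y 2)" using e1 QP f(2) by (auto simp: P_def z0_def)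
      then show False using no_L_intercalate[of 1 1] rng(5) y2 by simp
    next
      case False
      then have "fst (P r' x') = A (fst r') (fst x')" using A00 B00 by (auto simp: P_def)
      then have "A (fst r') (fst x') = z" using e1 QP by (simp add: z0_def)
      then have ij: "fst r' = i" "fst x' = j" using hole[OF l(1,3) f(1)] by auto
      then have "snd (P r' x') = L (snd r') (snd x')" using i by (simp add: P_def)
      then have "L (snd r') (snd x') = L x\<^sub>2 (y 2)" using e1 QP by (simp add: z0_def)
      moreover have "snd r' \<noteq> x\<^sub>1" using r'(2) ij by (auto simp: r0_def prod_eq_iff)
      ultimately show False using no_L_intercalate[OF l(2) _ l(4)] f(2) by simp
    qed
  qed
qed

lemma row_perm_NQ:
  assumes "r \<in> U" "x \<in> U" shows "row_perm (\<alpha> * \<mu>) NQ (enc r) j (enc (Q r x)) = NQ j (enc x)"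
  using row_perm_latin[OF NQ_latin enc_mem[OF assms(1)] enc_mem[OF assms(2)]] NQ_enc[OF assms] by simp

lemma NQ_pure:
  assumes "2 \<le> i" "i < \<alpha>" "x \<in> {2..\<mu>}" "j < \<alpha>" "v \<in> {1..\<mu>}"
  shows "NQ (enc (i, x)) (enc (j, v)) = enc (A i j, L x v)" "Q (i, x) (j, v) = (A i j, L x v)"
    "(i, x) \<in> U" "(j, v) \<in> U"
proof -
  show U: "(i, x) \<in> U" "(j, v) \<in> U" using assms by (auto simp: U_iff)
  show "Q (i, x) (j, v) = (A i j, L x v)" using Q_pure_row[of "(i, x)" "(j, v)"] assms by simp
  then show "NQ (enc (i, x)) (enc (j, v)) = enc (A i j, L x v)" using NQ_enc[OF U] by simp
qed

lemma NQ11: "NQ 1 1 = enc (0, sh (L 1 1))" "(0, sh (L 1 1)) \<in> U" "add_mod (\<alpha> * \<mu>) (NQ 1 1) (3 * \<mu>) = enc (3, sh (L 1 1))"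
  "(3, sh (L 1 1)) \<in> U"
proof -
  have U: "(0, 1) \<in> U" using rng(5) alpha_ge by (simp add: U_iff)
  have "enc (0, 1) = 1" by (simp add: enc_def)
  moreover have "Q (0, 1) (0, 1) = (0, sh (L 1 1))"
  proof -
    have "(0, 1) \<noteq> \<rho> 0" "(0, 1) \<noteq> \<rho> 1" using snd_\<rho>[of 0] snd_\<rho>[of 1] by (metis snd_conv)+
    then have "Q (0, 1) (0, 1) = P (0, 1) (0, 1)" using Q_eq_P[of "(0, 1)" "(0, 1)"] by simp
    then show ?thesis using B00 by (simp add: P_def)
  qed
  ultimately show e: "NQ 1 1 = enc (0, sh (L 1 1))" using NQ_enc[OF U U] by simp
  show V: "(0, sh (L 1 1)) \<in> U" using sh_mem[OF L_mem[OF rng(5) rng(5)]] alpha_ge by (simp add: U_iff)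
  show "(3, sh (L 1 1)) \<in> U" using sh_mem[OF L_mem[OF rng(5) rng(5)]] alpha_ge by (simp add: U_iff)
  show "add_mod (\<alpha> * \<mu>) (NQ 1 1) (3 * \<mu>) = enc (3, sh (L 1 1))"
    using add_mod_enc[OF V] e alpha_ge by simp
qed

text \<open>Both the entry in cell (1, 1) and its shift lie over \<open>sh (L 1 1)\<close>, which is
  no symbol of the cycle of condition (ii). This gives the symbol requirements of both
  conditions.\<close>

lemma enc_neq_sh: "d < 3 \<Longrightarrow> z < \<alpha> \<Longrightarrow> (u, sh (L 1 1)) \<in> U \<Longrightarrow> enc (u, sh (L 1 1)) \<noteq> enc (z, \<zeta> d)"
  using enc_inj[of "(u, sh (L 1 1))" "(z, \<zeta> d)"] \<zeta>11[of d] rng(4)[of d] by (auto simp: U_iff)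

lemma enc_gt1: "1 \<le> i \<Longrightarrow> enc (i, v) \<noteq> 1" "v \<in> {2..\<mu>} \<Longrightarrow> enc (i, v) \<noteq> 1"
  using mu by (auto simp: enc_def mult_eq_if)

text \<open>The row cycle of \<open>L\<close> is repeated over the cell (2, 3) of \<open>A\<close>,
  where \<open>Q\<close> copies \<open>L\<close> outside the block of \<open>B\<close>.
  \<open>A\<close> has no intercalate, hence the cell has no hole for its own symbol.\<close>

lemma NQ_cond_ii: "cond_ii (\<alpha> * \<mu>) NQ (3 * \<mu>)"
proof -
  have a: "2 < \<alpha>" "3 < \<alpha>" using alpha_ge by auto
  let ?r = "enc (2, x\<^sub>1)" and ?r' = "enc (2, x\<^sub>2)" and ?c = "\<lambda>d. enc (3, y d)" and ?z = "\<lambda>d. enc (A 2 3, \<zeta> d)"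
  have Al: "A 2 3 < \<alpha>" by (rule A_less[OF a])
  have v: "NQ ?r (?c d) = ?z d" "NQ ?r' (?c d) = ?z ((d + 1) mod 3)"
    "Q (2, x\<^sub>1) (3, y d) = (A 2 3, \<zeta> d)" "(2, x\<^sub>1) \<in> U" "(2, x\<^sub>2) \<in> U" "(3, y d) \<in> U" if "d < 3" for d
    using NQ_pure[OF _ a(1) x12(1) a(2) rng(3)[OF that]] NQ_pure[OF _ a(1) x12(2) a(2) rng(3)[OF that]] cyc[OF that]
    by auto
  have zU: "(A 2 3, \<zeta> d) \<in> U" if "d < 3" for d using Al rng(4)[OF that] by (simp add: U_iff)
  have perm: "row_perm (\<alpha> * \<mu>) NQ ?r ?r' (?z d) = ?z ((d + 1) mod 3)" if "d < 3" for d
    using row_perm_NQ[OF v(4,6)[OF that], of ?r'] v(2,3)[OF that] by simp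
  have cy: "cyclic_on (row_perm (\<alpha> * \<mu>) NQ ?r ?r') {?z 0, ?z 1, ?z 2}"
    by (rule cyclic_on_three) (use perm[of 0] perm[of 1] perm[of 2] in \<open>auto simp: numeral_2_eq_2\<close>)
  have y_inj: "y d = y d' \<longleftrightarrow> d = d'" if "d < 3" "d' < 3" for d d'
  proof
    assume e: "y d = y d'"
    have "\<zeta> d = \<zeta> d'" "\<zeta> ((d + 1) mod 3) = \<zeta> ((d' + 1) mod 3)" using cyc[OF that(1)] cyc[OF that(2)] e by auto
    show "d = d'"
    proof (rule ccontr)
      assume ne: "d \<noteq> d'"
      have nz: "\<zeta> u \<noteq> \<zeta> ((u + 1) mod 3)" if "u < 3" for u
        using cyc[OF that] L_col_inj[OF rng(1,2) rng(3)[OF that]] x12(3) by auto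
      have "\<zeta> 0 \<noteq> \<zeta> 1" "\<zeta> 1 \<noteq> \<zeta> 2" "\<zeta> 2 \<noteq> \<zeta> 0" using nz[of 0] nz[of 1] nz[of 2] by (auto simp: numeral_2_eq_2)
      then show False using less_3_cases[OF that(1)] less_3_cases[OF that(2)] ne \<open>\<zeta> d = \<zeta> d'\<close> by auto
    qed
  qed simp
  have c_inj: "?c d = ?c d' \<longleftrightarrow> d = d'" if "d < 3" "d' < 3" for d d'
    using enc_inj[OF v(6)[OF that(1)] v(6)[OF that(2)]] y_inj[OF that] by simp
  have cc: "card {?c 0, ?c 1, ?c 2} = 3" using c_inj[of 0 1] c_inj[of 0 2] c_inj[of 1 2] by simp
  have cols: "{?c 0, ?c 1, ?c 2} = {m \<in> {1..\<alpha> * \<mu>}. NQ ?r m \<in> {?z 0, ?z 1, ?z 2}}"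
  proof (intro set_eqI iffI)
    fix m assume "m \<in> {?c 0, ?c 1, ?c 2}"
    then obtain d where d: "d < 3" "m = ?c d" by (auto intro: that[of 0] that[of 1] that[of 2])
    have "?z d \<in> {?z 0, ?z 1, ?z 2}" using less_3_cases[OF d(1)] by auto
    then show "m \<in> {m \<in> {1..\<alpha> * \<mu>}. NQ ?r m \<in> {?z 0, ?z 1, ?z 2}}"
      using enc_mem[OF v(6)[OF d(1)]] v(1)[OF d(1)] d(2) by simp
  next
    fix m assume m: "m \<in> {m \<in> {1..\<alpha> * \<mu>}. NQ ?r m \<in> {?z 0, ?z 1, ?z 2}}"
    then obtain d where d: "d < 3" "NQ ?r m = ?z d" by (auto intro: that[of 0] that[of 1] that[of 2])
    have mm: "m \<in> {1..\<alpha> * \<mu>}" using m by simp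
    have lat: "latin_array {1..\<alpha> * \<mu>} {1..\<alpha> * \<mu>} {1..\<alpha> * \<mu>} NQ"
      using NQ_latin latin_on_imp_array unfolding latin_square_def by blast
    have "m = ?c d"
      by (rule latin_array_row_inj[OF lat enc_mem[OF v(4)[OF d(1)]] mm enc_mem[OF v(6)[OF d(1)]]])
        (use d(2) v(1)[OF d(1)] in simp)
    then show "m \<in> {?c 0, ?c 1, ?c 2}" using less_3_cases[OF d(1)] by auto
  qed
  have rc: "row_cycle (\<alpha> * \<mu>) NQ ?r ?r' {?c 0, ?c 1, ?c 2} {?z 0, ?z 1, ?z 2}"
    unfolding row_cycle_def
  proof (intro conjI)
    show "?r \<in> {1..\<alpha> * \<mu>}" "?r' \<in> {1..\<alpha> * \<mu>}" using enc_mem v(4,5)[of 0] by auto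
    show "?r \<noteq> ?r'" using enc_inj[OF v(4,5)[of 0]] x12(3) by simp
    show "{?z 0, ?z 1, ?z 2} \<subseteq> {1..\<alpha> * \<mu>}"
      using enc_mem[OF zU[of 0]] enc_mem[OF zU[of 1]] enc_mem[OF zU[of 2]] by simp
  qed (rule cy cols)+
  have one: "1 \<notin> {?r, ?r', ?c 0, ?c 1, ?c 2}"
    using enc_gt1(1)[of 2] enc_gt1(1)[of 3] by (metis insertE one_le_numeral singletonD)
  have am11: "add_mod (\<alpha> * \<mu>) (NQ 1 1) (3 * \<mu>) \<notin> {?z 0, ?z 1, ?z 2}"
    using NQ11(3) enc_neq_sh[OF _ Al NQ11(4)] by simp
  have ni: "\<not> has_intercalate (\<alpha> * \<mu>) (replace (enc (A 2 3, L x\<^sub>2 (y 2))) NQ ?r (?c 2))"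
  proof (rule no_lifted_intercalate)
    show "i' = 2 \<and> j' = 3" if "i' < \<alpha>" "j' < \<alpha>" "A i' 3 = A 2 j'" "A i' j' = A 2 3" for i' j'
      using A_no2[of 2 i' 3 j'] A_row_inj[OF a(1) a(2) that(2)] that a by metis
  qed (use a Al copy_sw in auto)
  have "NQ ?r' (?c 2) = enc (A 2 3, L x\<^sub>2 (y 2))" using v(2)[of 2] cyc(2)[of 2] by simp
  then have ni': "\<not> has_intercalate (\<alpha> * \<mu>) (replace (NQ ?r' (?c 2)) NQ ?r (?c 2))" using ni by simp
  show ?thesis unfolding cond_ii_def
    using rc cc one am11 ni' by blast
qed

text \<open>The first coordinates follow the path in \<open>A\<close>, the second coordinates the
  closed 3-cycle of \<open>L\<close>. After three steps the second coordinate has returned and the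
  first is off by 3, so the last symbol is the first one shifted by
  \<open>3 * \<mu>\<close>.\<close>

lemma NQ_cond_iii: "cond_iii (\<alpha> * \<mu>) NQ (3 * \<mu>)"
proof -
  let ?r = "enc (p, x\<^sub>1)" and ?r' = "enc (q, x\<^sub>2)"
  let ?c0 = "enc (l\<^sub>0, y 0)" and ?c1 = "enc (l\<^sub>1, y 1)" and ?c2 = "enc (l\<^sub>2, y 2)"
  let ?\<sigma> = "enc (A p l\<^sub>0, \<zeta> 0)" and ?\<tau> = "row_perm (\<alpha> * \<mu>) NQ ?r ?r'"
  have l2: "l\<^sub>2 < \<alpha>" "l\<^sub>0 < \<alpha>" "l\<^sub>1 < \<alpha>" using l by auto
  note n0 = NQ_pure[OF pq(1,2) x12(1) l2(2) rng(3)[of 0]] NQ_pure[OF pq(3,4) x12(2) l2(2) rng(3)[of 0]]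
  note n1 = NQ_pure[OF pq(1,2) x12(1) l2(3) rng(3)[of 1]] NQ_pure[OF pq(3,4) x12(2) l2(3) rng(3)[of 1]]
  note n2 = NQ_pure[OF pq(1,2) x12(1) l2(1) rng(3)[of 2]] NQ_pure[OF pq(3,4) x12(2) l2(1) rng(3)[of 2]]
  have m1: "(0 + 1) mod 3 = (1::nat)" "(1 + 1) mod 3 = (2::nat)" "(2 + 1) mod 3 = (0::nat)" by auto
  have v: "NQ ?r ?c0 = ?\<sigma>" "NQ ?r' ?c0 = enc (A q l\<^sub>0, \<zeta> 1)" "NQ ?r ?c1 = enc (A q l\<^sub>0, \<zeta> 1)"
    "NQ ?r' ?c1 = enc (A q l\<^sub>1, \<zeta> 2)" "NQ ?r ?c2 = enc (A q l\<^sub>1, \<zeta> 2)" "NQ ?r' ?c2 = enc (A q l\<^sub>2, \<zeta> 0)"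
    using n0 n1 n2 cyc[of 0] cyc[of 1] cyc[of 2] path m1 by (auto simp: numeral_2_eq_2)
  have U: "(p, x\<^sub>1) \<in> U" "(q, x\<^sub>2) \<in> U" "(l\<^sub>0, y 0) \<in> U" "(l\<^sub>1, y 1) \<in> U" "(l\<^sub>2, y 2) \<in> U"
    using n0 n1 n2 by auto
  have Al: "A p l\<^sub>0 < \<alpha>" "A q l\<^sub>0 < \<alpha>" "A q l\<^sub>1 < \<alpha>" "A q l\<^sub>2 < \<alpha>" using A_less pq l2 by auto
  have sU: "(A p l\<^sub>0, \<zeta> 0) \<in> U" using Al rng(4)[of 0] by (simp add: U_iff)
  have t1: "?\<tau> ?\<sigma> = enc (A q l\<^sub>0, \<zeta> 1)"
    using row_perm_NQ[OF U(1,3), of ?r'] n0(2) cyc[of 0] v(2) by simp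
  have t2: "?\<tau> (enc (A q l\<^sub>0, \<zeta> 1)) = enc (A q l\<^sub>1, \<zeta> 2)"
    using row_perm_NQ[OF U(1,4), of ?r'] n1(2) cyc[of 1] v(4) path(1) by simp
  have ad: "add_mod (\<alpha> * \<mu>) ?\<sigma> (3 * \<mu>) = enc (A q l\<^sub>2, \<zeta> 0)" using add_mod_enc[OF sU] path(3) by simp
  have L2: "L x\<^sub>2 (y 2) = \<zeta> 0" using cyc(2)[of 2] by simp
  have ni: "\<not> has_intercalate (\<alpha> * \<mu>) (replace (enc (A q l\<^sub>2, L x\<^sub>2 (y 2))) NQ ?r ?c2)"
    by (rule no_lifted_intercalate) (use pq l Al path_sw path_hole in auto)
  have ne: "u \<notin> {?\<sigma>, enc (A q l\<^sub>0, \<zeta> 1), enc (A q l\<^sub>1, \<zeta> 2), enc (A q l\<^sub>2, \<zeta> 0)}"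
    if "u = enc (g, sh (L 1 1))" "(g, sh (L 1 1)) \<in> U" for u g
    using enc_neq_sh[OF _ Al(1) that(2), of 0] enc_neq_sh[OF _ Al(2) that(2), of 1]
      enc_neq_sh[OF _ Al(3) that(2), of 2] enc_neq_sh[OF _ Al(4) that(2), of 0] that(1) by simp
  have sub: "{?r, ?r', ?c0, ?c1, ?c2, ?\<sigma>} \<subseteq> {1..\<alpha> * \<mu>}"
    using enc_mem U sU by blast
  have rr: "?r \<noteq> ?r'" using enc_inj[OF U(1,2)] pq(5) by simp
  have one: "1 \<notin> {?r, ?r', ?c0, ?c1, ?c2}"
    using enc_gt1(2)[OF x12(1)] enc_gt1(2)[OF x12(2)] enc_gt1(2)[OF y[of 0]] enc_gt1(2)[OF y[of 1]] enc_gt1(2)[OF y[of 2]]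
    by (auto dest: sym)
  show ?thesis unfolding cond_iii_def Let_def
    by (intro exI[of _ ?r] exI[of _ ?r'] exI[of _ ?c0] exI[of _ ?c1] exI[of _ ?c2] exI[of _ ?\<sigma>] conjI)
      (simp_all only: t1 t2 ad v ne[OF NQ11(1,2)] ne[OF NQ11(3,4)] sub rr one L2 not_False_eq_True
        ni[unfolded L2])
qed

lemma NQ_in_family: "(NQ, 3 * \<mu>) \<in> X_family (\<alpha> * \<mu>)"
proof -
  have "3 * \<mu> \<in> {1..\<alpha> * \<mu> - 1}" using NQ_strong_shift[of 8] by (simp add: strong_allowable_shift_def)
  moreover have "10 \<le> \<alpha> * \<mu>" using am by linarith
  ultimately show ?thesis
    using NQ_N_infinity NQ_strong_shift[of 8] NQ_strong_shift[of 9] NQ_cond_ii NQ_cond_iii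
    unfolding X_family_def by simp
qed

end

lemma (in corrupting_step) multiply_order:
  assumes fam: "(L, s) \<in> X_family \<mu>"
  shows "int (\<alpha> * \<mu>) \<in> N_X"
proof -
  have h: "10 \<le> \<mu>" "N_infinity \<mu> L" "s \<in> {1..\<mu> - 1}" "strong_allowable_shift \<mu> L s 8"
    "strong_allowable_shift \<mu> L s 9" "cond_ii \<mu> L s" "cond_iii \<mu> L s"
    using fam unfolding X_family_def by auto
  have lat: "latin_square \<mu> L" using h(2) by (simp add: N_infinity_def)
  have sa: "strong_allowable_shift \<mu> L s \<alpha>" using h(4,5) alpha by auto
  from cond_ii_cycle[OF lat h(6)] obtain x1 x2 and y \<zeta> :: "nat \<Rightarrow> nat" where
    i: "x1 \<in> {2..\<mu>}" "x2 \<in> {2..\<mu>}" "x1 \<noteq> x2" "\<forall>d<3. y d \<in> {2..\<mu>}"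
      "\<forall>d<3. L x1 (y d) = \<zeta> d \<and> L x2 (y d) = \<zeta> ((d + 1) mod 3) \<and> \<zeta> d \<noteq> add_mod \<mu> (L 1 1) s"
      "\<not> has_intercalate \<mu> (replace (L x2 (y 2)) L x1 (y 2))" by blast
  from h(7) obtain r1 r2 c1 c2 c3 \<sigma> where
    c: "{r1, r2, c1, c2, c3, \<sigma>} \<subseteq> {1..\<mu>}" "r1 \<noteq> r2" "1 \<notin> {r1, r2, c1, c2, c3}"
      "L r1 c1 = \<sigma>" "L r2 c1 = row_perm \<mu> L r1 r2 \<sigma>"
      "L r1 c2 = row_perm \<mu> L r1 r2 \<sigma>" "L r2 c2 = row_perm \<mu> L r1 r2 (row_perm \<mu> L r1 r2 \<sigma>)"
      "L r1 c3 = row_perm \<mu> L r1 r2 (row_perm \<mu> L r1 r2 \<sigma>)" "L r2 c3 = add_mod \<mu> \<sigma> s"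
      "\<not> has_intercalate \<mu> (replace (L r2 c3) L r1 c3)"
      "L 1 1 \<notin> {\<sigma>, row_perm \<mu> L r1 r2 \<sigma>, row_perm \<mu> L r1 r2 (row_perm \<mu> L r1 r2 \<sigma>), add_mod \<mu> \<sigma> s}"
    unfolding cond_iii_def Let_def by (elim exE conjE) (rule that)
  define cc where "cc d = (if d = 0 then c1 else if d = 1 then c2 else c3)" for d :: nat
  define ww where "ww d = (if d = 0 then add_mod \<mu> \<sigma> s else if d = 1 then L r2 c1 else L r2 c2)" for d :: nat
  have d3: "d = 0 \<or> d = 1 \<or> d = 2" if "d < 3" for d :: nat using that by linarith
  have m: "r1 \<in> {1..\<mu>}" "r2 \<in> {1..\<mu>}" "c1 \<in> {1..\<mu>}" "c2 \<in> {1..\<mu>}" "c3 \<in> {1..\<mu>}"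
    "r1 \<noteq> 1" "r2 \<noteq> 1" "c1 \<noteq> 1" "c2 \<noteq> 1" "c3 \<noteq> 1" using c(1,3) by auto
  interpret corrupted_product \<alpha> A B \<mu> L s r1 r2 \<sigma> cc ww
  proof
    show "10 \<le> \<mu>" "N_infinity \<mu> L" "s \<in> {1..\<mu> - 1}" "strong_allowable_shift \<mu> L s \<alpha>" "r1 \<noteq> r2"
      by (fact h sa c)+
    show "r1 \<in> {2..\<mu>}" "r2 \<in> {2..\<mu>}" using m by auto
    show "cc d \<in> {2..\<mu>}" for d using m by (auto simp: cc_def)
    show "L r1 (cc 0) = \<sigma>" "ww 0 = add_mod \<mu> \<sigma> s" using c(4) by (simp_all add: cc_def ww_def)
    show "L r1 (cc d) = ww d" if "0 < d" "d < 3" for d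
      using d3[OF that(2)] that(1) c(5-8) by (auto simp: cc_def ww_def)
    show "L r2 (cc d) = ww ((d + 1) mod 3)" if "d < 3" for d
      using d3[OF that] c(9) by (auto simp: cc_def ww_def)
    show "ww d \<noteq> L 1 1" if "d < 3" for d using d3[OF that] c(5,7,11) by (auto simp: ww_def)
    show "\<not> has_intercalate \<mu> (replace (L r2 (cc 2)) L r1 (cc 2))" using c(10) by (simp add: cc_def)
  qed
  interpret product_step \<alpha> A B p q l\<^sub>0 l\<^sub>1 l\<^sub>2 \<mu> L s r1 r2 \<sigma> cc ww x1 x2 y \<zeta>
    by unfold_locales (use i in \<open>auto simp: sh_def\<close>)
  show ?thesis using NQ_in_family unfolding N_X_def by blast
qed

section \<open>The squares of orders 8 and 9\<close>

fun walk :: "(nat \<Rightarrow> nat) \<Rightarrow> (nat \<Rightarrow> nat) \<Rightarrow> bool list \<Rightarrow> nat \<Rightarrow> nat list" where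
  "walk f g [] z = [z]"
| "walk f g (b # bs) z = z # walk f g bs (if b then g z else f z)"

lemma walk_invariant:
  fixes \<chi> :: "nat \<Rightarrow> nat"
  assumes "\<And>z. z < n \<Longrightarrow> f z < n \<and> \<chi> (f z) = \<chi> z" "\<And>z. z < n \<Longrightarrow> g z < n \<and> \<chi> (g z) = \<chi> z"
    and "z < n" "u \<in> set (walk f g bs z)"
  shows "\<chi> u = \<chi> z"
  using assms(3,4)
proof (induction bs arbitrary: z)
  case (Cons b bs)
  have "(if b then g z else f z) < n" "\<chi> (if b then g z else f z) = \<chi> z" using assms(1,2)[OF Cons.prems(1)] by auto
  then show ?case using Cons.IH[of "if b then g z else f z"] Cons.prems(2) by auto
qed simp

text \<open>An invariant function is constant along the walk, and the walk reaches every symbol from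
  0. The hypothesis on \<chi> is symmetric in the three rows, so increasing triples are
  enough.\<close>

lemma connected_by_walk:
  fixes \<chi> :: "nat \<Rightarrow> nat"
  assumes tab: "\<forall>i<n. \<forall>j<n. M i j < n \<and> R i j < n \<and> M i (R i j) = j"
    and walk: "\<forall>i<n. \<forall>i'<n. if i < i' then (\<forall>i''<n. if i' < i''
      then (\<forall>z<n. z \<in> set (walk (\<lambda>z. M i' (R i z)) (\<lambda>z. M i'' (R i z)) bs 0)) else True) else True"
    and i: "i < n" "i' < n" "i'' < n" "i \<noteq> i'" "i \<noteq> i''" "i' \<noteq> i''"
    and \<chi>: "\<And>j. j < n \<Longrightarrow> \<chi> (M i' j) = \<chi> (M i j)" "\<And>j. j < n \<Longrightarrow> \<chi> (M i'' j) = \<chi> (M i j)"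
    and z: "z < n"
  shows "\<chi> z = \<chi> 0"
proof -
  have main: "\<chi> z = \<chi> 0" if s: "a < b" "b < c" "c < n" and e: "\<forall>j<n. \<chi> (M b j) = \<chi> (M a j) \<and> \<chi> (M c j) = \<chi> (M a j)" for a b c
  proof (rule walk_invariant[of n "\<lambda>z. M b (R a z)" \<chi> "\<lambda>z. M c (R a z)" 0 z bs])
    have n: "a < n" "b < n" using s by auto
    show "z \<in> set (walk (\<lambda>z. M b (R a z)) (\<lambda>z. M c (R a z)) bs 0)"
      using walk[rule_format, OF n] s z by simp
    show "M b (R a u) < n \<and> \<chi> (M b (R a u)) = \<chi> u" if "u < n" for u
      using tab[rule_format, OF n(1) that] tab[rule_format, OF n(2), of "R a u"] e[rule_format, of "R a u"] by simp
    show "M c (R a u) < n \<and> \<chi> (M c (R a u)) = \<chi> u" if "u < n" for u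
      using tab[rule_format, OF n(1) that] tab[rule_format, OF s(3), of "R a u"] e[rule_format, of "R a u"] by simp
    show "0 < n" using z by simp
  qed
  have "i < i' \<and> i' < i'' \<or> i < i'' \<and> i'' < i' \<or> i' < i \<and> i < i'' \<or> i' < i'' \<and> i'' < i \<or> i'' < i \<and> i < i' \<or> i'' < i' \<and> i' < i"
    using i(4-6) by linarith
  then show ?thesis
    using main[of i i' i''] main[of i i'' i'] main[of i' i i''] main[of i' i'' i] main[of i'' i i'] main[of i'' i' i] \<chi> i(1-3)
    by (elim disjE conjE) simp_all
qed

text \<open>\<open>hole3\<close> without a search: after the choice of j and i, the other column is
  \<open>R i\<^sub>0 (A i j)\<close> and the other row is \<open>C j\<^sub>0 (A i j)\<close>. The
  caller computes i from j in the same way.\<close>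

definition hole3_tab :: "(nat \<Rightarrow> nat \<Rightarrow> nat) \<Rightarrow> (nat \<Rightarrow> nat \<Rightarrow> nat) \<Rightarrow> (nat \<Rightarrow> nat \<Rightarrow> nat) \<Rightarrow> nat \<Rightarrow> nat \<Rightarrow> nat \<Rightarrow> nat \<Rightarrow> nat \<Rightarrow> bool" where
  "hole3_tab A R C i\<^sub>0 j\<^sub>0 v j i \<longleftrightarrow> (if A i (R i\<^sub>0 (A i j)) = v
     then R i\<^sub>0 (A i j) \<noteq> j\<^sub>0 \<and> A (C j\<^sub>0 (A i j)) j = v \<and> A (C j\<^sub>0 (A i j)) (R i\<^sub>0 (A i j)) = A i\<^sub>0 j else False)"

text \<open>Here \<open>R\<close>, \<open>R'\<close> are row inverses and \<open>C\<close>, \<open>C'\<close> column inverses of \<open>A\<close>, \<open>B\<close>; they determine the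
  indices that the conditions of \<open>corrupting_step\<close> quantify over. The conditionals keep the simplifier from
  unrolling quantifiers behind a failing test. The word \<open>bs\<close> is a universal traversal sequence: for all
  triples of rows at once, the walk it describes visits every symbol.\<close>

locale corrupting_tables =
  fixes n :: nat and A R C B R' C' :: "nat \<Rightarrow> nat \<Rightarrow> nat" and p q l\<^sub>0 l\<^sub>1 l\<^sub>2 :: nat and bs :: "bool list"
  assumes n: "n = 8 \<or> n = 9"
    and A_less: "\<forall>i<n. \<forall>j<n. A i j < n \<and> R i j < n \<and> C i j < n"
    and A_inv: "\<forall>i<n. \<forall>j<n. R i (A i j) = j \<and> A i (R i j) = j \<and> C j (A i j) = i \<and> A (C j i) j = i"
    and B_less: "\<forall>i<n. \<forall>j<n. B i j < n \<and> R' i j < n \<and> C' i j < n"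
    and B_inv: "\<forall>i<n. \<forall>j<n. R' i (B i j) = j \<and> B i (R' i j) = j \<and> C' j (B i j) = i \<and> B (C' j i) j = i"
    and B00: "B 0 0 = 0"
    and A0: "A 0 0 = 0 \<and> A 0 1 = 1 \<and> A 0 2 = 2"
    and A1: "A 1 0 = 1 \<and> A 1 1 = 2 \<and> A 1 2 = 0"
    and AB: "\<forall>i<n. \<forall>j<n. i = 0 \<and> j = 0 \<or> A i j \<noteq> B i j"
    and AB3: "\<forall>i<n. \<forall>j<n. A i j \<noteq> (B i j + 3) mod n"
    and A_no2: "\<forall>i<n. \<forall>i'<n. if i < i' then (\<forall>j<n. A i' (R i (A i' j)) \<noteq> A i j) else True"
    and B_no2: "\<forall>i<n. \<forall>i'<n. if i < i' then (\<forall>j<n. B i' (R' i (B i' j)) \<noteq> B i j) else True"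
    and A_walk: "\<forall>i<n. \<forall>i'<n. if i < i' then (\<forall>i''<n. if i' < i''
      then (\<forall>z<n. z \<in> set (walk (\<lambda>z. A i' (R i z)) (\<lambda>z. A i'' (R i z)) bs 0)) else True) else True"
    and B_walk: "\<forall>i<n. \<forall>i'<n. if i < i' then (\<forall>i''<n. if i' < i''
      then (\<forall>z<n. z \<in> set (walk (\<lambda>z. B i' (R' i z)) (\<lambda>z. B i'' (R' i z)) bs 0)) else True) else True"
    and A_no4: "\<forall>i<n. \<forall>i'<n. if i = i' then True else (\<forall>j<n.
      if A i' (R i (A i' (R i (A i' (R i (A i' j)))))) = A i j
      then (\<forall>l<n. if l = i \<or> l = i' then True else
        \<not> {A l j, A l (R i (A i' j)), A l (R i (A i' (R i (A i' j))))}
          \<subseteq> {A i j, A i' j, A i' (R i (A i' j)), A i' (R i (A i' (R i (A i' j))))}) else True)"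
    and B_hole2: "\<forall>i<n. if i = 0 then True else B 0 (R i 0) \<noteq> A i 0 \<and> B i 0 \<noteq> A 0 (R i 0) \<and> B i (R 0 (A i 0)) \<noteq> 0"
    and B_hole3: "\<forall>i<n. \<forall>j<n. if i = 0 \<and> j = 0 then True
      else (\<forall>j'<n. if j' = j then True else \<not> hole3_tab A R C i j (B i j) j' (C j (A i j')))"
    and sw_hole2: "\<forall>b<2. \<forall>d<3. if b = 0 \<and> d = 2 then True
      else (\<forall>j<n. if j = d then True else A (C d (A b j)) j \<noteq> A (1 - b) d)"
    and sw_hole2': "A (C 2 0) 0 \<noteq> 0"
    and sw_hole3: "\<forall>b<2. \<forall>d<3. \<forall>j<n. if j = d then True else \<not> hole3_tab A R C b d (A (1 - b) d) j (C d (A b j))"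
    and sw_hole33: "\<forall>b<2. \<forall>d<3. \<forall>d'<3. if d = d' then True
      else A (C d (A (1 - b) d')) (R b (A (C d (A (1 - b) d')) d')) \<noteq> A (1 - b) d"
    and sw_B: "\<forall>b<2. \<forall>d<3. \<forall>l<n. B l (R b (A l d)) \<noteq> A (C (R b (A l d)) (A (1 - b) d)) d"
    and pq: "2 \<le> p" "p < n" "2 \<le> q" "q < n" "p \<noteq> q"
    and l: "l\<^sub>0 < n" "l\<^sub>1 < n" "3 \<le> l\<^sub>2" "l\<^sub>2 < n"
    and path: "A q l\<^sub>0 = A p l\<^sub>1" "A q l\<^sub>1 = A p l\<^sub>2" "A q l\<^sub>2 = (A p l\<^sub>0 + 3) mod n"
    and path_hole: "\<forall>j<n. A (C l\<^sub>2 (A p j)) j \<noteq> A q l\<^sub>2"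
    and path_sw: "\<forall>b<2. \<forall>d<3. if A b l\<^sub>2 = A p d then A (1 - b) d \<noteq> A q l\<^sub>2 else True"
    and copy_sw: "\<forall>b<2. \<forall>d<3. if A b 3 = A 2 d then A (1 - b) d \<noteq> A 2 3 else True"
begin

lemma R_A: "i < n \<Longrightarrow> j < n \<Longrightarrow> A i j = v \<Longrightarrow> R i v = j" using A_inv by blast
lemma C_A: "i < n \<Longrightarrow> j < n \<Longrightarrow> A i j = v \<Longrightarrow> C j v = i" using A_inv by blast
lemma R'_B: "i < n \<Longrightarrow> j < n \<Longrightarrow> B i j = v \<Longrightarrow> R' i v = j" using B_inv by blast

lemma n_gt: "0 < n" "1 < n" "2 < n" using n by auto
lemma b_lt: "b < 2 \<Longrightarrow> b < n" and d_lt: "d < 3 \<Longrightarrow> d < n" using n by auto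

lemma no_hole3:
  assumes "i\<^sub>0 < n" "j\<^sub>0 < n" "\<forall>j<n. if j = j\<^sub>0 then True else \<not> hole3_tab A R C i\<^sub>0 j\<^sub>0 v j (C j\<^sub>0 (A i\<^sub>0 j))"
  shows "\<not> hole3 A n i\<^sub>0 j\<^sub>0 v"
proof
  assume "hole3 A n i\<^sub>0 j\<^sub>0 v"
  then obtain i i' j j' where h: "i < n" "i' < n" "j < n" "j' < n" "j \<noteq> j\<^sub>0" "j' \<noteq> j\<^sub>0"
    "A i j\<^sub>0 = A i\<^sub>0 j" "A i j = A i\<^sub>0 j'" "A i j' = v" "A i' j\<^sub>0 = A i\<^sub>0 j'" "A i' j = v" "A i' j' = A i\<^sub>0 j"
    unfolding hole3_def by blast
  have "C j\<^sub>0 (A i\<^sub>0 j) = i" "R i\<^sub>0 (A i j) = j'" "C j\<^sub>0 (A i j) = i'"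
    using C_A[OF h(1) assms(2) h(7)] R_A[OF assms(1) h(4) h(8)[symmetric]] C_A[OF h(2) assms(2)] h(8,10) by auto
  then show False using assms(3)[rule_format, OF h(3)] h by (simp add: hole3_tab_def)
qed

lemma no2:
  assumes "i < n" "i' < n" "i \<noteq> i'" "j < n" "j' < n" "A i j' = A i' j" "A i' j' = A i j" shows False
proof (cases "i < i'")
  case True
  have "R i (A i' j) = j'" using R_A[OF assms(1,5,6)] .
  then show False using A_no2[rule_format, OF assms(1,2)] True assms by auto
next
  case False
  have "R i' (A i j) = j'" using R_A[OF assms(2,5,7)] .
  then show False using A_no2[rule_format, OF assms(2,1)] False assms by auto
qed

lemma no2_B:
  assumes "i < n" "i' < n" "i \<noteq> i'" "j < n" "j' < n" "B i j' = B i' j" "B i' j' = B i j" shows False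
proof (cases "i < i'")
  case True
  have "R' i (B i' j) = j'" using R'_B[OF assms(1,5,6)] .
  then show False using B_no2[rule_format, OF assms(1,2)] True assms by auto
next
  case False
  have "R' i' (B i j) = j'" using R'_B[OF assms(2,5,7)] .
  then show False using B_no2[rule_format, OF assms(2,1)] False assms by auto
qed

lemma step: "corrupting_step n A B p q l\<^sub>0 l\<^sub>1 l\<^sub>2"
proof
  show "n = 8 \<or> n = 9" by (rule n)
  show "bij_betw (A i) {..<n} {..<n}" if "i < n" for i
    by (rule bij_betw_byWitness[where f' = "R i"]) (use that A_inv A_less in auto)
  show "bij_betw (\<lambda>i. A i j) {..<n} {..<n}" if "j < n" for j
    by (rule bij_betw_byWitness[where f' = "C j"]) (use that A_inv A_less in auto)
  show "bij_betw (B i) {..<n} {..<n}" if "i < n" for i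
    by (rule bij_betw_byWitness[where f' = "R' i"]) (use that B_inv B_less in auto)
  show "bij_betw (\<lambda>i. B i j) {..<n} {..<n}" if "j < n" for j
    by (rule bij_betw_byWitness[where f' = "C' j"]) (use that B_inv B_less in auto)
  show "B 0 0 = 0" by (rule B00)
  show "A 0 d = d" if "d < 3" for d using less_3_cases[OF that] A0 by auto
  show "A 1 d = (d + 1) mod 3" if "d < 3" for d using less_3_cases[OF that] A1 by auto
  show "A i j \<noteq> B i j" if "i < n" "j < n" "(i, j) \<noteq> (0, 0)" for i j using AB that by blast
  show "A i j \<noteq> (B i j + 3) mod n" if "i < n" "j < n" for i j using AB3 that by blast
  show "A i' j' \<noteq> A i j" if "i < n" "i' < n" "i \<noteq> i'" "j < n" "j' < n" "A i j' = A i' j" for i i' j j'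
    using no2[OF that] by blast
  show "B i' j' \<noteq> B i j" if "i < n" "i' < n" "i \<noteq> i'" "j < n" "j' < n" "B i j' = B i' j" for i i' j j'
    using no2_B[OF that] by blast
  have tA: "\<forall>i<n. \<forall>j<n. A i j < n \<and> R i j < n \<and> A i (R i j) = j" using A_less A_inv by blast
  show "\<chi> z = \<chi> 0" if "i < n" "i' < n" "i'' < n" "i \<noteq> i'" "i \<noteq> i''" "i' \<noteq> i''"
    "\<And>j. j < n \<Longrightarrow> \<chi> (A i' j) = \<chi> (A i j)" "\<And>j. j < n \<Longrightarrow> \<chi> (A i'' j) = \<chi> (A i j)" "z < n"
    for i i' i'' z and \<chi> :: "nat \<Rightarrow> nat" by (rule connected_by_walk[OF tA A_walk that])
  have tB: "\<forall>i<n. \<forall>j<n. B i j < n \<and> R' i j < n \<and> B i (R' i j) = j" using B_less B_inv by blast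
  show "\<chi> z = \<chi> 0" if "i < n" "i' < n" "i'' < n" "i \<noteq> i'" "i \<noteq> i''" "i' \<noteq> i''"
    "\<And>j. j < n \<Longrightarrow> \<chi> (B i' j) = \<chi> (B i j)" "\<And>j. j < n \<Longrightarrow> \<chi> (B i'' j) = \<chi> (B i j)" "z < n"
    for i i' i'' z and \<chi> :: "nat \<Rightarrow> nat" by (rule connected_by_walk[OF tB B_walk that])
  show "\<not> {A l j\<^sub>0, A l j\<^sub>1, A l j\<^sub>2} \<subseteq> {A i j\<^sub>0, A i j\<^sub>1, A i j\<^sub>2, A i j\<^sub>3}"
    if h: "i < n" "i' < n" "l < n" "i \<noteq> i'" "l \<noteq> i" "l \<noteq> i'" "j\<^sub>0 < n" "j\<^sub>1 < n" "j\<^sub>2 < n" "j\<^sub>3 < n"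
      "A i' j\<^sub>0 = A i j\<^sub>1" "A i' j\<^sub>1 = A i j\<^sub>2" "A i' j\<^sub>2 = A i j\<^sub>3" "A i' j\<^sub>3 = A i j\<^sub>0" for i i' l j\<^sub>0 j\<^sub>1 j\<^sub>2 j\<^sub>3
  proof -
    have R: "R i (A i' j\<^sub>0) = j\<^sub>1" "R i (A i' j\<^sub>1) = j\<^sub>2" "R i (A i' j\<^sub>2) = j\<^sub>3"
      using R_A[OF h(1,8)] R_A[OF h(1,9)] R_A[OF h(1,10)] h(11-13) by auto
    have "\<forall>j<n. if A i' (R i (A i' (R i (A i' (R i (A i' j)))))) = A i j
      then (\<forall>l<n. if l = i \<or> l = i' then True else
        \<not> {A l j, A l (R i (A i' j)), A l (R i (A i' (R i (A i' j))))}
          \<subseteq> {A i j, A i' j, A i' (R i (A i' j)), A i' (R i (A i' (R i (A i' j))))}) else True"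
      using A_no4[rule_format, OF h(1,2)] h(4) by (simp only: if_False)
    from this[rule_format, OF h(7)]
    have "\<forall>l<n. if l = i \<or> l = i' then True else
        \<not> {A l j\<^sub>0, A l j\<^sub>1, A l j\<^sub>2} \<subseteq> {A i j\<^sub>0, A i' j\<^sub>0, A i' j\<^sub>1, A i' j\<^sub>2}"
      by (simp only: R h(14) if_True refl)
    from this[rule_format, OF h(3)]
    have "\<not> {A l j\<^sub>0, A l j\<^sub>1, A l j\<^sub>2} \<subseteq> {A i j\<^sub>0, A i' j\<^sub>0, A i' j\<^sub>1, A i' j\<^sub>2}"
      by (simp only: h(5,6) simp_thms if_False)
    then show ?thesis unfolding h(11-13) .
  qed
  have B2: "B 0 (R i 0) \<noteq> A i 0 \<and> B i 0 \<noteq> A 0 (R i 0) \<and> B i (R 0 (A i 0)) \<noteq> 0" if "0 < i" "i < n" for i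
    using B_hole2 that by auto
  show "B 0 j \<noteq> A i 0" "B i 0 \<noteq> A 0 j" if "0 < i" "i < n" "0 < j" "j < n" "A i j = 0" for i j
    using B2[OF that(1,2)] R_A[OF that(2,4,5)] by auto
  show "B i j \<noteq> 0" if "0 < i" "i < n" "0 < j" "j < n" "A i 0 = A 0 j" for i j
    using B2[OF that(1,2)] R_A[OF n_gt(1) that(4) that(5)[symmetric]] by auto
  show "\<not> hole3 A n i j (B i j)" if "i < n" "j < n" "(i, j) \<noteq> (0, 0)" for i j
    by (rule no_hole3[OF that(1,2)]) (use B_hole3[rule_format, OF that(1,2)] that(3) in \<open>simp split: if_splits\<close>)
  show "\<not> hole2 A n b d (A (1 - b) d)" if h: "b < 2" "d < 3" "(b, d) \<noteq> (0, 2)" for b d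
  proof
    assume "hole2 A n b d (A (1 - b) d)"
    then obtain i j where ij: "i < n" "j < n" "j \<noteq> d" "A i d = A b j" "A i j = A (1 - b) d"
      unfolding hole2_def by blast
    have "A (C d (A b j)) j \<noteq> A (1 - b) d"
      using sw_hole2[rule_format, OF h(1,2)] h(3) ij(2,3) by (auto split: if_splits)
    then show False using C_A[OF ij(1) d_lt[OF h(2)] ij(4)] ij(5) by simp
  qed
  show "A i 0 \<noteq> 0" if "i < n" "A i 2 = 0" for i using C_A[OF that(1) n_gt(3) that(2)] sw_hole2' by simp
  show "\<not> hole3 A n b d (A (1 - b) d)" if "b < 2" "d < 3" for b d
    by (rule no_hole3[OF b_lt[OF that(1)] d_lt[OF that(2)]]) (use sw_hole3 that in blast)
  show "A i' j \<noteq> A (1 - b) d'"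
    if h: "b < 2" "d < 3" "d' < 3" "d \<noteq> d'" "i < n" "j < n" "A i d = A (1 - b) d'" "A i d' = A b j" "A i j = A (1 - b) d"
      "i' < n" "A i' d = A b j" "A i' d' = A (1 - b) d" for b d d' i j i'
  proof -
    have "A (C d (A (1 - b) d')) (R b (A (C d (A (1 - b) d')) d')) \<noteq> A (1 - b) d"
      using sw_hole33[rule_format, OF h(1-3)] h(4) by simp
    moreover have "C d (A (1 - b) d') = i" by (rule C_A[OF h(5) d_lt[OF h(2)] h(7)])
    moreover have "R b (A i d') = j" by (rule R_A[OF b_lt[OF h(1)] h(6) h(8)[symmetric]])
    ultimately show ?thesis using h(9) by simp
  qed
  show "B l j \<noteq> A i d"
    if h: "b < 2" "d < 3" "l < n" "j < n" "i < n" "(l, j) \<noteq> (0, 0)" "A b j = A l d" "A (1 - b) d = A i j" for b d l j i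
    using sw_B[rule_format, OF h(1-3)] R_A[OF b_lt[OF h(1)] h(4,7)] C_A[OF h(5,4) h(8)[symmetric]] by simp
  show "A i j \<noteq> A q l\<^sub>2" if "i < n" "j < n" "A i l\<^sub>2 = A p j" for i j
    using path_hole[rule_format, OF that(2)] C_A[OF that(1) l(4) that(3)] by simp
  show "A (1 - b) d \<noteq> A q l\<^sub>2" if "b < 2" "d < 3" "A b l\<^sub>2 = A p d" for b d
    using path_sw[rule_format, OF that(1,2)] that(3) by simp
  show "A (1 - b) d \<noteq> A 2 3" if "b < 2" "d < 3" "A b 3 = A 2 d" for b d
    using copy_sw[rule_format, OF that(1,2)] that(3) by simp
qed (rule pq l path)+

end

lemma all_less_2: "(\<forall>i<2. P i) \<longleftrightarrow> P 0 \<and> P 1" for P :: "nat \<Rightarrow> bool"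
  by (simp add: numeral_eq_Suc All_less_Suc2)

lemma all_less_3: "(\<forall>i<3. P i) \<longleftrightarrow> P 0 \<and> P 1 \<and> P 2" for P :: "nat \<Rightarrow> bool"
  by (simp add: numeral_eq_Suc All_less_Suc2)

text \<open>The tables and the traversal words were found by computer search.\<close>

definition A8 :: "nat \<Rightarrow> nat \<Rightarrow> nat" where
  "A8 i j = [[0, 1, 2, 3, 4, 5, 6, 7],
     [1, 2, 0, 4, 5, 6, 7, 3],
     [3, 7, 1, 2, 6, 4, 0, 5],
     [7, 0, 5, 6, 3, 1, 2, 4],
     [4, 6, 3, 7, 2, 0, 5, 1],
     [5, 4, 6, 0, 7, 3, 1, 2],
     [2, 5, 4, 1, 0, 7, 3, 6],
     [6, 3, 7, 5, 1, 2, 4, 0]] ! i ! j"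

definition R8 :: "nat \<Rightarrow> nat \<Rightarrow> nat" where
  "R8 i j = [[0, 1, 2, 3, 4, 5, 6, 7],
     [2, 0, 1, 7, 3, 4, 5, 6],
     [6, 2, 3, 0, 5, 7, 4, 1],
     [1, 5, 6, 4, 7, 2, 3, 0],
     [5, 7, 4, 2, 0, 6, 1, 3],
     [3, 6, 7, 5, 1, 0, 2, 4],
     [4, 3, 0, 6, 2, 1, 7, 5],
     [7, 4, 5, 1, 6, 3, 0, 2]] ! i ! j"

definition C8 :: "nat \<Rightarrow> nat \<Rightarrow> nat" where
  "C8 i j = [[0, 1, 6, 2, 4, 5, 7, 3],
     [3, 0, 1, 7, 5, 6, 4, 2],
     [1, 2, 0, 4, 6, 3, 5, 7],
     [5, 6, 2, 0, 1, 7, 3, 4],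
     [6, 7, 4, 3, 0, 1, 2, 5],
     [4, 3, 7, 5, 2, 0, 1, 6],
     [2, 5, 3, 6, 7, 4, 0, 1],
     [7, 4, 5, 1, 3, 2, 6, 0]] ! i ! j"

definition B8 :: "nat \<Rightarrow> nat \<Rightarrow> nat" where
  "B8 i j = [[0, 3, 4, 6, 7, 1, 2, 5],
     [4, 6, 3, 7, 1, 5, 0, 2],
     [7, 0, 2, 5, 4, 6, 3, 1],
     [2, 4, 1, 0, 6, 7, 5, 3],
     [6, 5, 7, 2, 3, 4, 1, 0],
     [1, 7, 0, 3, 5, 2, 4, 6],
     [3, 1, 5, 4, 2, 0, 6, 7],
     [5, 2, 6, 1, 0, 3, 7, 4]] ! i ! j"

definition R8' :: "nat \<Rightarrow> nat \<Rightarrow> nat" where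
  "R8' i j = [[0, 5, 6, 1, 2, 7, 3, 4],
     [6, 4, 7, 2, 0, 5, 1, 3],
     [1, 7, 2, 6, 4, 3, 5, 0],
     [3, 2, 0, 7, 1, 6, 4, 5],
     [7, 6, 3, 4, 5, 1, 0, 2],
     [2, 0, 5, 3, 6, 4, 7, 1],
     [5, 1, 4, 0, 3, 2, 6, 7],
     [4, 3, 1, 5, 7, 0, 2, 6]] ! i ! j"

definition C8' :: "nat \<Rightarrow> nat \<Rightarrow> nat" where
  "C8' i j = [[0, 5, 3, 6, 1, 7, 4, 2],
     [2, 6, 7, 0, 3, 4, 1, 5],
     [5, 3, 2, 1, 0, 6, 7, 4],
     [3, 7, 4, 5, 6, 2, 0, 1],
     [7, 1, 6, 4, 2, 5, 3, 0],
     [6, 0, 5, 7, 4, 1, 2, 3],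
     [1, 4, 0, 2, 5, 3, 6, 7],
     [4, 2, 1, 3, 7, 0, 5, 6]] ! i ! j"

text \<open>Stated for the table as a whole, so that unfolding \<open>map\<close> and comparing
  lists yields 64 ground equations at once. The final check rewrites with these and does not
  evaluate \<open>nth\<close>.\<close>

lemma A8_rows:
  "map (\<lambda>i. map (A8 i) [0, 1, 2, 3, 4, 5, 6, 7]) [0, 1, 2, 3, 4, 5, 6, 7] =
    [[0, 1, 2, 3, 4, 5, 6, 7],
     [1, 2, 0, 4, 5, 6, 7, 3],
     [3, 7, 1, 2, 6, 4, 0, 5],
     [7, 0, 5, 6, 3, 1, 2, 4],
     [4, 6, 3, 7, 2, 0, 5, 1],
     [5, 4, 6, 0, 7, 3, 1, 2],
     [2, 5, 4, 1, 0, 7, 3, 6],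
     [6, 3, 7, 5, 1, 2, 4, 0]]"
  by (simp add: A8_def)

lemma R8_rows:
  "map (\<lambda>i. map (R8 i) [0, 1, 2, 3, 4, 5, 6, 7]) [0, 1, 2, 3, 4, 5, 6, 7] =
    [[0, 1, 2, 3, 4, 5, 6, 7],
     [2, 0, 1, 7, 3, 4, 5, 6],
     [6, 2, 3, 0, 5, 7, 4, 1],
     [1, 5, 6, 4, 7, 2, 3, 0],
     [5, 7, 4, 2, 0, 6, 1, 3],
     [3, 6, 7, 5, 1, 0, 2, 4],
     [4, 3, 0, 6, 2, 1, 7, 5],
     [7, 4, 5, 1, 6, 3, 0, 2]]"
  by (simp add: R8_def)

lemma C8_rows:
  "map (\<lambda>i. map (C8 i) [0, 1, 2, 3, 4, 5, 6, 7]) [0, 1, 2, 3, 4, 5, 6, 7] =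
    [[0, 1, 6, 2, 4, 5, 7, 3],
     [3, 0, 1, 7, 5, 6, 4, 2],
     [1, 2, 0, 4, 6, 3, 5, 7],
     [5, 6, 2, 0, 1, 7, 3, 4],
     [6, 7, 4, 3, 0, 1, 2, 5],
     [4, 3, 7, 5, 2, 0, 1, 6],
     [2, 5, 3, 6, 7, 4, 0, 1],
     [7, 4, 5, 1, 3, 2, 6, 0]]"
  by (simp add: C8_def)

lemma B8_rows:
  "map (\<lambda>i. map (B8 i) [0, 1, 2, 3, 4, 5, 6, 7]) [0, 1, 2, 3, 4, 5, 6, 7] =
    [[0, 3, 4, 6, 7, 1, 2, 5],
     [4, 6, 3, 7, 1, 5, 0, 2],
     [7, 0, 2, 5, 4, 6, 3, 1],
     [2, 4, 1, 0, 6, 7, 5, 3],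
     [6, 5, 7, 2, 3, 4, 1, 0],
     [1, 7, 0, 3, 5, 2, 4, 6],
     [3, 1, 5, 4, 2, 0, 6, 7],
     [5, 2, 6, 1, 0, 3, 7, 4]]"
  by (simp add: B8_def)

lemma R8'_rows:
  "map (\<lambda>i. map (R8' i) [0, 1, 2, 3, 4, 5, 6, 7]) [0, 1, 2, 3, 4, 5, 6, 7] =
    [[0, 5, 6, 1, 2, 7, 3, 4],
     [6, 4, 7, 2, 0, 5, 1, 3],
     [1, 7, 2, 6, 4, 3, 5, 0],
     [3, 2, 0, 7, 1, 6, 4, 5],
     [7, 6, 3, 4, 5, 1, 0, 2],
     [2, 0, 5, 3, 6, 4, 7, 1],
     [5, 1, 4, 0, 3, 2, 6, 7],
     [4, 3, 1, 5, 7, 0, 2, 6]]"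
  by (simp add: R8'_def)

lemma C8'_rows:
  "map (\<lambda>i. map (C8' i) [0, 1, 2, 3, 4, 5, 6, 7]) [0, 1, 2, 3, 4, 5, 6, 7] =
    [[0, 5, 3, 6, 1, 7, 4, 2],
     [2, 6, 7, 0, 3, 4, 1, 5],
     [5, 3, 2, 1, 0, 6, 7, 4],
     [3, 7, 4, 5, 6, 2, 0, 1],
     [7, 1, 6, 4, 2, 5, 3, 0],
     [6, 0, 5, 7, 4, 1, 2, 3],
     [1, 4, 0, 2, 5, 3, 6, 7],
     [4, 2, 1, 3, 7, 0, 5, 6]]"
  by (simp add: C8'_def)

lemmas tables8 = A8_rows[unfolded list.map list.inject simp_thms]
  R8_rows[unfolded list.map list.inject simp_thms]
  C8_rows[unfolded list.map list.inject simp_thms]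
  B8_rows[unfolded list.map list.inject simp_thms]
  R8'_rows[unfolded list.map list.inject simp_thms]
  C8'_rows[unfolded list.map list.inject simp_thms]

lemma all_less_8: "(\<forall>i<8. P i) \<longleftrightarrow> P 0 \<and> P 1 \<and> P 2 \<and> P 3 \<and> P 4 \<and> P 5 \<and> P 6 \<and> P 7" for P :: "nat \<Rightarrow> bool"
  by (simp add: numeral_eq_Suc All_less_Suc2)

lemma add_3_mod_8:
  "(0 + 3) mod 8 = (3 :: nat)"
  "(1 + 3) mod 8 = (4 :: nat)"
  "(2 + 3) mod 8 = (5 :: nat)"
  "(3 + 3) mod 8 = (6 :: nat)"
  "(4 + 3) mod 8 = (7 :: nat)"
  "(5 + 3) mod 8 = (0 :: nat)"
  "(6 + 3) mod 8 = (1 :: nat)"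
  "(7 + 3) mod 8 = (2 :: nat)"
  by simp_all

text \<open>The path in rows 3 and 2 runs through the symbols 7, 3, 6, 2, and 2 is 7 + 3 modulo 8.
  Bounded quantifiers become finite conjunctions; \<open>if_weak_cong\<close> keeps a branch
  untouched until its test is decided.\<close>

lemma corrupting_tables_8:
  "corrupting_tables 8 A8 R8 C8 B8 R8' C8' 3 2 0 4 3
    [False, False, False, False, False, False, False, True, False, False, False, False, False, True, False, True, True, True, True, True, True, True]"
  by unfold_locales
    (simp only: all_less_8 all_less_2 all_less_3 tables8 add_3_mod_8 hole3_tab_def walk.simps list.set
      insert_iff empty_iff insert_subset empty_subsetI if_True if_False not_False_eq_True not_True_eq_False
      rel_simps simp_thms zero_neq_one one_neq_zero diff_zero diff_self_eq_0 cong: if_weak_cong)+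

definition A9 :: "nat \<Rightarrow> nat \<Rightarrow> nat" where
  "A9 i j = [[0, 1, 2, 3, 4, 5, 6, 7, 8],
     [1, 2, 0, 4, 8, 3, 7, 5, 6],
     [3, 5, 1, 7, 6, 8, 2, 0, 4],
     [4, 6, 5, 2, 3, 7, 8, 1, 0],
     [6, 0, 7, 5, 1, 4, 3, 8, 2],
     [5, 4, 6, 8, 0, 2, 1, 3, 7],
     [2, 8, 4, 1, 7, 0, 5, 6, 3],
     [7, 3, 8, 0, 5, 6, 4, 2, 1],
     [8, 7, 3, 6, 2, 1, 0, 4, 5]] ! i ! j"

definition R9 :: "nat \<Rightarrow> nat \<Rightarrow> nat" where
  "R9 i j = [[0, 1, 2, 3, 4, 5, 6, 7, 8],
     [2, 0, 1, 5, 3, 7, 8, 6, 4],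
     [7, 2, 6, 0, 8, 1, 4, 3, 5],
     [8, 7, 3, 4, 0, 2, 1, 5, 6],
     [1, 4, 8, 6, 5, 3, 0, 2, 7],
     [4, 6, 5, 7, 1, 0, 2, 8, 3],
     [5, 3, 0, 8, 2, 6, 7, 4, 1],
     [3, 8, 7, 1, 6, 4, 5, 0, 2],
     [6, 5, 4, 2, 7, 8, 3, 1, 0]] ! i ! j"

definition C9 :: "nat \<Rightarrow> nat \<Rightarrow> nat" where
  "C9 i j = [[0, 1, 6, 2, 3, 5, 4, 7, 8],
     [4, 0, 1, 7, 5, 2, 3, 8, 6],
     [1, 2, 0, 8, 6, 3, 5, 4, 7],
     [7, 6, 3, 0, 1, 4, 8, 2, 5],
     [5, 4, 8, 3, 0, 7, 2, 6, 1],
     [6, 8, 5, 1, 4, 0, 7, 3, 2],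
     [8, 5, 2, 4, 7, 6, 0, 1, 3],
     [2, 3, 7, 5, 8, 1, 6, 0, 4],
     [3, 7, 4, 6, 2, 8, 1, 5, 0]] ! i ! j"

definition B9 :: "nat \<Rightarrow> nat \<Rightarrow> nat" where
  "B9 i j = [[0, 3, 4, 2, 6, 1, 5, 8, 7],
     [6, 7, 3, 8, 1, 2, 0, 4, 5],
     [8, 4, 0, 5, 2, 6, 7, 1, 3],
     [3, 5, 7, 6, 4, 8, 2, 0, 1],
     [7, 1, 2, 0, 8, 5, 4, 3, 6],
     [1, 2, 8, 7, 3, 4, 6, 5, 0],
     [4, 0, 6, 3, 5, 7, 1, 2, 8],
     [5, 8, 1, 4, 7, 0, 3, 6, 2],
     [2, 6, 5, 1, 0, 3, 8, 7, 4]] ! i ! j"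

definition R9' :: "nat \<Rightarrow> nat \<Rightarrow> nat" where
  "R9' i j = [[0, 5, 3, 1, 2, 6, 4, 8, 7],
     [6, 4, 5, 2, 7, 8, 0, 1, 3],
     [2, 7, 4, 8, 1, 3, 5, 6, 0],
     [7, 8, 6, 0, 4, 1, 3, 2, 5],
     [3, 1, 2, 7, 6, 5, 8, 0, 4],
     [8, 0, 1, 4, 5, 7, 6, 3, 2],
     [1, 6, 7, 3, 0, 4, 2, 5, 8],
     [5, 2, 8, 6, 3, 0, 7, 4, 1],
     [4, 3, 0, 5, 8, 2, 1, 7, 6]] ! i ! j"

definition C9' :: "nat \<Rightarrow> nat \<Rightarrow> nat" where
  "C9' i j = [[0, 5, 8, 3, 6, 7, 1, 4, 2],
     [6, 4, 5, 0, 2, 3, 8, 1, 7],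
     [2, 7, 4, 1, 0, 8, 6, 3, 5],
     [4, 8, 0, 6, 7, 2, 3, 5, 1],
     [8, 1, 2, 5, 3, 6, 0, 7, 4],
     [7, 0, 1, 8, 5, 4, 2, 6, 3],
     [1, 6, 3, 7, 4, 0, 5, 2, 8],
     [3, 2, 6, 4, 1, 5, 7, 8, 0],
     [5, 3, 7, 2, 8, 1, 4, 0, 6]] ! i ! j"

lemma A9_rows:
  "map (\<lambda>i. map (A9 i) [0, 1, 2, 3, 4, 5, 6, 7, 8]) [0, 1, 2, 3, 4, 5, 6, 7, 8] =
    [[0, 1, 2, 3, 4, 5, 6, 7, 8],
     [1, 2, 0, 4, 8, 3, 7, 5, 6],
     [3, 5, 1, 7, 6, 8, 2, 0, 4],
     [4, 6, 5, 2, 3, 7, 8, 1, 0],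
     [6, 0, 7, 5, 1, 4, 3, 8, 2],
     [5, 4, 6, 8, 0, 2, 1, 3, 7],
     [2, 8, 4, 1, 7, 0, 5, 6, 3],
     [7, 3, 8, 0, 5, 6, 4, 2, 1],
     [8, 7, 3, 6, 2, 1, 0, 4, 5]]"
  by (simp add: A9_def)

lemma R9_rows:
  "map (\<lambda>i. map (R9 i) [0, 1, 2, 3, 4, 5, 6, 7, 8]) [0, 1, 2, 3, 4, 5, 6, 7, 8] =
    [[0, 1, 2, 3, 4, 5, 6, 7, 8],
     [2, 0, 1, 5, 3, 7, 8, 6, 4],
     [7, 2, 6, 0, 8, 1, 4, 3, 5],
     [8, 7, 3, 4, 0, 2, 1, 5, 6],
     [1, 4, 8, 6, 5, 3, 0, 2, 7],
     [4, 6, 5, 7, 1, 0, 2, 8, 3],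
     [5, 3, 0, 8, 2, 6, 7, 4, 1],
     [3, 8, 7, 1, 6, 4, 5, 0, 2],
     [6, 5, 4, 2, 7, 8, 3, 1, 0]]"
  by (simp add: R9_def)

lemma C9_rows:
  "map (\<lambda>i. map (C9 i) [0, 1, 2, 3, 4, 5, 6, 7, 8]) [0, 1, 2, 3, 4, 5, 6, 7, 8] =
    [[0, 1, 6, 2, 3, 5, 4, 7, 8],
     [4, 0, 1, 7, 5, 2, 3, 8, 6],
     [1, 2, 0, 8, 6, 3, 5, 4, 7],
     [7, 6, 3, 0, 1, 4, 8, 2, 5],
     [5, 4, 8, 3, 0, 7, 2, 6, 1],
     [6, 8, 5, 1, 4, 0, 7, 3, 2],
     [8, 5, 2, 4, 7, 6, 0, 1, 3],
     [2, 3, 7, 5, 8, 1, 6, 0, 4],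
     [3, 7, 4, 6, 2, 8, 1, 5, 0]]"
  by (simp add: C9_def)

lemma B9_rows:
  "map (\<lambda>i. map (B9 i) [0, 1, 2, 3, 4, 5, 6, 7, 8]) [0, 1, 2, 3, 4, 5, 6, 7, 8] =
    [[0, 3, 4, 2, 6, 1, 5, 8, 7],
     [6, 7, 3, 8, 1, 2, 0, 4, 5],
     [8, 4, 0, 5, 2, 6, 7, 1, 3],
     [3, 5, 7, 6, 4, 8, 2, 0, 1],
     [7, 1, 2, 0, 8, 5, 4, 3, 6],
     [1, 2, 8, 7, 3, 4, 6, 5, 0],
     [4, 0, 6, 3, 5, 7, 1, 2, 8],
     [5, 8, 1, 4, 7, 0, 3, 6, 2],
     [2, 6, 5, 1, 0, 3, 8, 7, 4]]"
  by (simp add: B9_def)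

lemma R9'_rows:
  "map (\<lambda>i. map (R9' i) [0, 1, 2, 3, 4, 5, 6, 7, 8]) [0, 1, 2, 3, 4, 5, 6, 7, 8] =
    [[0, 5, 3, 1, 2, 6, 4, 8, 7],
     [6, 4, 5, 2, 7, 8, 0, 1, 3],
     [2, 7, 4, 8, 1, 3, 5, 6, 0],
     [7, 8, 6, 0, 4, 1, 3, 2, 5],
     [3, 1, 2, 7, 6, 5, 8, 0, 4],
     [8, 0, 1, 4, 5, 7, 6, 3, 2],
     [1, 6, 7, 3, 0, 4, 2, 5, 8],
     [5, 2, 8, 6, 3, 0, 7, 4, 1],
     [4, 3, 0, 5, 8, 2, 1, 7, 6]]"
  by (simp add: R9'_def)

lemma C9'_rows:
  "map (\<lambda>i. map (C9' i) [0, 1, 2, 3, 4, 5, 6, 7, 8]) [0, 1, 2, 3, 4, 5, 6, 7, 8] =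
    [[0, 5, 8, 3, 6, 7, 1, 4, 2],
     [6, 4, 5, 0, 2, 3, 8, 1, 7],
     [2, 7, 4, 1, 0, 8, 6, 3, 5],
     [4, 8, 0, 6, 7, 2, 3, 5, 1],
     [8, 1, 2, 5, 3, 6, 0, 7, 4],
     [7, 0, 1, 8, 5, 4, 2, 6, 3],
     [1, 6, 3, 7, 4, 0, 5, 2, 8],
     [3, 2, 6, 4, 1, 5, 7, 8, 0],
     [5, 3, 7, 2, 8, 1, 4, 0, 6]]"
  by (simp add: C9'_def)

lemmas tables9 = A9_rows[unfolded list.map list.inject simp_thms]
  R9_rows[unfolded list.map list.inject simp_thms]
  C9_rows[unfolded list.map list.inject simp_thms]
  B9_rows[unfolded list.map list.inject simp_thms]
  R9'_rows[unfolded list.map list.inject simp_thms]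
  C9'_rows[unfolded list.map list.inject simp_thms]

lemma all_less_9: "(\<forall>i<9. P i) \<longleftrightarrow> P 0 \<and> P 1 \<and> P 2 \<and> P 3 \<and> P 4 \<and> P 5 \<and> P 6 \<and> P 7 \<and> P 8" for P :: "nat \<Rightarrow> bool"
  by (simp add: numeral_eq_Suc All_less_Suc2)

lemma add_3_mod_9:
  "(0 + 3) mod 9 = (3 :: nat)"
  "(1 + 3) mod 9 = (4 :: nat)"
  "(2 + 3) mod 9 = (5 :: nat)"
  "(3 + 3) mod 9 = (6 :: nat)"
  "(4 + 3) mod 9 = (7 :: nat)"
  "(5 + 3) mod 9 = (8 :: nat)"
  "(6 + 3) mod 9 = (0 :: nat)"
  "(7 + 3) mod 9 = (1 :: nat)"
  "(8 + 3) mod 9 = (2 :: nat)"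
  by simp_all

text \<open>The path in rows 2 and 3 runs through the symbols 6, 3, 4, 0, and 0 is 6 + 3 modulo
  9.\<close>

lemma corrupting_tables_9:
  "corrupting_tables 9 A9 R9 C9 B9 R9' C9' 2 3 4 0 8
    [False, False, False, False, False, False, False, False, True, True, False, False, False, True, False, False, False, False, False, True, False, False, False, True, True]"
  by unfold_locales
    (simp only: all_less_9 all_less_2 all_less_3 tables9 add_3_mod_9 hole3_tab_def walk.simps list.set
      insert_iff empty_iff insert_subset empty_subsetI if_True if_False not_False_eq_True not_True_eq_False
      rel_simps simp_thms zero_neq_one one_neq_zero diff_zero diff_self_eq_0 cong: if_weak_cong)+

theorem theorem3p7:
  fixes \<mu> :: int
  assumes "\<mu> \<in> N_X"
  shows "{8 * \<mu>, 9 * \<mu>} \<subseteq> N_X"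
proof -
  obtain m L s where m: "\<mu> = int m" "(L, s) \<in> X_family m" using assms unfolding N_X_def by blast
  have "int (8 * m) \<in> N_X"
    by (rule corrupting_step.multiply_order[OF corrupting_tables.step[OF corrupting_tables_8] m(2)])
  moreover have "int (9 * m) \<in> N_X"
    by (rule corrupting_step.multiply_order[OF corrupting_tables.step[OF corrupting_tables_9] m(2)])
  ultimately show ?thesis using m(1) by simp
qed

end
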